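(* Assume a periodic boundary condition in space and an infinite velocity domain. Let $(\mathbf f^{n+1},\mathbf B^{n+1},\mathbf p^{n+1})$ be obtained from $(\mathbf f^{n},\mathbf B^{n},\mathbf p^{n})$ by one step of the fully discrete scheme of sub-step $pvb$ described in the context, where initially $\nabla\cdot\boldsymbol B_h^n=0$. Then: 1. the discrete mass, momentum and energy are conserved: $\mathcal M_h^{n+1}=\mathcal M_h^n$, $\mathcal P_{h,\alpha}^{n+1}=\mathcal P_{h,\alpha}^n$ for $\alpha=1,2,3$, and $\mathcal E_h^{n+1}=\mathcal E_h^n$; 2. the cancellation problem is overcome: at every spatial grid point the contributions of $\boldsymbol v\times\boldsymbol B$ and $-\bar{\boldsymbol u}\times\boldsymbol B$ to the change of the mean velocity cancel, so that $$\mathbf u_{\boldsymbol i}^{n+1}-\mathbf u_{\boldsymbol i}^n=\Delta t\,\frac{\nabla\times\boldsymbol B_h^{n+\frac12}(\mathbf x_{\boldsymbol i})}{\rho_{\boldsymbol i}}\times\mathbf B_{\boldsymbol i}^{n+\frac12}-\Delta t\,\frac{\nabla p_h^{n+\frac12}(\mathbf x_{\boldsymbol i})}{\rho_{\boldsymbol i}};$$ 3. the magnetic field obtained is divergence free: $\nabla\cdot\boldsymbol B_h^{n+1}=0$.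
   Context: **Grids.** Space is the periodic box $\prod_{\alpha=1}^3[0,L_\alpha]$ with uniform grid points $\mathbf x_{\boldsymbol i}$, $M_\alpha$ points in direction $\alpha$, $\Delta x_\alpha=L_\alpha/M_\alpha$, $\Delta\boldsymbol x=\prod_\alpha\Delta x_\alpha$. Velocity grids are uniform and infinite: $\mathbf v_{\boldsymbol j}=(v^1_{j_1},v^2_{j_2},v^3_{j_3})$, $\boldsymbol j\in\mathbb Z^3$, with spacings $\Delta v_\alpha$, $\Delta\boldsymbol v=\prod_\alpha\Delta v_\alpha$. $\Delta t>0$ is the time step and $t^{n+1}=t^n+\Delta t$; $\gamma\ne1$ is a constant. **Unknowns.** $\mathbf f=(f_{\boldsymbol i\boldsymbol j})$ (distribution function on the phase-space grid), $\mathbf B_{\boldsymbol i}=(B_{1,\boldsymbol i},B_{2,\boldsymbol i},B_{3,\boldsymbol i})\in\mathbb R^3$ and $p_{\boldsymbol i}\in\mathbb R$ (magnetic field and pressure on the spatial grid). For a grid function, the subscript $h$ denotes its trigonometric interpolation polynomial, i.e. the combination of $e^{\mathrm i\boldsymbol\xi\cdot\boldsymbol x}$, $\xi_\alpha\in\frac{2\pi}{L_\alpha}\{-\lfloor\frac{M_\alpha-1}2\rfloor,\dots,\lfloor\frac{M_\alpha}2\rfloor\}$, with the given grid values; $\mathcal I_t\boldsymbol h$ denotes the (componentwise) trigonometric interpolation polynomial of the grid values of a function $\boldsymbol h$. $\nabla,\nabla\times,\nabla\cdot$ act exactly on these polynomials. All fields and their trigonometric interpolants are real-valued. For a field $a$,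 $a^{n+\frac12}=\frac12(a^n+a^{n+1})$. **Moments.** $\rho_{\boldsymbol i}=\sum_{\boldsymbol j}f_{\boldsymbol i\boldsymbol j}\Delta\boldsymbol v$ (assumed nonzero; it does not change during the step), $\mathbf u_{\boldsymbol i}=\rho_{\boldsymbol i}^{-1}\sum_{\boldsymbol j}\mathbf v_{\boldsymbol j}f_{\boldsymbol i\boldsymbol j}\Delta\boldsymbol v$. It is assumed that $\mathbf f$ decays in velocity so that sums of $f_{\boldsymbol i\boldsymbol j}$ weighted by velocity polynomials of degree $\le2$ converge absolutely. **Discrete invariants.** $\mathcal M_h=\sum_{\boldsymbol i\boldsymbol j}f_{\boldsymbol i\boldsymbol j}\Delta\boldsymbol x\Delta\boldsymbol v$, $\ \mathcal P_{h,\alpha}=\sum_{\boldsymbol i\boldsymbol j}v^\alpha_{j_\alpha}f_{\boldsymbol i\boldsymbol j}\Delta\boldsymbol x\Delta\boldsymbol v$, $$\mathcal E_h=\frac12\sum_{\boldsymbol i\boldsymbol j}|\mathbf v_{\boldsymbol j}|^2f_{\boldsymbol i\boldsymbol j}\Delta\boldsymbol x\Delta\boldsymbol v+\frac12\sum_{\boldsymbol i}|\mathbf B_{\boldsymbol i}|^2\Delta\boldsymbol x+\frac1{\gamma-1}\sum_{\boldsymbol i}p_{\boldsymbol i}\Delta\boldsymbol x .$$ **One-dimensional cubic spline advection.** On a uniform grid $\{z_i\}_{i\in\mathbb Z}$ of spacing $\Delta z$, the advection with displacement $\delta$ maps $(f_i)$ to $(\mathcal If(z_i-\delta))$, where $\mathcal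 If(z)=\sum_j e_jC(z-z_j)$ is the cubic spline interpolant, $\mathcal If(z_i)=f_i$ (with coefficients $e_j$ decaying like $f$), and $C(z)=\frac16(2-|z|/\Delta z)^3$ if $\Delta z\le|z|<2\Delta z$, $C(z)=\frac16(4-6(|z|/\Delta z)^2+3(|z|/\Delta z)^3)$ if $|z|<\Delta z$, $C(z)=0$ otherwise. A multi-dimensional distribution is advected in velocity direction $k$ by applying this along each grid line parallel to $v_k$, with a displacement that may depend on $\boldsymbol i$ and on the other velocity components. Replacing $f(\boldsymbol v)$ by $f(\boldsymbol v+\boldsymbol a)$ with $\boldsymbol a$ independent of $\boldsymbol v$ means performing successively, for $k=1,2,3$, the advection in direction $k$ with displacement $-a_k$. **Auxiliary quantities at each $\mathbf x_{\boldsymbol i}$.** $\hat{\mathbf B}_{\boldsymbol i}^{n+\frac12}\boldsymbol v:=\boldsymbol v\times\mathbf B_{\boldsymbol i}^{n+\frac12}$. With $\boldsymbol g_{\boldsymbol i}=\nabla p_h^{n+\frac12}(\mathbf x_{\boldsymbol i})/\rho_{\boldsymbol i}$: if $\mathbf B^{n+\frac12}_{\boldsymbol i}\ne0$, $(\boldsymbol g_{\boldsymbol i})_\parallel=\frac{\boldsymbol g_{\boldsymbol i}\cdot\mathbf B_{\boldsymbol i}^{n+\frac12}}{|\mathbf B_{\boldsymbol i}^{n+\frac12}|^2}\mathbf B_{\boldsymbol i}^{n+\frac12}$ and $\mathbf q_{\boldsymbol i}=\frac{\mathbf B_{\boldsymbol i}^{n+\frac12}}{|\mathbf B_{\boldsymbol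 i}^{n+\frac12}|^2}\times\boldsymbol g_{\boldsymbol i}$; if $\mathbf B^{n+\frac12}_{\boldsymbol i}=0$, $(\boldsymbol g_{\boldsymbol i})_\parallel=\boldsymbol g_{\boldsymbol i}$ and $\mathbf q_{\boldsymbol i}=0$. The vector $\bar{\mathbf u}_{\boldsymbol i}$ satisfies $\bar{\mathbf u}_{\boldsymbol i}=\frac1{\Delta t}\int_{t^n}^{t^{n+1}}\mathbf u_{\boldsymbol i}(t)\,\mathrm dt$, where $$\frac{\mathrm d\mathbf u_{\boldsymbol i}}{\mathrm dt}=\Big(\mathbf u_{\boldsymbol i}-\bar{\mathbf u}_{\boldsymbol i}+\frac{\nabla\times\boldsymbol B_h^{n+\frac12}(\mathbf x_{\boldsymbol i})}{\rho_{\boldsymbol i}}\Big)\times\mathbf B_{\boldsymbol i}^{n+\frac12}-\frac{\nabla p_h^{n+\frac12}(\mathbf x_{\boldsymbol i})}{\rho_{\boldsymbol i}},\qquad\mathbf u_{\boldsymbol i}(t^n)=\mathbf u_{\boldsymbol i}^n .$$ Set $\boldsymbol w_{\boldsymbol i}=\bar{\mathbf u}_{\boldsymbol i}+\mathbf q_{\boldsymbol i}-\nabla\times\boldsymbol B_h^{n+\frac12}(\mathbf x_{\boldsymbol i})/\rho_{\boldsymbol i}$. **Scheme.** (a) $\mathbf f^{n+1}=\mathcal T_3\mathcal T_2\mathcal T_1\mathcal T_0\mathbf f^n$, where, at each $\mathbf x_{\boldsymbol i}$ and with all advections done by cubic splines: $\mathcal T_0$ replaces $f(\boldsymbol v)$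 by $f(\boldsymbol v+\Delta t(\boldsymbol g_{\boldsymbol i})_\parallel)$; $\mathcal T_1$ replaces $f(\boldsymbol v)$ by $f(\boldsymbol v+\boldsymbol w_{\boldsymbol i})$; $\mathcal T_3$ replaces $f(\boldsymbol v)$ by $f(\boldsymbol v-\boldsymbol w_{\boldsymbol i})$; $\mathcal T_2$ is the rotation $f(\boldsymbol v)\to f(e^{-\Delta t\hat{\mathbf B}_{\boldsymbol i}^{n+\frac12}}\boldsymbol v)$ performed through an exact splitting into four shears: for a fixed $s\in\{1,2,3\}$ one takes vectors $y^{(l)},y^{(r)},y^{(k)}\in\mathbb R^3$ ($k\ne s$; they depend on $\mathbf B_{\boldsymbol i}^{n+\frac12}$ and $\Delta t$) with $y^{(l)}_s=y^{(r)}_s=0$, $y^{(k)}_k=0$, such that the operator identity $$e^{-\Delta t\hat{\mathbf B}_{\boldsymbol i}^{n+\frac12}\boldsymbol v\cdot\nabla_v}=e^{\Delta t\,(y^{(l)}\cdot\boldsymbol v)\partial_{v_s}}\Big(\prod_{k\ne s}e^{\Delta t\,(y^{(k)}\cdot\boldsymbol v)\partial_{v_k}}\Big)e^{\Delta t\,(y^{(r)}\cdot\boldsymbol v)\partial_{v_s}}$$ holds exactly, and each factor $e^{\Delta t(y\cdot\boldsymbol v)\partial_{v_k}}$ (which maps $g(\boldsymbol v)$ to $g(\boldsymbol v+\Delta t(y\cdot\boldsymbol v)\boldsymbol e_k)$, $\boldsymbol e_k$ the $k$-th unit vector) is realized by cubic spline advection in direction $k$ with displacement $-\Delta t\,y\cdot\boldsymbol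 v$. (b) $\displaystyle\mathbf B_{\boldsymbol i}^{n+1}=\mathbf B_{\boldsymbol i}^n+\Delta t\,\nabla\times\mathcal I_t\Big(\bar{\boldsymbol u}_h\times\boldsymbol B_h^{n+\frac12}-\frac{\nabla\times\boldsymbol B_h^{n+\frac12}}{\rho_h}\times\boldsymbol B_h^{n+\frac12}+\frac{\nabla p_h^{n+\frac12}}{\rho_h}\Big)(\mathbf x_{\boldsymbol i})$. (c) $\displaystyle\frac{p_{\boldsymbol i}^{n+1}-p_{\boldsymbol i}^n}{\Delta t}+\nabla\cdot\mathcal I_t\big(\boldsymbol u_{e,h}^{n+\frac12}p_h^{n+\frac12}\big)(\mathbf x_{\boldsymbol i})+(\gamma-1)p_{\boldsymbol i}^{n+\frac12}\big(\nabla\cdot\mathcal I_t\boldsymbol u_{e,h}^{n+\frac12}\big)(\mathbf x_{\boldsymbol i})=0$, with $\boldsymbol u_{e,h}^{n+\frac12}=\bar{\boldsymbol u}_h-\frac{\nabla\times\boldsymbol B_h^{n+\frac12}}{\rho_h}$. "Cancellation problem": in the continuous sub-step the contributions of $\boldsymbol v\times\boldsymbol B$ and $-\boldsymbol u\times\boldsymbol B$ cancel in the evolution of $\boldsymbol u$, giving $\partial_t\boldsymbol u=-\nabla p/\rho+(\nabla\times\boldsymbol B)\times\boldsymbol B/\rho$; the problem is overcome when this cancellation is preserved by the discretization. *)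

theory Defs
  imports "HOL-Analysis.Analysis"
begin

unbundle cross3_syntax

section \<open>Spatial grid and trigonometric interpolation\<close>

text \<open>
  The box is the product of the intervals \<open>[0, box_len G $ a]\<close>.  The position of the
  uniform periodic grid relative to the box (nodes at cell corners, cell centres, ...) is left
  open by means of \<open>origin\<close>.
\<close>

record space_grid =
  box_len :: "real^3"
  pts :: "nat^3"
  origin :: "real^3"

definition mesh :: "space_grid \<Rightarrow> real^3" where
  "mesh G = (\<chi> a. box_len G $ a / real (pts G $ a))"

definition valid_space_grid :: "space_grid \<Rightarrow> bool" where
  "valid_space_grid G \<longleftrightarrow>
     (\<forall>a. 0 < box_len G $ a \<and> 0 < pts G $ a \<and> 0 \<le> origin G $ a \<and> origin G $ a < mesh G $ a)"

definition cells :: "space_grid \<Rightarrow> (nat^3) set" where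
  "cells G = {i. \<forall>a. i $ a < pts G $ a}"

definition node :: "space_grid \<Rightarrow> nat^3 \<Rightarrow> real^3" where
  "node G i = (\<chi> a. origin G $ a + real (i $ a) * mesh G $ a)"

definition space_vol :: "space_grid \<Rightarrow> real" where
  "space_vol G = (\<Prod>a\<in>UNIV. mesh G $ a)"

definition wave_vectors :: "space_grid \<Rightarrow> (real^3) set" where
  "wave_vectors G = {\<xi>. \<forall>a. \<exists>k::int.
     - ((int (pts G $ a) - 1) div 2) \<le> k \<and> k \<le> int (pts G $ a) div 2 \<and>
     \<xi> $ a = 2 * pi / box_len G $ a * of_int k}"

definition trig_poly :: "space_grid \<Rightarrow> (real^3 \<Rightarrow> complex) \<Rightarrow> bool" where
  "trig_poly G P \<longleftrightarrow>
     (\<exists>c. P = (\<lambda>x. \<Sum>\<xi>\<in>wave_vectors G. c \<xi> * exp (\<i> * complex_of_real (\<xi> \<bullet> x))))"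

definition trig_interp :: "space_grid \<Rightarrow> (nat^3 \<Rightarrow> real) \<Rightarrow> real^3 \<Rightarrow> complex" where
  "trig_interp G g =
     (THE P. trig_poly G P \<and> (\<forall>i\<in>cells G. P (node G i) = complex_of_real (g i)))"

text \<open>
  For an even number of points the set of wave vectors is not symmetric, so that the interpolant
  of real grid values need not be real.  Real-valuedness is the hypothesis \<open>real_interp\<close>;
  under it, taking the real part in \<open>interp\<close> only changes the type.
\<close>

definition real_interp :: "space_grid \<Rightarrow> (nat^3 \<Rightarrow> real) \<Rightarrow> bool" where
  "real_interp G g \<longleftrightarrow> (\<forall>x. trig_interp G g x \<in> \<real>)"

definition real_vinterp :: "space_grid \<Rightarrow> (nat^3 \<Rightarrow> real^3) \<Rightarrow> bool" where
  "real_vinterp G h \<longleftrightarrow> (\<forall>a. real_interp G (\<lambda>i. h i $ a))"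

definition interp :: "space_grid \<Rightarrow> (nat^3 \<Rightarrow> real) \<Rightarrow> real^3 \<Rightarrow> real" where
  "interp G g x = Re (trig_interp G g x)"

definition vinterp :: "space_grid \<Rightarrow> (nat^3 \<Rightarrow> real^3) \<Rightarrow> real^3 \<Rightarrow> real^3" where
  "vinterp G h x = (\<chi> a. interp G (\<lambda>i. h i $ a) x)"

definition sample :: "space_grid \<Rightarrow> (real^3 \<Rightarrow> 'b) \<Rightarrow> nat^3 \<Rightarrow> 'b" where
  "sample G F i = F (node G i)"


section \<open>Vector calculus\<close>

definition pderiv_at :: "3 \<Rightarrow> (real^3 \<Rightarrow> real) \<Rightarrow> real^3 \<Rightarrow> real" where
  "pderiv_at a F x = frechet_derivative F (at x) (axis a 1)"

definition grad :: "(real^3 \<Rightarrow> real) \<Rightarrow> real^3 \<Rightarrow> real^3" where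
  "grad F x = (\<chi> a. pderiv_at a F x)"

definition divergence :: "(real^3 \<Rightarrow> real^3) \<Rightarrow> real^3 \<Rightarrow> real" where
  "divergence A x = (\<Sum>a\<in>UNIV. pderiv_at a (\<lambda>y. A y $ a) x)"

definition curl :: "(real^3 \<Rightarrow> real^3) \<Rightarrow> real^3 \<Rightarrow> real^3" where
  "curl A x = vector
     [pderiv_at 2 (\<lambda>y. A y $ 3) x - pderiv_at 3 (\<lambda>y. A y $ 2) x,
      pderiv_at 3 (\<lambda>y. A y $ 1) x - pderiv_at 1 (\<lambda>y. A y $ 3) x,
      pderiv_at 1 (\<lambda>y. A y $ 2) x - pderiv_at 2 (\<lambda>y. A y $ 1) x]"


section \<open>Velocity grid, moments and discrete invariants\<close>

record vel_grid =
  vorigin :: "real^3"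
  vspacing :: "real^3"

definition valid_vel_grid :: "vel_grid \<Rightarrow> bool" where
  "valid_vel_grid V \<longleftrightarrow> (\<forall>a. 0 < vspacing V $ a)"

definition vel :: "vel_grid \<Rightarrow> int^3 \<Rightarrow> real^3" where
  "vel V j = (\<chi> a. vorigin V $ a + of_int (j $ a) * vspacing V $ a)"

definition vel_vol :: "vel_grid \<Rightarrow> real" where
  "vel_vol V = (\<Prod>a\<in>UNIV. vspacing V $ a)"

text \<open>\<open>c + b \<bullet> v + v \<bullet> (A *v v)\<close> is the general polynomial of degree at most two.\<close>

definition vel_decay :: "vel_grid \<Rightarrow> (int^3 \<Rightarrow> real) \<Rightarrow> bool" where
  "vel_decay V f \<longleftrightarrow> (\<forall>(c::real) (b::real^3) (A::real^3^3).
     (\<lambda>j. \<bar>(c + b \<bullet> vel V j + vel V j \<bullet> (A *v vel V j)) * f j\<bar>) summable_on UNIV)"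

definition mass_density :: "vel_grid \<Rightarrow> (int^3 \<Rightarrow> real) \<Rightarrow> real" where
  "mass_density V f = (\<Sum>\<^sub>\<infinity>j. f j * vel_vol V)"

definition mean_vel :: "vel_grid \<Rightarrow> (int^3 \<Rightarrow> real) \<Rightarrow> real^3" where
  "mean_vel V f = (1 / mass_density V f) *\<^sub>R (\<Sum>\<^sub>\<infinity>j. (f j * vel_vol V) *\<^sub>R vel V j)"

definition total_mass :: "space_grid \<Rightarrow> vel_grid \<Rightarrow> (nat^3 \<Rightarrow> int^3 \<Rightarrow> real) \<Rightarrow> real" where
  "total_mass G V f = (\<Sum>i\<in>cells G. \<Sum>\<^sub>\<infinity>j. f i j * space_vol G * vel_vol V)"

definition total_momentum ::
    "space_grid \<Rightarrow> vel_grid \<Rightarrow> (nat^3 \<Rightarrow> int^3 \<Rightarrow> real) \<Rightarrow> 3 \<Rightarrow> real" where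
  "total_momentum G V f a =
     (\<Sum>i\<in>cells G. \<Sum>\<^sub>\<infinity>j. vel V j $ a * f i j * space_vol G * vel_vol V)"

definition total_energy ::
    "space_grid \<Rightarrow> vel_grid \<Rightarrow> real \<Rightarrow> (nat^3 \<Rightarrow> int^3 \<Rightarrow> real) \<Rightarrow> (nat^3 \<Rightarrow> real^3) \<Rightarrow>
     (nat^3 \<Rightarrow> real) \<Rightarrow> real" where
  "total_energy G V \<gamma> f B p =
     1 / 2 * (\<Sum>i\<in>cells G. \<Sum>\<^sub>\<infinity>j. (norm (vel V j))\<^sup>2 * f i j * space_vol G * vel_vol V)
     + 1 / 2 * (\<Sum>i\<in>cells G. (norm (B i))\<^sup>2 * space_vol G)
     + 1 / (\<gamma> - 1) * (\<Sum>i\<in>cells G. p i * space_vol G)"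


section \<open>Cubic spline advection\<close>

definition knot :: "real \<Rightarrow> real \<Rightarrow> int \<Rightarrow> real" where
  "knot z0 dz j = z0 + of_int j * dz"

definition bspline :: "real \<Rightarrow> real \<Rightarrow> real" where
  "bspline dz z =
     (if dz \<le> \<bar>z\<bar> \<and> \<bar>z\<bar> < 2 * dz then 1 / 6 * (2 - \<bar>z\<bar> / dz) ^ 3
      else if \<bar>z\<bar> < dz then 1 / 6 * (4 - 6 * (\<bar>z\<bar> / dz)\<^sup>2 + 3 * (\<bar>z\<bar> / dz) ^ 3)
      else 0)"

text \<open>The one-dimensional counterpart of \<open>vel_decay\<close>.\<close>

definition line_decay :: "real \<Rightarrow> real \<Rightarrow> (int \<Rightarrow> real) \<Rightarrow> bool" where
  "line_decay z0 dz e \<longleftrightarrow> (\<forall>c0 c1 c2 :: real.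
     (\<lambda>j. \<bar>(c0 + c1 * knot z0 dz j + c2 * (knot z0 dz j)\<^sup>2) * e j\<bar>) summable_on UNIV)"

definition spline_of :: "real \<Rightarrow> real \<Rightarrow> (int \<Rightarrow> real) \<Rightarrow> real \<Rightarrow> real" where
  "spline_of z0 dz e z = (\<Sum>\<^sub>\<infinity>j. e j * bspline dz (z - knot z0 dz j))"

text \<open>
  The interpolation conditions alone leave a two-parameter family of splines (the homogeneous
  solutions grow exponentially); the decay of the coefficients selects one of them.
\<close>

definition spline_interp :: "real \<Rightarrow> real \<Rightarrow> (int \<Rightarrow> real) \<Rightarrow> real \<Rightarrow> real" where
  "spline_interp z0 dz g =
     (THE F. \<exists>e. line_decay z0 dz e \<and> F = spline_of z0 dz e \<and> (\<forall>i. F (knot z0 dz i) = g i))"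

text \<open>
  In \<open>advect V k \<delta>\<close> the displacement is a function of the velocity; in a genuine advection
  it does not depend on component \<open>k\<close>.
\<close>

definition advect ::
    "vel_grid \<Rightarrow> 3 \<Rightarrow> (real^3 \<Rightarrow> real) \<Rightarrow> (int^3 \<Rightarrow> real) \<Rightarrow> int^3 \<Rightarrow> real" where
  "advect V k \<delta> f j =
     spline_interp (vorigin V $ k) (vspacing V $ k)
       (\<lambda>m. f (\<chi> a. if a = k then m else j $ a))
       (vel V j $ k - \<delta> (vel V j))"

definition translate :: "vel_grid \<Rightarrow> real^3 \<Rightarrow> (int^3 \<Rightarrow> real) \<Rightarrow> int^3 \<Rightarrow> real" where
  "translate V a f =
     advect V 3 (\<lambda>_. - a $ 3) (advect V 2 (\<lambda>_. - a $ 2) (advect V 1 (\<lambda>_. - a $ 1) f))"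


section \<open>Rotation in velocity space\<close>

definition exp_op :: "(real^3 \<Rightarrow> real^3) \<Rightarrow> real^3 \<Rightarrow> real^3" where
  "exp_op A v = (\<Sum>n. (A ^^ n) v /\<^sub>R fact n)"

definition hat :: "real^3 \<Rightarrow> real^3 \<Rightarrow> real^3" where
  "hat B v = v \<times> B"

definition shear :: "real \<Rightarrow> 3 \<Rightarrow> real^3 \<Rightarrow> (real^3 \<Rightarrow> real) \<Rightarrow> real^3 \<Rightarrow> real" where
  "shear dt k y g v = g (v + (dt * (y \<bullet> v)) *\<^sub>R axis k 1)"

definition shear_advect ::
    "vel_grid \<Rightarrow> real \<Rightarrow> 3 \<Rightarrow> real^3 \<Rightarrow> (int^3 \<Rightarrow> real) \<Rightarrow> int^3 \<Rightarrow> real" where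
  "shear_advect V dt k y = advect V k (\<lambda>v. - (dt * (y \<bullet> v)))"

text \<open>
  \<open>k1\<close>, \<open>k2\<close> are the two directions different from \<open>s\<close>, in the order in which the factors
  of the (non-commutative) product over \<open>k \<noteq> s\<close> are written.  The operator on the left of the
  identity sends \<open>g\<close> to \<open>g \<circ> exp_op (\<lambda>w. - dt *\<^sub>R hat B w)\<close>.
\<close>

definition exact_splitting ::
    "real \<Rightarrow> real^3 \<Rightarrow> 3 \<Rightarrow> 3 \<Rightarrow> 3 \<Rightarrow> real^3 \<Rightarrow> (3 \<Rightarrow> real^3) \<Rightarrow> real^3 \<Rightarrow> bool" where
  "exact_splitting dt B s k1 k2 yl yk yr \<longleftrightarrow>
     yl $ s = 0 \<and> yr $ s = 0 \<and> (\<forall>k. k \<noteq> s \<longrightarrow> yk k $ k = 0) \<and>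
     (\<forall>(g :: real^3 \<Rightarrow> real) v.
        g (exp_op (\<lambda>w. - dt *\<^sub>R hat B w) v) =
        shear dt s yl (shear dt k1 (yk k1) (shear dt k2 (yk k2) (shear dt s yr g))) v)"

definition rotate_split ::
    "vel_grid \<Rightarrow> real \<Rightarrow> 3 \<Rightarrow> 3 \<Rightarrow> 3 \<Rightarrow> real^3 \<Rightarrow> (3 \<Rightarrow> real^3) \<Rightarrow> real^3 \<Rightarrow>
     (int^3 \<Rightarrow> real) \<Rightarrow> int^3 \<Rightarrow> real" where
  "rotate_split V dt s k1 k2 yl yk yr f =
     shear_advect V dt s yl (shear_advect V dt k1 (yk k1)
       (shear_advect V dt k2 (yk k2) (shear_advect V dt s yr f)))"


section \<open>The scheme\<close>

definition midpoint_field :: "(nat^3 \<Rightarrow> 'b::real_vector) \<Rightarrow> (nat^3 \<Rightarrow> 'b) \<Rightarrow> nat^3 \<Rightarrow> 'b" where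
  "midpoint_field a b i = (1 / 2) *\<^sub>R (a i + b i)"

definition par_part :: "real^3 \<Rightarrow> real^3 \<Rightarrow> real^3" where
  "par_part B g = (if B \<noteq> 0 then (g \<bullet> B / (norm B)\<^sup>2) *\<^sub>R B else g)"

definition drift :: "real^3 \<Rightarrow> real^3 \<Rightarrow> real^3" where
  "drift B g = (if B \<noteq> 0 then ((1 / (norm B)\<^sup>2) *\<^sub>R B) \<times> g else 0)"

definition current :: "space_grid \<Rightarrow> (nat^3 \<Rightarrow> real^3) \<Rightarrow> real^3 \<Rightarrow> real^3" where
  "current G B = curl (vinterp G B)"

definition pforce :: "space_grid \<Rightarrow> (nat^3 \<Rightarrow> real) \<Rightarrow> (nat^3 \<Rightarrow> real) \<Rightarrow> nat^3 \<Rightarrow> real^3" where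
  "pforce G \<rho> p i = grad (interp G p) (node G i) /\<^sub>R \<rho> i"

definition shift_vel ::
    "space_grid \<Rightarrow> (nat^3 \<Rightarrow> real) \<Rightarrow> (nat^3 \<Rightarrow> real^3) \<Rightarrow> (nat^3 \<Rightarrow> real^3) \<Rightarrow> (nat^3 \<Rightarrow> real) \<Rightarrow>
     nat^3 \<Rightarrow> real^3" where
  "shift_vel G \<rho> ub B p i =
     ub i + drift (B i) (pforce G \<rho> p i) - current G B (node G i) /\<^sub>R \<rho> i"

definition electron_vel ::
    "space_grid \<Rightarrow> (nat^3 \<Rightarrow> real) \<Rightarrow> (nat^3 \<Rightarrow> real^3) \<Rightarrow> (nat^3 \<Rightarrow> real^3) \<Rightarrow>
     real^3 \<Rightarrow> real^3" where
  "electron_vel G \<rho> ub B x = vinterp G ub x - current G B x /\<^sub>R interp G \<rho> x"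

definition induction_rhs ::
    "space_grid \<Rightarrow> (nat^3 \<Rightarrow> real) \<Rightarrow> (nat^3 \<Rightarrow> real^3) \<Rightarrow> (nat^3 \<Rightarrow> real^3) \<Rightarrow> (nat^3 \<Rightarrow> real) \<Rightarrow>
     real^3 \<Rightarrow> real^3" where
  "induction_rhs G \<rho> ub B p x =
     vinterp G ub x \<times> vinterp G B x
     - (current G B x /\<^sub>R interp G \<rho> x) \<times> vinterp G B x
     + grad (interp G p) x /\<^sub>R interp G \<rho> x"

definition pressure_flux ::
    "space_grid \<Rightarrow> (nat^3 \<Rightarrow> real) \<Rightarrow> (nat^3 \<Rightarrow> real^3) \<Rightarrow> (nat^3 \<Rightarrow> real^3) \<Rightarrow> (nat^3 \<Rightarrow> real) \<Rightarrow>
     real^3 \<Rightarrow> real^3" where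
  "pressure_flux G \<rho> ub B p x = interp G p x *\<^sub>R electron_vel G \<rho> ub B x"

text \<open>In the next three definitions \<open>B\<close> and \<open>p\<close> stand for the values at half-time level.\<close>

definition mean_vel_path ::
    "space_grid \<Rightarrow> real \<Rightarrow> real \<Rightarrow> (nat^3 \<Rightarrow> real) \<Rightarrow> (nat^3 \<Rightarrow> real^3) \<Rightarrow> (nat^3 \<Rightarrow> real) \<Rightarrow>
     real^3 \<Rightarrow> nat^3 \<Rightarrow> (real \<Rightarrow> real^3) \<Rightarrow> real^3 \<Rightarrow> bool" where
  "mean_vel_path G dt tn \<rho> B p u0 i u ub \<longleftrightarrow>
     u tn = u0 \<and>
     (\<forall>t\<in>{tn..tn + dt}.
        (u has_vector_derivative
           (u t - ub + current G B (node G i) /\<^sub>R \<rho> i) \<times> B i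
           - grad (interp G p) (node G i) /\<^sub>R \<rho> i) (at t within {tn..tn + dt})) \<and>
     ub = (1 / dt) *\<^sub>R integral {tn..tn + dt} u"

definition vlasov_step ::
    "space_grid \<Rightarrow> vel_grid \<Rightarrow> real \<Rightarrow> 3 \<Rightarrow> 3 \<Rightarrow> 3 \<Rightarrow>
     (nat^3 \<Rightarrow> real^3) \<Rightarrow> (nat^3 \<Rightarrow> 3 \<Rightarrow> real^3) \<Rightarrow> (nat^3 \<Rightarrow> real^3) \<Rightarrow>
     (nat^3 \<Rightarrow> real) \<Rightarrow> (nat^3 \<Rightarrow> real^3) \<Rightarrow> (nat^3 \<Rightarrow> real^3) \<Rightarrow> (nat^3 \<Rightarrow> real) \<Rightarrow>
     nat^3 \<Rightarrow> (int^3 \<Rightarrow> real) \<Rightarrow> int^3 \<Rightarrow> real" where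
  "vlasov_step G V dt s k1 k2 yl yk yr \<rho> ub B p i f =
     (let w = shift_vel G \<rho> ub B p i in
      translate V (- w)
        (rotate_split V dt s k1 k2 (yl i) (yk i) (yr i)
          (translate V w
            (translate V (dt *\<^sub>R par_part (B i) (pforce G \<rho> p i)) f))))"

definition pressure_residual ::
    "space_grid \<Rightarrow> real \<Rightarrow> (nat^3 \<Rightarrow> real) \<Rightarrow> (nat^3 \<Rightarrow> real^3) \<Rightarrow> (nat^3 \<Rightarrow> real^3) \<Rightarrow>
     (nat^3 \<Rightarrow> real) \<Rightarrow> nat^3 \<Rightarrow> real" where
  "pressure_residual G \<gamma> \<rho> ub B p i =
     divergence (vinterp G (sample G (pressure_flux G \<rho> ub B p))) (node G i)
     + (\<gamma> - 1) * p i * divergence (vinterp G (sample G (electron_vel G \<rho> ub B))) (node G i)"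

end

theory Submission
  imports Defs
begin

text \<open>
  The proof rests on two exact discrete facts and one explicit solution.

  In space, waves with distinct wave vectors of the grid are orthogonal with respect to summation
  over the nodes. Hence interpolation by trigonometric polynomials is well posed, a real
  trigonometric polynomial is the interpolant of its own node values, and summation by parts holds
  without error (\<open>summation_by_parts\<close>). Derivatives of such polynomials are of the same
  kind, so the magnetic field changes by the curl of one, whose divergence vanishes identically
  (\<open>magnetic_divergence_free\<close>).

  In velocity, the values of a shifted cubic B-spline on the grid have the zeroth and first moments
  of a point mass at the shift, and its second moment up to the constant \<open>h\<^sup>2 / 3\<close>
  (\<open>bspline_moments\<close>). That constant is the same for shift zero, that is, in the relation
  between the data and the spline coefficients, so it cancels: for a quadratic polynomial
  \<open>\<phi>\<close>, summing \<open>\<phi>\<close> against the advected distribution is the same as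
  summing \<open>\<phi> (v + \<delta> v e\<^sub>k)\<close> against the original one
  (\<open>transports_advect\<close>). This property passes to compositions. All moments of order at most
  two therefore change in one step as if particles were moved by the rigid motion
  \<open>v \<mapsto> w + R (v - dt g\<^sub>\<parallel> - w)\<close>, where \<open>R\<close> is the inverse of
  the rotation in the hypothesis \<open>exact_splitting\<close>.

  The vector \<open>w\<close> is chosen such that the equation for the mean velocity \<open>u\<close> reads
  \<open>(u - w)' = (u - w) \<times> B - g\<^sub>\<parallel>\<close>. As \<open>g\<^sub>\<parallel>\<close> is parallel to
  \<open>B\<close>, the solution at the end of the step is the image of the initial value under that same
  rigid motion, so the new mean velocity is the end point of the path \<open>u\<close>
  (\<open>cell_step\<close>). Its increment is the integral of the right-hand side, where
  \<open>u \<times> B\<close> cancels against the same product with the time average of \<open>u\<close>. A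
  rigid motion changes the kinetic energy only through the mean velocity, and the increment of
  \<open>u \<bullet> u\<close> is linear in the time average of \<open>u\<close>, because
  \<open>u \<bullet> (u \<times> B) = 0\<close>.

  Momentum is conserved because the sums over the nodes of \<open>curl B \<times> B\<close>, for solenoidal
  \<open>B\<close>, and of \<open>grad p\<close> vanish by summation by parts. For the energy, summation by
  parts moves the curl from the electric field to \<open>B\<close> and the divergence from the electron
  velocity to \<open>p\<close>; the kinetic, magnetic and thermal contributions then cancel at each node
  (\<open>energy_exchange\<close>).
\<close>

section \<open>Trigonometric interpolation\<close>

lemma finite_vec_box:
  fixes A :: "'n::finite \<Rightarrow> 'a set"
  assumes "\<And>a. finite (A a)"
  shows "finite {x :: 'a^'n. \<forall>a. x $ a \<in> A a}"
proof -
  have "{x :: 'a^'n. \<forall>a. x $ a \<in> A a} \<subseteq> vec_lambda ` (PiE UNIV A)"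
  proof
    fix x :: "'a^'n" assume "x \<in> {x. \<forall>a. x $ a \<in> A a}"
    then have "vec_nth x \<in> PiE UNIV A" by auto
    then show "x \<in> vec_lambda ` (PiE UNIV A)"
      by (intro image_eqI[of _ _ "vec_nth x"]) (auto simp: vec_eq_iff)
  qed
  then show ?thesis
    by (rule finite_subset) (intro finite_imageI finite_PiE finite assms)
qed

lemma sum_vec_box_prod:
  fixes f :: "'n::finite \<Rightarrow> 'a \<Rightarrow> 'b::comm_semiring_1"
  assumes "\<And>a. finite (A a)"
  shows "(\<Sum>x\<in>{x :: 'a^'n. \<forall>a. x $ a \<in> A a}. \<Prod>a\<in>UNIV. f a (x $ a))
    = (\<Prod>a\<in>UNIV. \<Sum>y\<in>A a. f a y)"
proof -
  have "(\<Prod>a\<in>UNIV. \<Sum>y\<in>A a. f a y) = (\<Sum>g\<in>PiE UNIV A. \<Prod>a\<in>UNIV. f a (g a))"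
    by (rule prod_sum_PiE) (auto simp: assms)
  also have "\<dots> = (\<Sum>x\<in>{x :: 'a^'n. \<forall>a. x $ a \<in> A a}. \<Prod>a\<in>UNIV. f a (x $ a))"
    by (rule sum.reindex_bij_witness[of _ vec_nth vec_lambda]) auto
  finally show ?thesis by simp
qed

text \<open>
  This is the building block of \<open>trig_poly\<close>. Naming it keeps the simplifier from rewriting
  the exponential while sums over the grid are rearranged.
\<close>

definition wave :: "real^3 \<Rightarrow> real^3 \<Rightarrow> complex" where
  "wave \<xi> x = exp (\<i> * complex_of_real (\<xi> \<bullet> x))"

lemma wave_diff_right: "wave \<xi> (x - y) = wave \<xi> x * cnj (wave \<xi> y)"
  by (simp add: wave_def inner_diff_right exp_diff exp_cnj algebra_simps exp_minus divide_inverse)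

lemma wave_diff_left: "wave (\<xi> - \<eta>) x = wave \<xi> x * cnj (wave \<eta> x)"
  by (simp add: wave_def inner_diff_left exp_diff exp_cnj algebra_simps exp_minus divide_inverse)

lemma wave_prod: "wave \<xi> x = (\<Prod>a\<in>UNIV. exp (\<i> * complex_of_real (\<xi> $ a * x $ a)))"
  by (simp add: wave_def inner_vec_def sum_distrib_left exp_sum)

text \<open>
  The terms are the powers of a root of unity different from 1, so the geometric sum vanishes. The
  bound on \<open>d\<close> reflects that the wave numbers of an axis, as well as its node indices, are
  \<open>M\<close> consecutive integers, so that their differences are smaller than \<open>M\<close>.
\<close>

lemma roots_of_unity_sum:
  fixes d :: int
  assumes "d \<noteq> 0" "\<bar>d\<bar> < int M"
  shows "(\<Sum>n<M. exp (\<i> * complex_of_real (2 * pi * of_int d * real n / real M))) = 0"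
proof -
  define w where "w = exp (\<i> * complex_of_real (2 * pi * of_int d / real M))"
  have M: "M > 0" using assms by linarith
  have pw: "w ^ n = exp (\<i> * complex_of_real (2 * pi * of_int d * real n / real M))" for n
    unfolding w_def exp_of_nat_mult[symmetric] by (simp add: algebra_simps)
  have "w ^ M = 1"
    unfolding pw using M by (simp add: exp_eq_1)
  moreover have "w \<noteq> 1"
  proof
    assume "w = 1"
    then obtain k :: int where "2 * pi * of_int d / real M = of_int (2 * k) * pi"
      unfolding w_def exp_eq_1 by auto
    then have "of_int d = (of_int (k * int M) :: real)"
      using M by (simp add: field_simps)
    then have "d = k * int M" by linarith
    then show False using assms
      by (metis abs_mult abs_of_nat dvd_imp_le_int dvd_triv_right linorder_not_le)
  qed
  ultimately show ?thesis
    unfolding pw[symmetric] by (subst geometric_sum) auto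
qed

abbreviation wave_numbers :: "space_grid \<Rightarrow> 3 \<Rightarrow> int set" where
  "wave_numbers G a \<equiv> {- ((int (pts G $ a) - 1) div 2) .. int (pts G $ a) div 2}"

lemma wave_vectors_box:
  "wave_vectors G = {\<xi>. \<forall>a. \<xi> $ a \<in> (\<lambda>k. 2 * pi / box_len G $ a * of_int k) ` wave_numbers G a}"
  unfolding wave_vectors_def image_iff Bex_def atLeastAtMost_iff conj_assoc ..

lemma cells_box: "cells G = {i. \<forall>a. i $ a \<in> {..<pts G $ a}}"
  unfolding cells_def by auto

lemma finite_cells [simp]: "finite (cells G)"
  unfolding cells_box by (rule finite_vec_box) simp

lemma finite_wave_vectors [simp]: "finite (wave_vectors G)"
  unfolding wave_vectors_box by (rule finite_vec_box) simp

text \<open>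
  Both the cells and the wave vectors form boxes, so the sum factors over the three axes; an axis in
  which the wave vectors differ contributes a vanishing sum of roots of unity.
\<close>

lemma sum_waves_over_nodes:
  assumes G: "valid_space_grid G" and "\<xi> \<in> wave_vectors G" "\<eta> \<in> wave_vectors G"
  shows "(\<Sum>i\<in>cells G. wave \<xi> (node G i) * cnj (wave \<eta> (node G i)))
    = (if \<xi> = \<eta> then of_nat (card (cells G)) else 0)"
proof (cases "\<xi> = \<eta>")
  case True
  then show ?thesis by (simp add: wave_diff_left[symmetric]) (simp add: wave_def)
next
  case False
  then obtain a where a: "\<xi> $ a \<noteq> \<eta> $ a" by (auto simp: vec_eq_iff)
  obtain k where k: "k \<in> wave_numbers G a" "\<xi> $ a = 2 * pi / box_len G $ a * of_int k"
    using assms(2) unfolding wave_vectors_def by force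
  obtain l where l: "l \<in> wave_numbers G a" "\<eta> $ a = 2 * pi / box_len G $ a * of_int l"
    using assms(3) unfolding wave_vectors_def by force
  have L: "box_len G $ a > 0" and M: "pts G $ a > 0" using G by (auto simp: valid_space_grid_def)
  have kl: "k \<noteq> l" using a k l by auto
  have bd: "\<bar>k - l\<bar> < int (pts G $ a)" using k(1) l(1) M by (auto simp: abs_if)
  let ?o = "exp (\<i> * complex_of_real ((\<xi> - \<eta>) $ a * origin G $ a))"
  let ?f = "\<lambda>b n. exp (\<i> * complex_of_real ((\<xi> - \<eta>) $ b * (origin G $ b + real n * mesh G $ b)))"
  have "?f a n = ?o * exp (\<i> * complex_of_real (2 * pi * of_int (k - l) * real n / real (pts G $ a)))" for n
  proof -
    have "(\<xi> - \<eta>) $ a * (origin G $ a + real n * mesh G $ a)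
      = (\<xi> - \<eta>) $ a * origin G $ a + 2 * pi * of_int (k - l) * real n / real (pts G $ a)"
      using L M by (simp add: k l mesh_def field_simps)
    then show ?thesis by (simp only: of_real_add distrib_left exp_add)
  qed
  then have "(\<Sum>n<pts G $ a. ?f a n) = 0"
    using roots_of_unity_sum[of "k - l" "pts G $ a"] kl bd by (simp add: sum_distrib_left[symmetric])
  then have z: "(\<Prod>b\<in>UNIV. \<Sum>n\<in>{..<pts G $ b}. ?f b n) = 0"
    by (intro prod_zero) auto
  have "(\<Sum>i\<in>cells G. wave (\<xi> - \<eta>) (node G i)) = (\<Prod>b\<in>UNIV. \<Sum>n\<in>{..<pts G $ b}. ?f b n)"
    unfolding wave_prod cells_box node_def vec_lambda_beta by (rule sum_vec_box_prod) simp
  then show ?thesis using False z by (simp add: wave_diff_left)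
qed

text \<open>
  The dual orthogonality relation; it is what makes the discrete Fourier coefficients reproduce given
  node values, and thus yields existence of the interpolant.
\<close>

lemma sum_nodes_over_waves:
  assumes G: "valid_space_grid G" and ij: "i \<in> cells G" "j \<in> cells G" and ne: "i \<noteq> j"
  shows "(\<Sum>\<xi>\<in>wave_vectors G. wave \<xi> (node G i) * cnj (wave \<xi> (node G j))) = 0"
proof -
  obtain a where a: "i $ a \<noteq> j $ a" using ne by (auto simp: vec_eq_iff)
  have L: "box_len G $ a > 0" and M: "pts G $ a > 0" using G by (auto simp: valid_space_grid_def)
  define d where "d = int (i $ a) - int (j $ a)"
  have "i $ a < pts G $ a" "j $ a < pts G $ a" using ij by (auto simp: cells_def)
  then have d: "d \<noteq> 0" "\<bar>d\<bar> < int (pts G $ a)" using a by (auto simp: d_def)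
  let ?f = "\<lambda>b k. exp (\<i> * complex_of_real (k * (node G i - node G j) $ b))"
  let ?g = "\<lambda>k::int. 2 * pi / box_len G $ a * of_int k"
  let ?m = "- ((int (pts G $ a) - 1) div 2)"
  have eq: "?f a (?g (?m + int n)) = ?f a (?g ?m) *
      exp (\<i> * complex_of_real (2 * pi * of_int d * real n / real (pts G $ a)))" for n
  proof -
    have "?g (?m + int n) * (node G i - node G j) $ a
      = ?g ?m * (node G i - node G j) $ a + 2 * pi * of_int d * real n / real (pts G $ a)"
      using L M by (simp add: node_def mesh_def d_def field_simps)
    then show ?thesis by (simp only: of_real_add distrib_left exp_add)
  qed
  have "(\<Sum>k\<in>?g ` wave_numbers G a. ?f a k) = (\<Sum>k\<in>wave_numbers G a. ?f a (?g k))"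
    using L by (subst sum.reindex) (auto simp: inj_on_def)
  also have "\<dots> = (\<Sum>n<pts G $ a. ?f a (?g (?m + int n)))"
    by (rule sum.reindex_bij_witness[of _ "\<lambda>n. ?m + int n" "\<lambda>k. nat (k - ?m)"]) (use M in auto)
  also have "\<dots> = 0"
    unfolding eq sum_distrib_left[symmetric] roots_of_unity_sum[OF d] by simp
  finally have "(\<Prod>b\<in>UNIV. \<Sum>k\<in>(\<lambda>k. 2 * pi / box_len G $ b * of_int k) ` wave_numbers G b. ?f b k) = 0"
    by (intro prod_zero) auto
  moreover have "(\<Sum>\<xi>\<in>wave_vectors G. wave \<xi> (node G i - node G j)) =
      (\<Prod>b\<in>UNIV. \<Sum>k\<in>(\<lambda>k. 2 * pi / box_len G $ b * of_int k) ` wave_numbers G b. ?f b k)"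
    unfolding wave_prod wave_vectors_box by (rule sum_vec_box_prod) simp
  ultimately show ?thesis by (simp add: wave_diff_right)
qed

definition trig_sum :: "space_grid \<Rightarrow> (real^3 \<Rightarrow> complex) \<Rightarrow> real^3 \<Rightarrow> complex" where
  "trig_sum G c x = (\<Sum>\<xi>\<in>wave_vectors G. c \<xi> * wave \<xi> x)"

lemma trig_poly_iff: "trig_poly G P \<longleftrightarrow> (\<exists>c. P = trig_sum G c)"
  unfolding trig_poly_def trig_sum_def wave_def by (auto simp: fun_eq_iff)

text \<open>
  The conjugate on the second factor is essential: for an even number of points the wave vectors are
  not symmetric, and only differences, not sums, of two wave vectors are controlled.
\<close>

lemma parseval:
  assumes "valid_space_grid G"
  shows "(\<Sum>i\<in>cells G. trig_sum G c (node G i) * cnj (trig_sum G d (node G i)))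
    = of_nat (card (cells G)) * (\<Sum>\<xi>\<in>wave_vectors G. c \<xi> * cnj (d \<xi>))"
proof -
  have "(\<Sum>i\<in>cells G. trig_sum G c (node G i) * cnj (trig_sum G d (node G i)))
      = (\<Sum>i\<in>cells G. \<Sum>\<xi>\<in>wave_vectors G. \<Sum>\<eta>\<in>wave_vectors G.
          c \<xi> * cnj (d \<eta>) * (wave \<xi> (node G i) * cnj (wave \<eta> (node G i))))"
    by (simp add: trig_sum_def sum_product algebra_simps)
  also have "\<dots> = (\<Sum>\<xi>\<in>wave_vectors G. \<Sum>\<eta>\<in>wave_vectors G. \<Sum>i\<in>cells G.
          c \<xi> * cnj (d \<eta>) * (wave \<xi> (node G i) * cnj (wave \<eta> (node G i))))"
    by (subst sum.swap) (rule sum.cong[OF refl], rule sum.swap)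
  also have "\<dots> = (\<Sum>\<xi>\<in>wave_vectors G. \<Sum>\<eta>\<in>wave_vectors G.
          c \<xi> * cnj (d \<eta>) * (if \<xi> = \<eta> then of_nat (card (cells G)) else 0))"
    by (intro sum.cong refl)
       (simp only: sum_distrib_left[symmetric] sum_waves_over_nodes[OF assms])
  also have "\<dots> = of_nat (card (cells G)) * (\<Sum>\<xi>\<in>wave_vectors G. c \<xi> * cnj (d \<xi>))"
    by (simp add: sum_distrib_left mult.commute if_distrib sum.delta cong: if_cong)
  finally show ?thesis .
qed

lemma card_cells_pos:
  assumes "valid_space_grid G" shows "card (cells G) > 0"
proof -
  have "0 \<in> cells G" using assms by (auto simp: cells_def valid_space_grid_def)
  then show ?thesis by (auto simp: card_gt_0_iff)
qed

text \<open>
  By Parseval's identity the sum of the squared moduli of the coefficients vanishes.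
\<close>

lemma trig_poly_zero:
  assumes G: "valid_space_grid G" and z: "\<And>i. i \<in> cells G \<Longrightarrow> trig_sum G c (node G i) = 0"
  shows "trig_sum G c x = 0"
proof -
  have "of_nat (card (cells G)) * (\<Sum>\<xi>\<in>wave_vectors G. c \<xi> * cnj (c \<xi>)) = 0"
    unfolding parseval[OF G, symmetric] using z by simp
  then have "(\<Sum>\<xi>\<in>wave_vectors G. c \<xi> * cnj (c \<xi>)) = 0"
    using card_cells_pos[OF G] by auto
  then have "complex_of_real (\<Sum>\<xi>\<in>wave_vectors G. (cmod (c \<xi>))\<^sup>2) = 0"
    by (simp only: of_real_sum complex_norm_square of_real_0)
  then have "(\<Sum>\<xi>\<in>wave_vectors G. (cmod (c \<xi>))\<^sup>2) = 0" by (simp only: of_real_eq_0_iff)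
  then have "\<forall>\<xi>\<in>wave_vectors G. c \<xi> = 0" by (subst (asm) sum_nonneg_eq_0_iff) auto
  then show ?thesis by (simp add: trig_sum_def)
qed

lemma trig_sum_diff: "trig_sum G c x - trig_sum G d x = trig_sum G (\<lambda>\<xi>. c \<xi> - d \<xi>) x"
  by (simp add: trig_sum_def sum_subtractf algebra_simps)

lemma trig_poly_unique:
  assumes G: "valid_space_grid G" and "trig_poly G P" "trig_poly G Q"
    and eq: "\<And>i. i \<in> cells G \<Longrightarrow> P (node G i) = Q (node G i)"
  shows "P = Q"
proof -
  obtain c d where cd: "P = trig_sum G c" "Q = trig_sum G d" using assms(2,3) by (auto simp: trig_poly_iff)
  have "trig_sum G (\<lambda>\<xi>. c \<xi> - d \<xi>) x = 0" for x
    by (rule trig_poly_zero[OF G]) (use eq cd in \<open>simp add: trig_sum_diff[symmetric]\<close>)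
  then show ?thesis by (auto simp: cd trig_sum_diff[symmetric])
qed

text \<open>
  The coefficients are those of the discrete Fourier transform. The number of wave vectors is
  the diagonal value in the dual orthogonality relation, whence the normalisation.
\<close>

lemma trig_poly_interpolant_exists:
  assumes G: "valid_space_grid G"
  shows "\<exists>P. trig_poly G P \<and> (\<forall>i\<in>cells G. P (node G i) = complex_of_real (g i))"
proof -
  define c where "c \<xi> = (\<Sum>j\<in>cells G. complex_of_real (g j) * cnj (wave \<xi> (node G j))) / of_nat (card (wave_vectors G))" for \<xi>
  have "0 \<in> wave_vectors G" using G by (force simp: wave_vectors_def valid_space_grid_def intro!: exI[of _ "0::int"])
  then have W: "card (wave_vectors G) \<noteq> 0" by auto
  have "trig_sum G c (node G i) = complex_of_real (g i)" if i: "i \<in> cells G" for i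
  proof -
    have "of_nat (card (wave_vectors G)) * trig_sum G c (node G i) =
       (\<Sum>\<xi>\<in>wave_vectors G. \<Sum>j\<in>cells G. of_real (g j) * (wave \<xi> (node G i) * cnj (wave \<xi> (node G j))))"
      using W by (simp add: trig_sum_def c_def sum_distrib_left sum_distrib_right sum_divide_distrib algebra_simps)
    also have "\<dots> = (\<Sum>j\<in>cells G. of_real (g j) * (\<Sum>\<xi>\<in>wave_vectors G. wave \<xi> (node G i) * cnj (wave \<xi> (node G j))))"
      by (subst sum.swap) (simp only: sum_distrib_left)
    also have "\<dots> = (\<Sum>j\<in>cells G. if j = i then of_real (g j) * of_nat (card (wave_vectors G)) else 0)"
    proof (rule sum.cong[OF refl])
      fix j assume j: "j \<in> cells G"
      show "of_real (g j) * (\<Sum>\<xi>\<in>wave_vectors G. wave \<xi> (node G i) * cnj (wave \<xi> (node G j)))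
          = (if j = i then of_real (g j) * of_nat (card (wave_vectors G)) else 0)"
        using sum_nodes_over_waves[OF G i j]
        by (auto simp: wave_diff_right[symmetric]) (simp add: wave_def)
    qed
    also have "\<dots> = of_real (g i) * of_nat (card (wave_vectors G))" using i by (simp add: sum.delta)
    finally show ?thesis using W by simp
  qed
  then show ?thesis by (auto simp: trig_poly_iff)
qed

lemma trig_interp_eqI:
  assumes "valid_space_grid G" "trig_poly G P"
    and "\<And>i. i \<in> cells G \<Longrightarrow> P (node G i) = complex_of_real (g i)"
  shows "trig_interp G g = P"
  unfolding trig_interp_def
  by (rule the_equality) (use assms in \<open>auto intro!: trig_poly_unique[of G]\<close>)

lemma trig_interp:
  assumes "valid_space_grid G"
  shows "trig_poly G (trig_interp G g)"
    and "i \<in> cells G \<Longrightarrow> trig_interp G g (node G i) = complex_of_real (g i)"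
  using trig_poly_interpolant_exists[OF assms, of g] trig_interp_eqI[OF assms] by metis+

text \<open>
  The coefficients are kept explicit because differentiation acts on them diagonally, with the same
  factor whatever the function.
\<close>

definition real_trig :: "space_grid \<Rightarrow> (real^3 \<Rightarrow> complex) \<Rightarrow> (real^3 \<Rightarrow> real) \<Rightarrow> bool" where
  "real_trig G c F \<longleftrightarrow> (\<forall>x. complex_of_real (F x) = trig_sum G c x)"

definition real_trig_poly :: "space_grid \<Rightarrow> (real^3 \<Rightarrow> real) \<Rightarrow> bool" where
  "real_trig_poly G F \<longleftrightarrow> (\<exists>c. real_trig G c F)"

lemma interp_node:
  assumes "valid_space_grid G" "i \<in> cells G"
  shows "interp G g (node G i) = g i"
  using trig_interp(2)[OF assms, of g] by (simp add: interp_def)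

lemma real_trig_poly_interp:
  assumes G: "valid_space_grid G" and "real_interp G g"
  shows "real_trig_poly G (interp G g)"
proof -
  obtain c where "trig_interp G g = trig_sum G c"
    using trig_interp(1)[OF G, of g] by (auto simp: trig_poly_iff)
  moreover have "complex_of_real (interp G g x) = trig_interp G g x" for x
    using assms(2) by (auto simp: interp_def real_interp_def)
  ultimately show ?thesis by (auto simp: real_trig_poly_def real_trig_def)
qed

lemma interp_eq_real_trig_poly:
  assumes G: "valid_space_grid G" and F: "real_trig_poly G F"
    and "\<And>i. i \<in> cells G \<Longrightarrow> g i = F (node G i)"
  shows "interp G g = F"
proof -
  have "trig_poly G (\<lambda>x. complex_of_real (F x))"
    using F by (auto simp: trig_poly_iff real_trig_poly_def real_trig_def fun_eq_iff)
  then have "trig_interp G g = (\<lambda>x. complex_of_real (F x))"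
    by (rule trig_interp_eqI[OF G]) (use assms(3) in auto)
  then show ?thesis by (auto simp: interp_def fun_eq_iff)
qed

lemma real_trig_poly_lincomb:
  assumes "real_trig_poly G F" "real_trig_poly G H"
  shows "real_trig_poly G (\<lambda>x. a * F x + b * H x)"
proof -
  obtain c d where "real_trig G c F" "real_trig G d H" using assms by (auto simp: real_trig_poly_def)
  then have "real_trig G (\<lambda>\<xi>. of_real a * c \<xi> + of_real b * d \<xi>) (\<lambda>x. a * F x + b * H x)"
    by (simp add: real_trig_def trig_sum_def sum_distrib_left sum.distrib algebra_simps)
  then show ?thesis by (auto simp: real_trig_poly_def)
qed

text \<open>
  The derivative is computed for the complex sum. Since the sum is real everywhere, uniqueness of the
  Frechet derivative shows that the derivative is real as well, so that the real partial derivative has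
  the differentiated coefficients.
\<close>

lemma real_trig_has_derivative:
  assumes F: "real_trig G c F"
  shows "F differentiable (at x)"
    and "real_trig G (\<lambda>\<xi>. c \<xi> * (\<i> * of_real (\<xi> $ a))) (pderiv_at a F)"
proof -
  let ?D = "\<lambda>x h. \<Sum>\<xi>\<in>wave_vectors G. c \<xi> * (of_real (\<xi> \<bullet> h) * \<i> * wave \<xi> x)"
  have w: "((\<lambda>x. wave \<xi> x) has_derivative (\<lambda>h. of_real (\<xi> \<bullet> h) * \<i> * wave \<xi> x)) (at x)" for \<xi> x
  proof -
    have "((\<lambda>x. \<i> * complex_of_real (\<xi> \<bullet> x)) has_derivative (\<lambda>h. \<i> * complex_of_real (\<xi> \<bullet> h))) (at x)"
      by (intro derivative_intros)
    from has_derivative_compose[OF this DERIV_exp[unfolded has_field_derivative_def]] show ?thesis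
      unfolding wave_def by (simp add: mult_ac)
  qed
  have D: "((\<lambda>x. complex_of_real (F x)) has_derivative ?D x) (at x)" for x
    using F unfolding real_trig_def trig_sum_def
    by (simp only:) (intro has_derivative_sum has_derivative_mult_right w)
  have FD: "(F has_derivative (\<lambda>h. Re (?D x h))) (at x)" for x
    using has_derivative_Re[OF D[of x]] by simp
  show "F differentiable (at x)" using FD unfolding differentiable_def by blast
  have fd: "frechet_derivative F (at x) = (\<lambda>h. Re (?D x h))" for x
    using frechet_derivative_at[OF FD[of x]] by simp
  have "((\<lambda>x. complex_of_real (F x)) has_derivative (\<lambda>h. complex_of_real (Re (?D x h)))) (at x)" for x
    by (intro has_derivative_of_real FD)
  \<comment> \<open>The complex sum has two derivatives, one of which is visibly real.\<close>
  from has_derivative_unique[OF this D]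
  have re: "complex_of_real (Re (?D x h)) = ?D x h" for x h by (metis)
  show "real_trig G (\<lambda>\<xi>. c \<xi> * (\<i> * of_real (\<xi> $ a))) (pderiv_at a F)"
    unfolding real_trig_def pderiv_at_def fd re
    by (simp add: trig_sum_def inner_axis mult_ac)
qed

lemma real_trig_poly_pderiv:
  "real_trig_poly G F \<Longrightarrow> real_trig_poly G (pderiv_at a F)"
  unfolding real_trig_poly_def using real_trig_has_derivative(2) by blast

lemma real_trig_poly_differentiable:
  "real_trig_poly G F \<Longrightarrow> F differentiable (at x)"
  unfolding real_trig_poly_def using real_trig_has_derivative(1) by blast

lemma pderiv_at_commute:
  assumes "real_trig_poly G F"
  shows "pderiv_at a (pderiv_at b F) = pderiv_at b (pderiv_at a F)"
proof -
  obtain c where c: "real_trig G c F" using assms by (auto simp: real_trig_poly_def)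
  have "real_trig G (\<lambda>\<xi>. c \<xi> * (\<i> * of_real (\<xi> $ b)) * (\<i> * of_real (\<xi> $ a))) (pderiv_at a (pderiv_at b F))"
    for a b by (intro real_trig_has_derivative(2) c)
  from this[of a b] this[of b a] show ?thesis
    by (simp add: real_trig_def fun_eq_iff mult_ac trig_sum_def) (metis of_real_eq_iff)
qed

lemma pderiv_at_lincomb:
  assumes "F differentiable (at x)" "H differentiable (at x)"
  shows "pderiv_at a (\<lambda>x. c * F x + d * H x) x = c * pderiv_at a F x + d * pderiv_at a H x"
proof -
  have "((\<lambda>x. c * F x + d * H x) has_derivative
     (\<lambda>h. c * frechet_derivative F (at x) h + d * frechet_derivative H (at x) h)) (at x)"
    using assms unfolding frechet_derivative_works
    by (intro has_derivative_add has_derivative_mult_right)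
  from frechet_derivative_at[OF this, symmetric] show ?thesis by (simp add: pderiv_at_def)
qed

text \<open>
  On the coefficients, differentiation is multiplication by the imaginary numbers
  \<open>\<i> * \<xi> $ a\<close>, hence skew-adjoint with respect to the right-hand side of Parseval's
  identity.
\<close>

lemma summation_by_parts:
  assumes G: "valid_space_grid G" and "real_trig_poly G F" "real_trig_poly G H"
  shows "(\<Sum>i\<in>cells G. F (node G i) * pderiv_at a H (node G i))
    = - (\<Sum>i\<in>cells G. pderiv_at a F (node G i) * H (node G i))"
proof -
  obtain c d where c: "real_trig G c F" and d: "real_trig G d H"
    using assms by (auto simp: real_trig_poly_def)
  have eq: "complex_of_real (\<Sum>i\<in>cells G. F (node G i) * H (node G i))
      = of_nat (card (cells G)) * (\<Sum>\<xi>\<in>wave_vectors G. c \<xi> * cnj (d \<xi>))"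
    if "real_trig G c F" "real_trig G d H" for c d F H
  proof -
    have "cnj (trig_sum G d x) = trig_sum G d x" for x
      using that(2) unfolding real_trig_def by (metis complex_cnj_complex_of_real)
    then show ?thesis
      unfolding parseval[OF G, symmetric] using that by (simp add: real_trig_def)
  qed
  have "complex_of_real (\<Sum>i\<in>cells G. F (node G i) * pderiv_at a H (node G i))
     = complex_of_real (- (\<Sum>i\<in>cells G. pderiv_at a F (node G i) * H (node G i)))"
    unfolding of_real_minus eq[OF c real_trig_has_derivative(2)[OF d]] eq[OF real_trig_has_derivative(2)[OF c] d]
    by (simp add: sum_negf mult_ac)
  then show ?thesis by (simp only: of_real_eq_iff)
qed

section \<open>Cubic splines on a line\<close>

text \<open>
  All values of the spline can thus be computed for unit spacing.
\<close>

lemma bspline_rescale: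
  assumes "0 < h" shows "bspline h z = bspline 1 (z / h)"
proof -
  have "\<bar>z / h\<bar> = \<bar>z\<bar> / h" using assms by simp
  then show ?thesis using assms unfolding bspline_def by (simp add: field_simps)
qed

lemma bspline_nonneg: "0 < h \<Longrightarrow> 0 \<le> bspline h z"
proof -
  assume h: "0 < h"
  have "0 \<le> bspline 1 t" for t
  proof -
    have "4 - 6 * x\<^sup>2 + 3 * x ^ 3 = 1 + 3 * (1 - x) + 3 * (1 - x)\<^sup>2 * x" for x :: real
      by (simp add: algebra_simps power2_eq_square power3_eq_cube)
    moreover have "0 \<le> 1 + 3 * (1 - x) + 3 * (1 - x)\<^sup>2 * x" if "0 \<le> x" "x < 1" for x :: real
      using that by (intro add_nonneg_nonneg mult_nonneg_nonneg) auto
    ultimately have "0 \<le> 4 - 6 * \<bar>t\<bar>\<^sup>2 + 3 * \<bar>t\<bar> ^ 3" if "\<bar>t\<bar> < 1"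
      using that by (metis abs_ge_zero)
    then show ?thesis unfolding bspline_def by (auto simp del: power2_abs)
  qed
  then show ?thesis using bspline_rescale[OF h] by simp
qed

lemma bspline_values:
  fixes s :: real
  assumes "0 \<le> s" "s < 1"
  shows "bspline 1 (- 1 - s) = (1 - s) ^ 3 / 6"
    and "bspline 1 (- s) = (4 - 6 * s\<^sup>2 + 3 * s ^ 3) / 6"
    and "bspline 1 (1 - s) = (4 - 6 * (1 - s)\<^sup>2 + 3 * (1 - s) ^ 3) / 6"
    and "bspline 1 (2 - s) = s ^ 3 / 6"
  using assms by (auto simp: bspline_def abs_if)

text \<open>
  The factors in \<open>s\<close> are the four spline values of \<open>bspline_values\<close>, and
  \<open>n\<close> is the knot to the left of the shift.
\<close>

lemma bspline_moment_identity:
  fixes s n :: real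
  shows "(1 - s) ^ 3 * (a + b * ((n - 1) * h) + c * ((n - 1) * h)\<^sup>2) / 6 +
    ((4 - 6 * s\<^sup>2 + 3 * s ^ 3) * (a + b * (n * h) + c * (n * h)\<^sup>2) / 6 +
     ((4 - 6 * (1 - s)\<^sup>2 + 3 * (1 - s) ^ 3) * (a + b * ((n + 1) * h) + c * ((n + 1) * h)\<^sup>2) / 6 +
      s ^ 3 * (a + b * ((n + 2) * h) + c * ((n + 2) * h)\<^sup>2) / 6))
    = a + b * ((n + s) * h) + c * (((n + s) * h)\<^sup>2 + h\<^sup>2 / 3)"
  by (simp add: power2_eq_square power3_eq_cube algebra_simps add_divide_distrib diff_divide_distrib)

text \<open>
  Only the four knots closest to \<open>\<delta>\<close> contribute, and their values are cubic
  polynomials in the fractional part of \<open>\<delta> / h\<close>. The case \<open>b = c = 0\<close> is the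
  partition of unity. The excess \<open>h\<^sup>2 / 3\<close> is the variance of the B-spline; that it does
  not depend on \<open>\<delta>\<close> is what makes second moments transform exactly under advection.
\<close>

lemma bspline_moments:
  assumes h: "0 < h"
  shows "((\<lambda>m::int. bspline h (of_int m * h - \<delta>) * (a + b * (of_int m * h) + c * (of_int m * h)\<^sup>2))
    has_sum (a + b * \<delta> + c * (\<delta>\<^sup>2 + h\<^sup>2 / 3))) UNIV"
proof -
  \<comment> \<open>The shift lies in the cell between knots \<open>n\<close> and \<open>n + 1\<close>, at relative position \<open>s\<close>.\<close>
  define n where "n = \<lfloor>\<delta> / h\<rfloor>"
  define s where "s = \<delta> / h - of_int n"
  have s: "0 \<le> s" "s < 1" unfolding s_def n_def by linarith+
  have \<delta>: "\<delta> = (of_int n + s) * h" using h by (simp add: s_def)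
  have arg: "bspline h (of_int m * h - \<delta>) = bspline 1 (of_int (m - n) - s)" for m
  proof -
    have "(of_int m * h - \<delta>) / h = of_int (m - n) - s"
      using h by (simp add: \<delta> field_simps)
    then show ?thesis by (simp only: bspline_rescale[OF h])
  qed
  let ?f = "\<lambda>m::int. bspline h (of_int m * h - \<delta>) * (a + b * (of_int m * h) + c * (of_int m * h)\<^sup>2)"
  let ?S = "{n - 1, n, n + 1, n + 2}"
  have zero: "?f m = 0" if "m \<notin> ?S" for m
  proof -
    have "m - n \<le> - 2 \<or> m - n \<ge> 3" using that by auto
    then have "of_int (m - n) \<le> (- 2::real) \<or> of_int (m - n) \<ge> (3::real)" by linarith
    then have "2 \<le> \<bar>of_int (m - n) - s\<bar>" using s by linarith
    then have "bspline 1 (of_int (m - n) - s) = 0" by (simp add: bspline_def)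
    then show ?thesis unfolding arg by simp
  qed
  have "sum ?f ?S = a + b * \<delta> + c * (\<delta>\<^sup>2 + h\<^sup>2 / 3)"
  proof -
    have "sum ?f ?S = ?f (n - 1) + (?f n + (?f (n + 1) + ?f (n + 2)))" by simp
    also have "\<dots> = a + b * ((of_int n + s) * h) + c * (((of_int n + s) * h)\<^sup>2 + h\<^sup>2 / 3)"
      unfolding arg by (simp add: bspline_values[OF s]) (rule bspline_moment_identity)
    finally show ?thesis unfolding \<delta> .
  qed
  then have "(?f has_sum (a + b * \<delta> + c * (\<delta>\<^sup>2 + h\<^sup>2 / 3))) ?S"
    by (intro has_sum_finiteI) auto
  then show ?thesis
    by (rule has_sum_cong_neutral[THEN iffD1, rotated -1]) (use zero in auto)
qed

lemma spline_at_knot: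
  assumes h: "0 < h"
  shows "spline_of z0 h e (knot z0 h i) = (e (i - 1) + 4 * e i + e (i + 1)) / 6"
proof -
  have b: "bspline h (knot z0 h i - knot z0 h j) = bspline 1 (of_int (i - j))" for j
  proof -
    have "(knot z0 h i - knot z0 h j) / h = of_int (i - j)"
      using h by (simp add: knot_def field_simps)
    then show ?thesis by (simp only: bspline_rescale[OF h])
  qed
  have "infsum (\<lambda>j. e j * bspline h (knot z0 h i - knot z0 h j)) UNIV
      = infsum (\<lambda>j. e j * bspline h (knot z0 h i - knot z0 h j)) {i - 1, i, i + 1}"
  proof (rule infsum_cong_neutral)
    fix j assume "j \<in> UNIV - {i - 1, i, i + 1}"
    then have "2 \<le> \<bar>i - j\<bar>" by auto
    then have "2 \<le> \<bar>of_int (i - j) :: real\<bar>" by linarith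
    then show "e j * bspline h (knot z0 h i - knot z0 h j) = 0" unfolding b by (simp add: bspline_def)
  qed auto
  also have "\<dots> = (e (i - 1) + 4 * e i + e (i + 1)) / 6"
    unfolding b by (simp add: bspline_def add_divide_distrib)
  finally show ?thesis by (simp add: spline_of_def)
qed

lemma bij_int_shift: "bij (\<lambda>i::int. i + k)"
  by (rule bij_betw_byWitness[of _ "\<lambda>i. i - k"]) auto

lemma summable_on_int_shift:
  "(\<lambda>i::int. f (i + k)) summable_on UNIV \<longleftrightarrow> f summable_on UNIV"
  using summable_on_reindex_bij_betw[OF bij_int_shift] .

lemma infsum_int_shift:
  "infsum (\<lambda>i::int. f (i + k)) UNIV = infsum f UNIV"
  using infsum_reindex_bij_betw[OF bij_int_shift] .

lemma bij_int_reflect: "bij (\<lambda>i::int. k - i)"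
  by (rule bij_betw_byWitness[of _ "\<lambda>i. k - i"]) auto

text \<open>
  Diagonal dominance: summing \<open>4 \<bar>d i\<bar> \<le> \<bar>d (i - 1)\<bar> + \<bar>d (i + 1)\<bar>\<close> over all
  \<open>i\<close> gives \<open>4 S \<le> 2 S\<close> for the absolute sum \<open>S\<close>.
\<close>

lemma tridiagonal_injective:
  fixes d :: "int \<Rightarrow> real"
  assumes sd: "(\<lambda>i. \<bar>d i\<bar>) summable_on UNIV"
    and eq: "\<And>i. d (i - 1) + 4 * d i + d (i + 1) = 0"
  shows "d i = 0"
proof -
  let ?s = "infsum (\<lambda>i. \<bar>d i\<bar>) UNIV"
  have s1: "(\<lambda>i. \<bar>d (i + -1)\<bar>) summable_on UNIV" "(\<lambda>i. \<bar>d (i + 1)\<bar>) summable_on UNIV"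
    using sd summable_on_int_shift[of "\<lambda>i. \<bar>d i\<bar>"] by blast+
  have "4 * ?s = infsum (\<lambda>i. 4 * \<bar>d i\<bar>) UNIV" by (simp add: infsum_cmult_right')
  also have "\<dots> \<le> infsum (\<lambda>i. \<bar>d (i + -1)\<bar> + \<bar>d (i + 1)\<bar>) UNIV"
  proof (rule infsum_mono)
    show "4 * \<bar>d i\<bar> \<le> \<bar>d (i + -1)\<bar> + \<bar>d (i + 1)\<bar>" for i using eq[of i] by simp
  qed (intro summable_on_add summable_on_cmult_right s1 sd)+
  also have "\<dots> = ?s + ?s"
    by (subst infsum_add[OF s1]) (simp only: infsum_int_shift[of "\<lambda>i. \<bar>d i\<bar>"])
  finally have "?s \<le> 0" by simp
  moreover have "\<bar>d i\<bar> \<le> ?s"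
    using infsum_mono_neutral[of "\<lambda>i. \<bar>d i\<bar>" "{i}" "\<lambda>i. \<bar>d i\<bar>" UNIV] sd by simp
  ultimately show ?thesis by simp
qed

lemma line_decay_summable:
  "line_decay z0 h e \<Longrightarrow> (\<lambda>j. \<bar>e j\<bar>) summable_on UNIV"
  unfolding line_decay_def by (elim allE[of _ 1] allE[of _ 0]) (simp)

text \<open>
  Any decaying solution of the tridiagonal system identifies the interpolant, because the decay
  excludes the exponentially growing homogeneous solutions.
\<close>

lemma spline_interp_eqI:
  assumes h: "0 < h" and e: "line_decay z0 h e"
    and eq: "\<And>i. e (i - 1) + 4 * e i + e (i + 1) = 6 * g i"
  shows "spline_interp z0 h g = spline_of z0 h e"
  unfolding spline_interp_def
proof (rule the_equality)
  show "\<exists>e'. line_decay z0 h e' \<and> spline_of z0 h e = spline_of z0 h e' \<and> (\<forall>i. spline_of z0 h e (knot z0 h i) = g i)"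
  proof (intro exI[of _ e] conjI allI e refl)
    show "spline_of z0 h e (knot z0 h i) = g i" for i
      using eq[of i] by (simp add: spline_at_knot[OF h])
  qed
  fix F assume "\<exists>e'. line_decay z0 h e' \<and> F = spline_of z0 h e' \<and> (\<forall>i. F (knot z0 h i) = g i)"
  then obtain e' where e': "line_decay z0 h e'" "F = spline_of z0 h e'"
    and g: "\<And>i. spline_of z0 h e' (knot z0 h i) = g i" by auto
  have "e' i - e i = 0" for i
  proof (rule tridiagonal_injective[of "\<lambda>i. e' i - e i"])
    have "(\<lambda>i. \<bar>e' i\<bar> + \<bar>e i\<bar>) summable_on UNIV"
      by (intro summable_on_add line_decay_summable[OF e] line_decay_summable[OF e'(1)])
    then have "(\<lambda>i. norm (e' i - e i)) summable_on UNIV"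
      by (rule Infinite_Sum.abs_summable_on_comparison_test') simp
    then show "(\<lambda>i. \<bar>e' i - e i\<bar>) summable_on UNIV" by simp
    show "e' (i - 1) - e (i - 1) + 4 * (e' i - e i) + (e' (i + 1) - e (i + 1)) = 0" for i
    proof -
      have "e' (i - 1) + 4 * e' i + e' (i + 1) = e (i - 1) + 4 * e i + e (i + 1)"
        using g[of i] unfolding eq spline_at_knot[OF h] by simp
      then show ?thesis by (simp add: algebra_simps)
    qed
  qed
  then have "e' = e" by auto
  then show "F = spline_of z0 h e" using e' by simp
qed

text \<open>
  This is six times the decaying fundamental solution of the second-order recurrence with stencil
  \<open>1, 4, 1\<close>; the ratio is the root of \<open>r\<^sup>2 + 4 r + 1 = 0\<close> inside the unit disc.
\<close>

definition spline_green :: "int \<Rightarrow> real" where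
  "spline_green m = sqrt 3 * (sqrt 3 - 2) ^ nat \<bar>m\<bar>"

lemma spline_green_eq:
  "spline_green (m - 1) + 4 * spline_green m + spline_green (m + 1) = (if m = 0 then 6 else 0)"
proof -
  define r :: real where "r = sqrt 3 - 2"
  have r: "r * r + 4 * r + 1 = 0" by (simp add: r_def algebra_simps)
  have pw: "r ^ n + 4 * r ^ Suc n + r ^ Suc (Suc n) = 0" for n
  proof -
    have "r ^ n + 4 * r ^ Suc n + r ^ Suc (Suc n) = r ^ n * (r * r + 4 * r + 1)" by (simp add: algebra_simps)
    then show ?thesis unfolding r by simp
  qed
  \<comment> \<open>Away from zero the exponents on one side are consecutive; at zero both neighbours are equal.\<close>
  consider "m = 0" | "m > 0" | "m < 0" by linarith
  then show ?thesis
  proof cases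
    case 1
    then show ?thesis by (simp add: spline_green_def algebra_simps)
  next
    case 2
    define n where "n = nat (m - 1)"
    have "nat \<bar>m - 1\<bar> = n" "nat \<bar>m\<bar> = Suc n" "nat \<bar>m + 1\<bar> = Suc (Suc n)" using 2 by (auto simp: n_def)
    then have "spline_green (m - 1) + 4 * spline_green m + spline_green (m + 1)
        = sqrt 3 * (r ^ n + 4 * r ^ Suc n + r ^ Suc (Suc n))"
      unfolding spline_green_def r_def[symmetric] by (simp only: distrib_left mult.left_commute)
    then show ?thesis using 2 unfolding pw by simp
  next
    case 3
    define n where "n = nat (- m - 1)"
    have "nat \<bar>m + 1\<bar> = n" "nat \<bar>m\<bar> = Suc n" "nat \<bar>m - 1\<bar> = Suc (Suc n)" using 3 by (auto simp: n_def)
    then have "spline_green (m - 1) + 4 * spline_green m + spline_green (m + 1)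
        = sqrt 3 * (r ^ n + 4 * r ^ Suc n + r ^ Suc (Suc n))"
      unfolding spline_green_def r_def[symmetric] by (simp only: distrib_left mult.left_commute add_ac)
    then show ?thesis using 3 unfolding pw by simp
  qed
qed

lemma summable_geometric_quadratic:
  fixes q c :: real
  assumes "\<bar>q\<bar> < 1"
  shows "summable (\<lambda>n. (1 + c * (real n)\<^sup>2) * q ^ n)"
proof -
  have 0: "summable (\<lambda>n. (1::real) * x ^ n)" if "norm x < 1" for x :: real
    using that by (simp add: summable_geometric)
  have 1: "summable (\<lambda>n. diffs (\<lambda>_. 1) n * x ^ n)" if "norm x < 1" for x :: real
    by (rule termdiff_converges[OF that]) (use 0 in blast)
  have 2: "summable (\<lambda>n. diffs (diffs (\<lambda>_. 1)) n * q ^ n)"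
    by (rule termdiff_converges[of _ 1]) (use 1 assms in auto)
  have "summable (\<lambda>n. c * (diffs (diffs (\<lambda>_. 1)) n * q ^ n) - 3 * c * (diffs (\<lambda>_. 1) n * q ^ n) + (1 + c) * (1 * q ^ n))"
    using assms by (intro summable_add summable_diff summable_mult 2 1 0) auto
  then show ?thesis
    by (rule back_subst[where P = summable]) (auto simp: diffs_def algebra_simps power2_eq_square)
qed

lemma spline_green_ratio: "\<bar>sqrt 3 - 2 :: real\<bar> < 1"
proof -
  have "1 < sqrt (3::real)" by (rule real_less_rsqrt) simp
  moreover have "sqrt 3 < (2::real)" by (rule real_less_lsqrt) auto
  ultimately show ?thesis by simp
qed

text \<open>
  The quadratic factor measures how much a shift by \<open>m\<close> cells can increase a velocity weight
  of order two.
\<close>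

lemma spline_green_decay:
  "(\<lambda>m::int. \<bar>spline_green m\<bar> * (1 + (of_int m * h)\<^sup>2)) summable_on UNIV"
proof -
  let ?f = "\<lambda>m::int. \<bar>spline_green m\<bar> * (1 + (of_int m * h)\<^sup>2)"
  have s: "summable (\<lambda>n. sqrt 3 * ((1 + h\<^sup>2 * (real n)\<^sup>2) * \<bar>sqrt 3 - 2\<bar> ^ n))"
    by (rule summable_mult[OF summable_geometric_quadratic]) (use spline_green_ratio in simp)
  have ff: "?f (int n) = sqrt 3 * ((1 + h\<^sup>2 * (real n)\<^sup>2) * \<bar>sqrt 3 - 2\<bar> ^ n)"
    "?f (- int n) = sqrt 3 * ((1 + h\<^sup>2 * (real n)\<^sup>2) * \<bar>sqrt 3 - 2\<bar> ^ n)" for n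
    by (simp_all add: spline_green_def abs_mult power_abs power_mult_distrib mult_ac)
  have nn: "norm (?f m) = ?f m" for m by simp
  have sn1: "(\<lambda>n. ?f (int n)) summable_on UNIV"
    by (rule norm_summable_imp_summable_on) (unfold trans[OF nn ff(1)], rule s)
  have sn2: "(\<lambda>n. ?f (- int n)) summable_on UNIV"
    by (rule norm_summable_imp_summable_on) (unfold trans[OF nn ff(2)], rule s)
  have "?f summable_on (range int)"
    unfolding summable_on_reindex[OF inj_of_nat] o_def by (rule sn1)
  moreover have "?f summable_on ((\<lambda>n. - int n) ` (UNIV - {0}))"
  proof -
    have i: "inj_on (\<lambda>n. - int n) (UNIV - {0})" by (simp add: inj_on_def)
    show ?thesis
      unfolding summable_on_reindex[OF i] o_def by (rule summable_on_subset_banach[OF sn2]) simp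
  qed
  moreover have "range int \<inter> (\<lambda>n. - int n) ` (UNIV - {0}) = {}"
  proof (rule equals0I)
    fix x assume "x \<in> range int \<inter> (\<lambda>n. - int n) ` (UNIV - {0})"
    then obtain n k where "x = int n" "x = - int k" "k \<noteq> 0" by (elim IntE imageE) simp
    then show False by linarith
  qed
  ultimately have "?f summable_on (range int \<union> (\<lambda>n. - int n) ` (UNIV - {0}))"
    by (rule summable_on_Un_disjoint)
  moreover have "range int \<union> (\<lambda>n. - int n) ` (UNIV - {0}) = UNIV"
  proof -
    have "m \<in> range int \<union> (\<lambda>n. - int n) ` (UNIV - {0})" for m :: int
    proof (cases "m \<ge> 0")
      case True
      then have "m = int (nat m)" by linarith
      then show ?thesis by (rule UnI1[OF range_eqI])
    next
      case False
      have m: "m = - int (nat (- m))" using False by linarith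
      have "nat (- m) \<noteq> 0" using False by linarith
      then have "nat (- m) \<in> UNIV - {0}" by (intro DiffI UNIV_I notI) (erule singletonE, erule notE)
      with m show ?thesis by (intro UnI2) (rule image_eqI)
    qed
    then show ?thesis by (intro set_eqI iffI UNIV_I)
  qed
  ultimately show ?thesis by (simp only:)
qed

lemma spline_green_le: "\<bar>spline_green m\<bar> \<le> sqrt 3"
proof -
  have "\<bar>sqrt 3 - 2 :: real\<bar> \<le> 1" using spline_green_ratio by simp
  then show ?thesis by (simp add: spline_green_def abs_mult power_abs power_le_one)
qed

text \<open>
  Convolution with the fundamental solution inverts the tridiagonal system, so that the spline
  coefficients of summable data exist explicitly.
\<close>

lemma spline_green_convolution:
  fixes g :: "int \<Rightarrow> real"
  assumes g: "(\<lambda>i. \<bar>g i\<bar>) summable_on UNIV"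
  defines "e \<equiv> \<lambda>i. \<Sum>\<^sub>\<infinity>m. spline_green m * g (i - m)"
  shows "e (i - 1) + 4 * e i + e (i + 1) = 6 * g i"
proof -
  have sg: "(\<lambda>m. \<bar>g (i - m)\<bar>) summable_on UNIV" for i
    using g summable_on_reindex_bij_betw[OF bij_int_reflect, of "\<lambda>i. \<bar>g i\<bar>" i] by simp
  have s: "(\<lambda>m. spline_green (m + k) * g (i - m)) summable_on UNIV" for i k
  proof -
    have "(\<lambda>m. norm (sqrt 3 * g (i - m))) summable_on UNIV"
      using summable_on_cmult_right[OF sg, of "sqrt 3"] by (simp add: abs_mult)
    then have "(\<lambda>m. norm (spline_green (m + k) * g (i - m))) summable_on UNIV"
      by (rule Infinite_Sum.abs_summable_on_comparison_test) (simp add: abs_mult mult_right_mono spline_green_le)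
    then show ?thesis by (rule summable_on_iff_abs_summable_on_real[THEN iffD2])
  qed
  have e: "e (i + k) = (\<Sum>\<^sub>\<infinity>m. spline_green (m + k) * g (i - m))" for k
    unfolding e_def infsum_int_shift[of "\<lambda>m. spline_green m * g (i + k - m)" k, symmetric]
    by (simp add: algebra_simps)
  have "e (i - 1) + 4 * e i + e (i + 1) = e (i + -1) + 4 * e (i + 0) + e (i + 1)" by simp
  also have "\<dots> = (\<Sum>\<^sub>\<infinity>m. spline_green (m + -1) * g (i - m) + 4 * (spline_green (m + 0) * g (i - m)) + spline_green (m + 1) * g (i - m))"
    unfolding e infsum_cmult_right'[symmetric]
    by (subst infsum_add[symmetric], intro s, intro summable_on_cmult_right s)
       (subst infsum_add[symmetric], intro summable_on_add summable_on_cmult_right s, intro s, rule refl)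
  also have "\<dots> = (\<Sum>\<^sub>\<infinity>m. (spline_green (m - 1) + 4 * spline_green m + spline_green (m + 1)) * g (i - m))"
    by (simp add: algebra_simps)
  also have "\<dots> = (\<Sum>\<^sub>\<infinity>m\<in>{0}. (spline_green (m - 1) + 4 * spline_green m + spline_green (m + 1)) * g (i - m))"
    unfolding spline_green_eq by (rule infsum_cong_neutral) auto
  also have "\<dots> = 6 * g i" unfolding spline_green_eq by simp
  finally show ?thesis .
qed

section \<open>Transport of velocity moments\<close>

text \<open>
  Up to a constant, this weight bounds every quadratic polynomial, so a single summability condition
  covers all moments of order at most two.
\<close>

definition weight :: "real^3 \<Rightarrow> real" where
  "weight v = 1 + (norm v)\<^sup>2"

lemma weight_ge_1: "1 \<le> weight v" and weight_nonneg: "0 \<le> weight v"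
  by (simp_all add: weight_def)

lemma norm_le_weight: "norm v \<le> weight v"
proof -
  have "0 \<le> (norm v - 1)\<^sup>2 + (norm v)\<^sup>2" by simp
  then have "2 * norm v \<le> 1 + 2 * (norm v)\<^sup>2" by (simp add: power2_eq_square algebra_simps)
  also have "\<dots> \<le> 2 * weight v" by (simp add: weight_def)
  finally show ?thesis by simp
qed

definition moment_summable :: "vel_grid \<Rightarrow> (int^3 \<Rightarrow> real) \<Rightarrow> bool" where
  "moment_summable V f \<longleftrightarrow> (\<lambda>j. weight (vel V j) * \<bar>f j\<bar>) summable_on UNIV"

lemma vel_decay_imp_moment_summable:
  assumes "vel_decay V f" shows "moment_summable V f"
proof -
  have "(\<lambda>j. \<bar>(1 + 0 \<bullet> vel V j + vel V j \<bullet> (mat 1 *v vel V j)) * f j\<bar>) summable_on UNIV"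
    using assms unfolding vel_decay_def by blast
  moreover have "\<bar>(1 + 0 \<bullet> v + v \<bullet> (mat 1 *v v)) * x\<bar> = weight v * \<bar>x\<bar>" for v :: "real^3" and x :: real
    using weight_nonneg[of v] by (simp add: abs_mult weight_def power2_norm_eq_inner)
  ultimately show ?thesis by (simp only: moment_summable_def)
qed

lemma moment_summable_dominated:
  assumes f: "moment_summable V f" and b: "\<And>j. \<bar>\<phi> j\<bar> \<le> K * weight (vel V j)"
  shows "(\<lambda>j. norm (\<phi> j * f j)) summable_on UNIV"
proof (rule Infinite_Sum.abs_summable_on_comparison_test')
  show "(\<lambda>j. K * (weight (vel V j) * \<bar>f j\<bar>)) summable_on UNIV"
    using f unfolding moment_summable_def by (rule summable_on_cmult_right)
  show "norm (\<phi> j * f j) \<le> K * (weight (vel V j) * \<bar>f j\<bar>)" for j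
    using mult_right_mono[OF b[of j], of "\<bar>f j\<bar>"] by (simp add: abs_mult mult.assoc)
qed

lemma axis_uminus: "axis k (- m) = - (axis k m :: int^3)"
  by (simp add: vec_eq_iff axis_def)

lemma vel_shift:
  "vel V (j + axis k m) = vel V j + (of_int m * vspacing V $ k) *\<^sub>R axis k 1"
  by (simp add: vec_eq_iff vel_def axis_def algebra_simps)

text \<open>
  Computing spline coefficients and evaluating the spline are both sums over shifts along one axis,
  with coefficients that are constant along this axis. Fubini's theorem moves the kernel from the
  distribution to the test function: after exchanging the sums, the substitution
  \<open>j \<mapsto> j + axis k m\<close> leaves the coefficients unchanged. The bound \<open>C\<close> supplies
  the absolute summability of the double family.
\<close>

lemma kernel_double_sum:
  fixes c :: "int \<Rightarrow> int^3 \<Rightarrow> real"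
  assumes inv: "\<And>m j n. c m (j + axis k n) = c m j"
    and f: "moment_summable V f"
    and cs: "\<And>j. (\<lambda>m. \<bar>c m j\<bar> * weight (vel V (j + axis k m))) summable_on UNIV"
    and cb: "\<And>j. (\<Sum>\<^sub>\<infinity>m. \<bar>c m j\<bar> * weight (vel V (j + axis k m))) \<le> C * weight (vel V j)"
    and \<phi>: "\<And>j. \<bar>\<phi> j\<bar> \<le> K * weight (vel V j)" and K: "0 \<le> K"
  shows "(\<lambda>j. \<phi> j * (\<Sum>\<^sub>\<infinity>m. c m j * f (j - axis k m))) summable_on UNIV"
    and "(\<Sum>\<^sub>\<infinity>j. \<phi> j * (\<Sum>\<^sub>\<infinity>m. c m j * f (j - axis k m)))
      = (\<Sum>\<^sub>\<infinity>j. (\<Sum>\<^sub>\<infinity>m. c m j * \<phi> (j + axis k m)) * f j)"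
proof -
  define F where "F = (\<lambda>(j, m). c m j * \<phi> (j + axis k m) * f j)"
  let ?w = "\<lambda>j m. \<bar>c m j\<bar> * weight (vel V (j + axis k m))"
  have Fb: "norm (F (j, m)) \<le> K * \<bar>f j\<bar> * ?w j m" for j m
  proof -
    have "norm (F (j, m)) = \<bar>c m j\<bar> * \<bar>f j\<bar> * \<bar>\<phi> (j + axis k m)\<bar>" by (simp add: F_def abs_mult)
    also have "\<dots> \<le> \<bar>c m j\<bar> * \<bar>f j\<bar> * (K * weight (vel V (j + axis k m)))"
      by (intro mult_left_mono \<phi>) auto
    finally show ?thesis by (simp add: mult_ac)
  qed
  have Fj: "(\<lambda>m. norm (F (j, m))) summable_on UNIV" for j
    by (rule Infinite_Sum.abs_summable_on_comparison_test'[OF summable_on_cmult_right[OF cs] Fb])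
  have Fsum: "norm (\<Sum>\<^sub>\<infinity>m. norm (F (j, m))) \<le> K * C * (weight (vel V j) * \<bar>f j\<bar>)" for j
  proof -
    have "(\<Sum>\<^sub>\<infinity>m. norm (F (j, m))) \<le> (\<Sum>\<^sub>\<infinity>m. K * \<bar>f j\<bar> * ?w j m)"
      by (rule infsum_mono[OF Fj summable_on_cmult_right[OF cs] Fb])
    also have "\<dots> = K * \<bar>f j\<bar> * (\<Sum>\<^sub>\<infinity>m. ?w j m)" by (rule infsum_cmult_right')
    also have "\<dots> \<le> K * \<bar>f j\<bar> * (C * weight (vel V j))"
      using K by (intro mult_left_mono cb) auto
    finally show ?thesis by (simp add: mult_ac infsum_nonneg)
  qed
  have "(\<lambda>x. norm (F x)) summable_on (Sigma UNIV (\<lambda>_. UNIV))"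
    unfolding Infinite_Sum.abs_summable_on_Sigma_iff
  proof (intro conjI ballI)
    show "(\<lambda>j. norm (\<Sum>\<^sub>\<infinity>m. norm (F (j, m)))) summable_on UNIV"
      by (rule Infinite_Sum.abs_summable_on_comparison_test'[OF summable_on_cmult_right[OF f[unfolded moment_summable_def]] Fsum])
  qed (rule Fj)
  then have F: "F summable_on (Sigma UNIV (\<lambda>_. UNIV))" by (rule summable_on_iff_abs_summable_on_real[THEN iffD2])
  \<comment> \<open>Collect the contributions by the target of the shift instead of its source.\<close>
  let ?\<pi> = "\<lambda>(j, m). (j - axis k m, m) :: (int^3) \<times> int"
  have bij: "bij_betw ?\<pi> ((Sigma UNIV (\<lambda>_. UNIV))) ((Sigma UNIV (\<lambda>_. UNIV)))"
    by (rule bij_betw_byWitness[of _ "\<lambda>(j, m). (j + axis k m, m)"]) auto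
  have inv': "c m (j - axis k m) = c m j" for m j
    using inv[of m j "- m"] by (simp add: axis_uminus)
  have F\<pi>: "F (?\<pi> x) = (\<lambda>(j, m). \<phi> j * (c m j * f (j - axis k m))) x" for x
    by (cases x) (simp add: F_def inv')
  have G: "(\<lambda>(j, m). \<phi> j * (c m j * f (j - axis k m))) summable_on (Sigma UNIV (\<lambda>_. UNIV))"
    using summable_on_reindex_bij_betw[OF bij, of F] F unfolding F\<pi> by simp
  show "(\<lambda>j. \<phi> j * (\<Sum>\<^sub>\<infinity>m. c m j * f (j - axis k m))) summable_on UNIV"
    using summable_on_Sigma_banach[OF G] by (simp add: infsum_cmult_right')
  have "(\<Sum>\<^sub>\<infinity>j. \<phi> j * (\<Sum>\<^sub>\<infinity>m. c m j * f (j - axis k m)))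
      = (\<Sum>\<^sub>\<infinity>j. \<Sum>\<^sub>\<infinity>m. \<phi> j * (c m j * f (j - axis k m)))"
    by (simp add: infsum_cmult_right')
  also have "\<dots> = infsum (\<lambda>(j, m). \<phi> j * (c m j * f (j - axis k m))) ((Sigma UNIV (\<lambda>_. UNIV)))"
    by (rule infsum_Sigma'_banach[OF G])
  also have "\<dots> = infsum F ((Sigma UNIV (\<lambda>_. UNIV)))"
    using infsum_reindex_bij_betw[OF bij, of F] unfolding F\<pi> .
  also have "\<dots> = (\<Sum>\<^sub>\<infinity>j. \<Sum>\<^sub>\<infinity>m. F (j, m))"
    by (rule infsum_Sigma_banach[OF F, symmetric])
  also have "\<dots> = (\<Sum>\<^sub>\<infinity>j. (\<Sum>\<^sub>\<infinity>m. c m j * \<phi> (j + axis k m)) * f j)"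
    by (simp add: F_def infsum_cmult_left')
  finally show "(\<Sum>\<^sub>\<infinity>j. \<phi> j * (\<Sum>\<^sub>\<infinity>m. c m j * f (j - axis k m)))
      = (\<Sum>\<^sub>\<infinity>j. (\<Sum>\<^sub>\<infinity>m. c m j * \<phi> (j + axis k m)) * f j)" .
qed

lemma kernel_moment_summable:
  fixes c :: "int \<Rightarrow> int^3 \<Rightarrow> real"
  assumes "\<And>m j n. c m (j + axis k n) = c m j"
    and "moment_summable V f"
    and "\<And>j. (\<lambda>m. \<bar>c m j\<bar> * weight (vel V (j + axis k m))) summable_on UNIV"
    and "\<And>j. (\<Sum>\<^sub>\<infinity>m. \<bar>c m j\<bar> * weight (vel V (j + axis k m))) \<le> C * weight (vel V j)"
  shows "moment_summable V (\<lambda>j. \<Sum>\<^sub>\<infinity>m. c m j * f (j - axis k m))"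
proof -
  have "(\<lambda>j. weight (vel V j) * (\<Sum>\<^sub>\<infinity>m. c m j * f (j - axis k m))) summable_on UNIV"
    by (rule kernel_double_sum(1)[OF assms, of _ 1]) (auto simp: weight_nonneg)
  then have "(\<lambda>j. norm (weight (vel V j) * (\<Sum>\<^sub>\<infinity>m. c m j * f (j - axis k m)))) summable_on UNIV"
    by (rule summable_on_iff_abs_summable_on_real[THEN iffD1])
  then show ?thesis by (simp add: moment_summable_def abs_mult weight_nonneg)
qed

text \<open>
  The quadratic part is an arbitrary bilinear map rather than a matrix, which makes invariance under
  affine substitutions immediate.
\<close>

definition quad :: "(real^3 \<Rightarrow> real) \<Rightarrow> bool" where
  "quad \<phi> \<longleftrightarrow> (\<exists>c l \<beta>. linear l \<and> bilinear \<beta> \<and> \<phi> = (\<lambda>v. c + l v + \<beta> v v))"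

lemma quad_bound:
  assumes "quad \<phi>"
  obtains K where "0 \<le> K" "\<And>v. \<bar>\<phi> v\<bar> \<le> K * weight v"
proof -
  obtain c l \<beta> where *: "linear l" "bilinear \<beta>" "\<phi> = (\<lambda>v. c + l v + \<beta> v v)"
    using assms by (auto simp: quad_def)
  obtain A where A: "A > 0" "\<And>v. norm (l v) \<le> A * norm v" using linear_bounded_pos[OF *(1)] by auto
  obtain B where B: "B > 0" "\<And>v w. norm (\<beta> v w) \<le> B * norm v * norm w"
    using bilinear_bounded_pos[OF *(2)] by blast
  have "\<bar>\<phi> v\<bar> \<le> (\<bar>c\<bar> + A + B) * weight v" for v
  proof -
    have "\<bar>\<phi> v\<bar> \<le> \<bar>c\<bar> * 1 + A * norm v + B * (norm v)\<^sup>2"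
      using A(2)[of v] B(2)[of v v] by (simp add: *(3) power2_eq_square mult.assoc)
    also have "\<dots> \<le> \<bar>c\<bar> * weight v + A * weight v + B * weight v"
      using A(1) B(1) by (intro add_mono mult_left_mono weight_ge_1 norm_le_weight) (auto simp: weight_def)
    finally show ?thesis by (simp add: algebra_simps)
  qed
  then show ?thesis using A(1) B(1) by (intro that[of "\<bar>c\<bar> + A + B"]) auto
qed

lemma quadI: "linear l \<Longrightarrow> bilinear \<beta> \<Longrightarrow> (\<And>v. \<phi> v = c + l v + \<beta> v v) \<Longrightarrow> quad \<phi>"
  unfolding quad_def by blast

lemma quad_affine:
  assumes "quad \<phi>" "linear L"
  shows "quad (\<lambda>v. \<phi> (a + L v))"
proof -
  obtain c l \<beta> where *: "linear l" "bilinear \<beta>" "\<phi> = (\<lambda>v. c + l v + \<beta> v v)"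
    using assms by (auto simp: quad_def)
  interpret l: linear l by fact
  interpret L: linear L by fact
  show ?thesis
  proof (rule quadI)
    show "linear (\<lambda>v. l (L v) + \<beta> a (L v) + \<beta> (L v) a)"
      by (rule linearI) (simp_all add: l.add l.scale L.add L.scale bilinear_ladd[OF *(2)] bilinear_radd[OF *(2)]
          bilinear_lmul[OF *(2)] bilinear_rmul[OF *(2)] algebra_simps)
    show "bilinear (\<lambda>v w. \<beta> (L v) (L w))"
      unfolding bilinear_def
      by (auto intro!: linearI simp: l.add l.scale L.add L.scale bilinear_ladd[OF *(2)] bilinear_radd[OF *(2)]
          bilinear_lmul[OF *(2)] bilinear_rmul[OF *(2)] algebra_simps)
    show "\<phi> (a + L v) = (c + l a + \<beta> a a) + (l (L v) + \<beta> a (L v) + \<beta> (L v) a) + \<beta> (L v) (L v)" for v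
      by (simp add: *(3) l.add bilinear_ladd[OF *(2)] bilinear_radd[OF *(2)])
  qed
qed

lemma bilinear_zero: "bilinear (\<lambda>v w. 0)"
  unfolding bilinear_def by (auto intro!: linearI)

lemma quad_const: "quad (\<lambda>v. c)"
  by (rule quadI[of "\<lambda>_. 0" "\<lambda>_ _. 0" _ c]) (auto intro: linearI bilinear_zero)

lemma quad_linear: "linear l \<Longrightarrow> quad l"
  by (rule quadI[of l "\<lambda>_ _. 0" _ 0]) (auto intro: bilinear_zero)

lemma quad_norm_square: "quad (\<lambda>v. (norm v)\<^sup>2)"
  by (rule quadI[of "\<lambda>_. 0" "\<lambda>v w. v \<bullet> w" _ 0])
    (auto intro!: linearI simp: bilinear_def inner_add_left inner_add_right power2_norm_eq_inner)

lemma quad_weight: "quad weight"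
  by (rule quadI[of "\<lambda>_. 0" "\<lambda>v w. v \<bullet> w" _ 1])
    (auto intro!: linearI simp: bilinear_def inner_add_left inner_add_right power2_norm_eq_inner weight_def)

text \<open>
  The second-order coefficient \<open>\<kappa>\<close> does not depend on the base point. Hence it is also
  unchanged when \<open>\<phi>\<close> is composed with a shear along \<open>e\<close>.
\<close>

lemma quad_along_line:
  assumes "quad \<phi>"
  obtains \<alpha> \<kappa> where "\<And>v t. \<phi> (v + t *\<^sub>R e) = \<phi> v + \<alpha> v * t + \<kappa> * t\<^sup>2"
proof -
  obtain c l \<beta> where *: "linear l" "bilinear \<beta>" "\<phi> = (\<lambda>v. c + l v + \<beta> v v)"
    using assms by (auto simp: quad_def)
  interpret l: linear l by fact
  show ?thesis
    by (rule that[of "\<lambda>v. l e + \<beta> v e + \<beta> e v" "\<beta> e e"])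
      (simp add: *(3) l.add l.scale bilinear_ladd[OF *(2)] bilinear_radd[OF *(2)]
          bilinear_lmul[OF *(2)] bilinear_rmul[OF *(2)] algebra_simps power2_eq_square)
qed

text \<open>
  The lines on which \<open>advect\<close> works are the ranges of \<open>\<lambda>m. upd k m j\<close>.
\<close>

definition upd :: "3 \<Rightarrow> int \<Rightarrow> int^3 \<Rightarrow> int^3" where
  "upd k m j = (\<chi> a. if a = k then m else j $ a)"

lemma upd_minus_axis: "upd k i j - axis k m = upd k (i - m) j"
  by (auto simp: upd_def axis_def vec_eq_iff)

lemma upd_self: "upd k (j $ k) j = j"
  by (auto simp: upd_def vec_eq_iff)

lemma upd_nth: "upd k i j $ k = i"
  by (simp add: upd_def)

lemma inj_upd: "inj (\<lambda>i. upd k i j)"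
  by (rule injI) (metis upd_nth)

lemma vel_nth: "vel V j $ k = knot (vorigin V $ k) (vspacing V $ k) (j $ k)"
  by (simp add: vel_def knot_def)

lemma moment_summable_line:
  assumes "moment_summable V f"
  shows "(\<lambda>i. weight (vel V (upd k i j)) * \<bar>f (upd k i j)\<bar>) summable_on UNIV"
proof -
  have "(\<lambda>j. weight (vel V j) * \<bar>f j\<bar>) summable_on range (\<lambda>i. upd k i j)"
    using assms unfolding moment_summable_def by (rule summable_on_subset_banach) simp
  then show ?thesis unfolding summable_on_reindex[OF inj_upd] o_def .
qed

lemma moment_summable_imp_line_decay:
  assumes "moment_summable V f"
  shows "line_decay (vorigin V $ k) (vspacing V $ k) (\<lambda>i. f (upd k i j))"
  unfolding line_decay_def
proof (intro allI)
  fix c0 c1 c2 :: real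
  let ?K = "\<bar>c0\<bar> + \<bar>c1\<bar> + \<bar>c2\<bar>"
  let ?z = "knot (vorigin V $ k) (vspacing V $ k)"
  have b: "\<bar>(c0 + c1 * ?z i + c2 * (?z i)\<^sup>2)\<bar> \<le> ?K * weight (vel V (upd k i j))" for i
  proof -
    let ?v = "vel V (upd k i j)"
    have z: "?z i = ?v $ k" by (simp add: vel_nth upd_nth)
    have zn: "\<bar>?z i\<bar> \<le> norm ?v" unfolding z by (rule component_le_norm_cart)
    then have z2: "(?z i)\<^sup>2 \<le> weight ?v"
      using power_mono[OF zn abs_ge_zero, of 2] by (simp add: weight_def)
    have z1: "\<bar>?z i\<bar> \<le> weight ?v" using zn norm_le_weight[of ?v] by linarith
    have "\<bar>c0 + c1 * ?z i + c2 * (?z i)\<^sup>2\<bar> \<le> \<bar>c0\<bar> * 1 + \<bar>c1\<bar> * \<bar>?z i\<bar> + \<bar>c2\<bar> * (?z i)\<^sup>2"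
      by (rule order_trans[OF abs_triangle_ineq]) (use abs_triangle_ineq[of c0 "c1 * ?z i"] in \<open>simp add: abs_mult\<close>)
    also have "\<dots> \<le> \<bar>c0\<bar> * weight ?v + \<bar>c1\<bar> * weight ?v + \<bar>c2\<bar> * weight ?v"
      by (intro add_mono mult_left_mono weight_ge_1 z1 z2) auto
    finally show ?thesis by (simp add: algebra_simps)
  qed
  have "(\<lambda>i. norm ((c0 + c1 * ?z i + c2 * (?z i)\<^sup>2) * f (upd k i j))) summable_on UNIV"
  proof (rule Infinite_Sum.abs_summable_on_comparison_test')
    show "(\<lambda>i. ?K * (weight (vel V (upd k i j)) * \<bar>f (upd k i j)\<bar>)) summable_on UNIV"
      by (rule summable_on_cmult_right[OF moment_summable_line[OF assms]])
    show "norm ((c0 + c1 * ?z i + c2 * (?z i)\<^sup>2) * f (upd k i j))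
       \<le> ?K * (weight (vel V (upd k i j)) * \<bar>f (upd k i j)\<bar>)" for i
      using mult_right_mono[OF b[of i], of "\<bar>f (upd k i j)\<bar>"] by (simp only: real_norm_def abs_mult mult.assoc abs_ge_zero)
  qed
  then show "(\<lambda>i. \<bar>(c0 + c1 * ?z i + c2 * (?z i)\<^sup>2) * f (upd k i j)\<bar>) summable_on UNIV"
    by (simp only: real_norm_def)
qed

text \<open>
  The coefficients of all lines are obtained at once by convolving with \<open>spline_green\<close> along
  axis \<open>k\<close>. Treating the lines together shows that the coefficients are summable against the
  weight on the whole velocity grid, and not merely on each line.
\<close>

lemma spline_coefficients_exist:
  assumes f: "moment_summable V f"
  obtains E where "moment_summable V E"
    "\<And>i j. E (upd k (i - 1) j) + 4 * E (upd k i j) + E (upd k (i + 1) j) = 6 * f (upd k i j)"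
proof -
  define E where "E = (\<lambda>j. \<Sum>\<^sub>\<infinity>m. spline_green m * f (j - axis k m))"
  let ?h = "vspacing V $ k"
  let ?G = "\<Sum>\<^sub>\<infinity>m. \<bar>spline_green m\<bar> * (1 + (of_int m * ?h)\<^sup>2)"
  have b: "\<bar>spline_green m\<bar> * weight (vel V (j + axis k m))
      \<le> (2 * weight (vel V j)) * (\<bar>spline_green m\<bar> * (1 + (of_int m * ?h)\<^sup>2))" for m j
  proof -
    let ?v = "vel V j" and ?t = "of_int m * ?h"
    have "(norm (?v + ?t *\<^sub>R axis k 1))\<^sup>2 \<le> (norm ?v + \<bar>?t\<bar>)\<^sup>2"
      by (rule power_mono[OF order_trans[OF norm_triangle_ineq]]) (auto simp: norm_axis_1)
    also have "\<dots> \<le> 2 * (norm ?v)\<^sup>2 + 2 * ?t\<^sup>2"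
      using zero_le_power2[of "norm ?v - \<bar>?t\<bar>"] by (simp add: power2_eq_square algebra_simps)
    also have "\<dots> \<le> 2 * weight ?v * (1 + ?t\<^sup>2) - 1"
      using mult_nonneg_nonneg[of "(norm ?v)\<^sup>2" "?t\<^sup>2"] by (simp add: weight_def algebra_simps)
    finally have "weight (vel V (j + axis k m)) \<le> 2 * weight ?v * (1 + ?t\<^sup>2)"
      unfolding vel_shift by (simp add: weight_def)
    from mult_left_mono[OF this, of "\<bar>spline_green m\<bar>"] show ?thesis by (simp add: mult_ac)
  qed
  have s: "(\<lambda>m. (2 * weight (vel V j)) * (\<bar>spline_green m\<bar> * (1 + (of_int m * ?h)\<^sup>2))) summable_on UNIV" for j
    by (rule summable_on_cmult_right[OF spline_green_decay])
  have cs: "(\<lambda>m. \<bar>spline_green m\<bar> * weight (vel V (j + axis k m))) summable_on UNIV" for j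
  proof -
    have "(\<lambda>m. norm (\<bar>spline_green m\<bar> * weight (vel V (j + axis k m)))) summable_on UNIV"
      by (rule Infinite_Sum.abs_summable_on_comparison_test'[OF s[of j]])
        (use b in \<open>simp add: weight_nonneg abs_mult\<close>)
    then show ?thesis by (rule summable_on_iff_abs_summable_on_real[THEN iffD2])
  qed
  have cb: "(\<Sum>\<^sub>\<infinity>m. \<bar>spline_green m\<bar> * weight (vel V (j + axis k m))) \<le> (2 * ?G) * weight (vel V j)" for j
  proof -
    have "(\<Sum>\<^sub>\<infinity>m. \<bar>spline_green m\<bar> * weight (vel V (j + axis k m)))
      \<le> (\<Sum>\<^sub>\<infinity>m. (2 * weight (vel V j)) * (\<bar>spline_green m\<bar> * (1 + (of_int m * ?h)\<^sup>2)))"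
      by (rule infsum_mono[OF cs s b])
    then show ?thesis unfolding infsum_cmult_right' by (simp add: mult_ac)
  qed
  have "moment_summable V E"
    unfolding E_def by (rule kernel_moment_summable[OF _ f cs cb]) simp
  moreover have "E (upd k (i - 1) j) + 4 * E (upd k i j) + E (upd k (i + 1) j) = 6 * f (upd k i j)" for i j
    unfolding E_def upd_minus_axis
    by (rule spline_green_convolution[OF line_decay_summable[OF moment_summable_imp_line_decay[OF f]]])
  ultimately show ?thesis by (rule that)
qed

text \<open>
  Spline evaluation with given coefficients, as opposed to given data. Displacement \<open>\<delta>\<close>
  yields the advected distribution and displacement zero the original one, so that both are compared
  through the same coefficients.
\<close>

definition sampled_spline ::
  "vel_grid \<Rightarrow> 3 \<Rightarrow> (int^3 \<Rightarrow> real) \<Rightarrow> (real^3 \<Rightarrow> real) \<Rightarrow> int^3 \<Rightarrow> real" where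
  "sampled_spline V k E \<delta> j =
     spline_of (vorigin V $ k) (vspacing V $ k) (\<lambda>i. E (upd k i j)) (vel V j $ k - \<delta> (vel V j))"

lemma sampled_spline_kernel:
  "sampled_spline V k E \<delta> j
    = (\<Sum>\<^sub>\<infinity>m. bspline (vspacing V $ k) (of_int m * vspacing V $ k - \<delta> (vel V j)) * E (j - axis k m))"
proof -
  let ?z = "knot (vorigin V $ k) (vspacing V $ k)"
  let ?g = "\<lambda>i. E (upd k i j) * bspline (vspacing V $ k) (vel V j $ k - \<delta> (vel V j) - ?z i)"
  have "sampled_spline V k E \<delta> j = infsum ?g UNIV"
    by (simp add: sampled_spline_def spline_of_def)
  also have "\<dots> = (\<Sum>\<^sub>\<infinity>m. ?g (j $ k - m))"
    by (rule infsum_reindex_bij_betw[OF bij_int_reflect, symmetric])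
  also have "\<dots> = (\<Sum>\<^sub>\<infinity>m. bspline (vspacing V $ k) (of_int m * vspacing V $ k - \<delta> (vel V j)) * E (j - axis k m))"
  proof (rule infsum_cong)
    fix m
    have "upd k (j $ k - m) j = j - axis k m"
      using upd_minus_axis[of k "j $ k" j m] by (simp add: upd_self)
    moreover have "vel V j $ k - \<delta> (vel V j) - ?z (j $ k - m) = of_int m * vspacing V $ k - \<delta> (vel V j)"
      by (simp add: vel_nth knot_def algebra_simps)
    ultimately show "?g (j $ k - m) = bspline (vspacing V $ k) (of_int m * vspacing V $ k - \<delta> (vel V j)) * E (j - axis k m)"
      by (simp only: mult.commute)
  qed
  finally show ?thesis .
qed

text \<open>
  Along the axis the test function is a quadratic polynomial in the shift, so
  \<open>bspline_moments\<close> evaluates the inner sum. Applied to the weight itself, the same formula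
  yields the bound needed for exchanging the sums.
\<close>

lemma sampled_spline_moments:
  assumes V: "valid_vel_grid V" and E: "moment_summable V E"
    and \<delta>: "\<And>v. \<delta> v = d + y \<bullet> v" and y: "y $ k = 0"
  shows "moment_summable V (sampled_spline V k E \<delta>)"
    and "quad \<phi> \<Longrightarrow> (\<And>v t. \<phi> (v + t *\<^sub>R axis k 1) = \<phi> v + \<alpha> v * t + \<kappa> * t\<^sup>2) \<Longrightarrow>
      (\<Sum>\<^sub>\<infinity>j. \<phi> (vel V j) * sampled_spline V k E \<delta> j) =
      (\<Sum>\<^sub>\<infinity>j. (\<phi> (vel V j + \<delta> (vel V j) *\<^sub>R axis k 1) + \<kappa> * (vspacing V $ k)\<^sup>2 / 3) * E j)"
proof -
  let ?h = "vspacing V $ k"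
  let ?c = "\<lambda>m j. bspline ?h (of_int m * ?h - \<delta> (vel V j))"
  have h: "0 < ?h" using V by (simp add: valid_vel_grid_def)
  have ye: "y \<bullet> axis k 1 = 0" using y by (simp add: inner_axis)
  have inv: "?c m (j + axis k n) = ?c m j" for m j n
    by (simp add: vel_shift \<delta> inner_add_right ye)
  have hs: "((\<lambda>m. ?c m j * \<phi> (vel V (j + axis k m))) has_sum
      (\<phi> (vel V j + \<delta> (vel V j) *\<^sub>R axis k 1) + \<kappa> * ?h\<^sup>2 / 3)) UNIV"
    if line: "\<And>v t. \<phi> (v + t *\<^sub>R axis k 1) = \<phi> v + \<alpha> v * t + \<kappa> * t\<^sup>2" for \<phi> \<alpha> \<kappa> j
    unfolding vel_shift line
    using bspline_moments[OF h, of "\<delta> (vel V j)" "\<phi> (vel V j)" "\<alpha> (vel V j)" \<kappa>]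
    by (simp add: algebra_simps)
  obtain \<alpha>w \<kappa>w where w: "\<And>v t. weight (v + t *\<^sub>R axis k 1) = weight v + \<alpha>w v * t + \<kappa>w * t\<^sup>2"
    using quad_along_line[OF quad_weight, of "axis k 1"] by blast
  have "linear (\<lambda>v. v + (y \<bullet> v) *\<^sub>R axis k (1::real))"
    by (rule linearI) (simp_all add: inner_add_right algebra_simps)
  from quad_affine[OF quad_weight this, of "d *\<^sub>R axis k 1"]
  have "quad (\<lambda>v. weight (v + \<delta> v *\<^sub>R axis k 1))"
    by (simp add: \<delta> algebra_simps)
  then obtain K where K: "\<And>v. \<bar>weight (v + \<delta> v *\<^sub>R axis k 1)\<bar> \<le> K * weight v" using quad_bound by blast
  have ab: "\<bar>?c m j\<bar> = ?c m j" for m j using bspline_nonneg[OF h] by simp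
  have cs: "(\<lambda>m. \<bar>?c m j\<bar> * weight (vel V (j + axis k m))) summable_on UNIV" for j
    unfolding ab using hs[OF w] by (rule has_sum_imp_summable)
  have cb: "(\<Sum>\<^sub>\<infinity>m. \<bar>?c m j\<bar> * weight (vel V (j + axis k m))) \<le> (K + \<bar>\<kappa>w * ?h\<^sup>2 / 3\<bar>) * weight (vel V j)" for j
  proof -
    have "\<bar>\<kappa>w * ?h\<^sup>2 / 3\<bar> * 1 \<le> \<bar>\<kappa>w * ?h\<^sup>2 / 3\<bar> * weight (vel V j)"
      by (intro mult_left_mono weight_ge_1) auto
    then show ?thesis
      unfolding ab infsumI[OF hs[OF w]] distrib_right using K[of "vel V j"] by linarith
  qed
  show "moment_summable V (sampled_spline V k E \<delta>)"
    unfolding sampled_spline_kernel[abs_def] by (rule kernel_moment_summable[OF inv E cs cb])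
  assume q: "quad \<phi>" and line: "\<And>v t. \<phi> (v + t *\<^sub>R axis k 1) = \<phi> v + \<alpha> v * t + \<kappa> * t\<^sup>2"
  obtain L where L: "0 \<le> L" "\<And>v. \<bar>\<phi> v\<bar> \<le> L * weight v" using quad_bound[OF q] by blast
  show "(\<Sum>\<^sub>\<infinity>j. \<phi> (vel V j) * sampled_spline V k E \<delta> j) =
      (\<Sum>\<^sub>\<infinity>j. (\<phi> (vel V j + \<delta> (vel V j) *\<^sub>R axis k 1) + \<kappa> * (vspacing V $ k)\<^sup>2 / 3) * E j)"
    unfolding sampled_spline_kernel kernel_double_sum(2)[where c = ?c and \<phi> = "\<lambda>j. \<phi> (vel V j)", OF inv E cs cb L(2) L(1)]
      infsumI[OF hs[OF line]] ..
qed

text \<open>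
  Only the moments of order at most two behave as under a push-forward by \<open>T\<close>; the
  distribution itself is smeared by the interpolation.
\<close>

definition transports ::
  "vel_grid \<Rightarrow> (real^3 \<Rightarrow> real^3) \<Rightarrow> (int^3 \<Rightarrow> real) \<Rightarrow> (int^3 \<Rightarrow> real) \<Rightarrow> bool" where
  "transports V T f g \<longleftrightarrow> moment_summable V g \<and>
     (\<forall>\<phi>. quad \<phi> \<longrightarrow> (\<Sum>\<^sub>\<infinity>j. \<phi> (vel V j) * g j) = (\<Sum>\<^sub>\<infinity>j. \<phi> (T (vel V j)) * f j))"

text \<open>
  Data and advected data are the samples of one spline at displacements zero and \<open>\<delta>\<close>. Their
  moments against \<open>\<psi> v = \<phi> (v + \<delta> v e\<^sub>k)\<close> and \<open>\<phi>\<close>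
  respectively carry the same excess \<open>\<kappa> h\<^sup>2 / 3\<close>, because \<open>\<phi>\<close> and
  \<open>\<psi>\<close> have the same second-order coefficient along \<open>e\<^sub>k\<close>.
\<close>

lemma transports_advect:
  assumes V: "valid_vel_grid V" and f: "moment_summable V f"
    and \<delta>: "\<And>v. \<delta> v = d + y \<bullet> v" and y: "y $ k = 0"
  shows "transports V (\<lambda>v. v + \<delta> v *\<^sub>R axis k 1) f (advect V k \<delta> f)"
proof -
  obtain E where E: "moment_summable V E"
    and eq: "\<And>i j. E (upd k (i - 1) j) + 4 * E (upd k i j) + E (upd k (i + 1) j) = 6 * f (upd k i j)"
    using spline_coefficients_exist[OF f] by blast
  have h: "0 < vspacing V $ k" using V by (simp add: valid_vel_grid_def)
  have adv: "advect V k \<delta> f = sampled_spline V k E \<delta>"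
  proof
    fix j
    have "spline_interp (vorigin V $ k) (vspacing V $ k) (\<lambda>m. f (upd k m j))
        = spline_of (vorigin V $ k) (vspacing V $ k) (\<lambda>i. E (upd k i j))"
      by (rule spline_interp_eqI[OF h moment_summable_imp_line_decay[OF E] eq])
    then show "advect V k \<delta> f j = sampled_spline V k E \<delta> j"
      by (simp add: advect_def sampled_spline_def upd_def)
  qed
  have f_eq: "f = sampled_spline V k E (\<lambda>_. 0)"
  proof
    fix j show "f j = sampled_spline V k E (\<lambda>_. 0) j"
      using eq[of "j $ k" j] unfolding sampled_spline_def vel_nth diff_0_right spline_at_knot[OF h]
      by (simp add: upd_self)
  qed
  have ye: "y \<bullet> axis k 1 = 0" using y by (simp add: inner_axis)
  have "(\<Sum>\<^sub>\<infinity>j. \<phi> (vel V j) * advect V k \<delta> f j) =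
        (\<Sum>\<^sub>\<infinity>j. \<phi> (vel V j + \<delta> (vel V j) *\<^sub>R axis k 1) * f j)" if q: "quad \<phi>" for \<phi>
  proof -
    obtain \<alpha> \<kappa> where line: "\<And>v t. \<phi> (v + t *\<^sub>R axis k 1) = \<phi> v + \<alpha> v * t + \<kappa> * t\<^sup>2"
      using quad_along_line[OF q, of "axis k 1"] by blast
    \<comment> \<open>\<open>\<delta>\<close> is constant along axis \<open>k\<close>, so \<open>\<psi>\<close> inherits \<open>\<kappa>\<close> from \<open>\<phi>\<close>.\<close>
    define \<psi> where "\<psi> = (\<lambda>v. \<phi> (v + \<delta> v *\<^sub>R axis k 1))"
    have "linear (\<lambda>v. v + (y \<bullet> v) *\<^sub>R axis k (1::real))"
      by (rule linearI) (simp_all add: inner_add_right algebra_simps)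
    from quad_affine[OF q this, of "d *\<^sub>R axis k 1"]
    have q\<psi>: "quad \<psi>" by (simp add: \<psi>_def \<delta> algebra_simps)
    have line\<psi>: "\<psi> (v + t *\<^sub>R axis k 1) = \<psi> v + \<alpha> (v + \<delta> v *\<^sub>R axis k 1) * t + \<kappa> * t\<^sup>2" for v t
    proof -
      have "\<psi> (v + t *\<^sub>R axis k 1) = \<phi> ((v + \<delta> v *\<^sub>R axis k 1) + t *\<^sub>R axis k 1)"
        by (simp add: \<psi>_def \<delta> inner_add_right ye add_ac)
      then show ?thesis by (simp only: line \<psi>_def)
    qed
    have "(\<Sum>\<^sub>\<infinity>j. \<phi> (vel V j) * advect V k \<delta> f j)
      = (\<Sum>\<^sub>\<infinity>j. (\<psi> (vel V j) + \<kappa> * (vspacing V $ k)\<^sup>2 / 3) * E j)"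
      unfolding adv \<psi>_def by (rule sampled_spline_moments(2)[OF V E \<delta> y q line])
    also have "\<dots> = (\<Sum>\<^sub>\<infinity>j. \<psi> (vel V j) * f j)"
      using sampled_spline_moments(2)[OF V E, of "\<lambda>_. 0" 0 0 k, OF _ _ q\<psi> line\<psi>]
      unfolding f_eq[symmetric] by simp
    finally show ?thesis by (simp add: \<psi>_def)
  qed
  then show ?thesis
    unfolding transports_def adv using sampled_spline_moments(1)[OF V E \<delta> y] by blast
qed

text \<open>
  The second map is affine, so that substituting it keeps test functions quadratic.
\<close>

lemma transports_trans:
  assumes T: "transports V T f g" and S: "transports V (\<lambda>v. a + L v) g h" and L: "linear L"
  shows "transports V (\<lambda>v. a + L (T v)) f h"
  unfolding transports_def
proof (intro conjI allI impI)
  show "moment_summable V h" using S by (simp add: transports_def)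
  fix \<phi> assume q: "quad \<phi>"
  have "(\<Sum>\<^sub>\<infinity>j. \<phi> (vel V j) * h j) = (\<Sum>\<^sub>\<infinity>j. \<phi> (a + L (vel V j)) * g j)"
    using S q by (simp add: transports_def)
  also have "\<dots> = (\<Sum>\<^sub>\<infinity>j. \<phi> (a + L (T (vel V j))) * f j)"
    by (rule T[unfolded transports_def, THEN conjunct2, rule_format, OF quad_affine[OF q L]])
  finally show "(\<Sum>\<^sub>\<infinity>j. \<phi> (vel V j) * h j) = (\<Sum>\<^sub>\<infinity>j. \<phi> (a + L (T (vel V j))) * f j)" .
qed

lemma transports_moment_summable: "transports V T f g \<Longrightarrow> moment_summable V g"
  by (simp add: transports_def)

lemma transports_translate:
  assumes V: "valid_vel_grid V" and f: "moment_summable V f"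
  shows "transports V (\<lambda>v. v - a) f (translate V a f)"
proof -
  have s: "transports V (\<lambda>v. (- (a $ k)) *\<^sub>R axis k 1 + v) g (advect V k (\<lambda>_. - (a $ k)) g)"
    if "moment_summable V g" for g k
    using transports_advect[OF V that, of "\<lambda>_. - (a $ k)" "- (a $ k)" 0 k] by (simp add: add.commute)
  let ?f1 = "advect V 1 (\<lambda>_. - (a $ 1)) f" and ?f2 = "advect V 2 (\<lambda>_. - (a $ 2)) (advect V 1 (\<lambda>_. - (a $ 1)) f)"
  note 1 = s[OF f, of 1]
  note 2 = s[OF transports_moment_summable[OF 1], of 2]
  note 3 = s[OF transports_moment_summable[OF 2], of 3]
  note id = linear_ident
  have "transports V (\<lambda>v. (- (a $ 3)) *\<^sub>R axis 3 1 + ((- (a $ 2)) *\<^sub>R axis 2 1 + ((- (a $ 1)) *\<^sub>R axis 1 1 + v))) f (translate V a f)"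
    unfolding translate_def by (rule transports_trans[OF transports_trans[OF 1 2 id] 3 id])
  moreover have "(- (a $ 3)) *\<^sub>R axis 3 1 + ((- (a $ 2)) *\<^sub>R axis 2 1 + ((- (a $ 1)) *\<^sub>R axis 1 1 + v)) = v - a" for v
    by (simp add: vec_eq_iff forall_3 axis_def)
  ultimately show ?thesis by (simp only:)
qed

text \<open>
  The inverse of the substitution made by \<open>shear\<close>: a distribution evaluated at
  \<open>v + c\<close> has its moments moved by \<open>- c\<close>.
\<close>

definition unshear :: "real \<Rightarrow> 3 \<Rightarrow> real^3 \<Rightarrow> real^3 \<Rightarrow> real^3" where
  "unshear dt k y v = v - (dt * (y \<bullet> v)) *\<^sub>R axis k 1"

lemma linear_unshear: "linear (unshear dt k y)"
  unfolding unshear_def by (rule linearI) (simp_all add: inner_add_right algebra_simps)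

lemma shear_unshear:
  assumes "y $ k = 0"
  shows "unshear dt k y v + (dt * (y \<bullet> unshear dt k y v)) *\<^sub>R axis k 1 = v"
  using assms by (simp add: unshear_def inner_diff_right inner_axis)

lemma transports_shear_advect:
  assumes V: "valid_vel_grid V" and f: "moment_summable V f" and y: "y $ k = 0"
  shows "transports V (\<lambda>v. 0 + unshear dt k y v) f (shear_advect V dt k y f)"
  using transports_advect[OF V f, of "\<lambda>v. - (dt * (y \<bullet> v))" 0 "- (dt *\<^sub>R y)" k] y
  by (simp add: shear_advect_def unshear_def[abs_def])

lemma transports_rotate_split:
  assumes V: "valid_vel_grid V" and f: "moment_summable V f"
    and y: "yl $ s = 0" "yr $ s = 0" "yk k1 $ k1 = 0" "yk k2 $ k2 = 0"
  shows "transports V (\<lambda>v. unshear dt s yl (unshear dt k1 (yk k1) (unshear dt k2 (yk k2) (unshear dt s yr v)))) f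
    (rotate_split V dt s k1 k2 yl yk yr f)"
proof -
  note t = transports_shear_advect[OF V]
  note 1 = t[OF f y(2), of dt]
  note 2 = t[OF transports_moment_summable[OF 1] y(4), of dt]
  note 3 = t[OF transports_moment_summable[OF 2] y(3), of dt]
  note 4 = t[OF transports_moment_summable[OF 3] y(1), of dt]
  note L = linear_unshear
  show ?thesis
    using transports_trans[OF transports_trans[OF transports_trans[OF 1 2 L] 3 L] 4 L]
    by (simp add: rotate_split_def)
qed

section \<open>Gyration\<close>

lemma linear_hat: "linear (hat B)"
  unfolding hat_def by (rule linearI) (simp_all add: cross_add_left cross_mult_left)

lemma bounded_linear_hat: "bounded_linear (hat B)"
  using linear_hat by (simp add: linear_conv_bounded_linear)

lemma norm_hat_le: "norm (hat B v) \<le> norm B * norm v"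
proof -
  have "(norm (hat B v))\<^sup>2 \<le> (norm B * norm v)\<^sup>2"
    using norm_cross_dot[of v B] zero_le_power2[of "v \<bullet> B"] unfolding hat_def mult.commute[of "norm v"]
    by linarith
  then show ?thesis by (rule power2_le_imp_le) simp
qed

lemma norm_hat_funpow_le: "norm ((hat B ^^ n) v) \<le> norm B ^ n * norm v"
proof (induction n)
  case (Suc n)
  have "norm ((hat B ^^ Suc n) v) \<le> norm B * norm ((hat B ^^ n) v)" using norm_hat_le by simp
  also have "\<dots> \<le> norm B * (norm B ^ n * norm v)" by (intro mult_left_mono Suc) simp
  finally show ?case by (simp add: mult.assoc)
qed simp

lemma scaled_hat_funpow: "((\<lambda>w. x *\<^sub>R hat B w) ^^ n) v = x ^ n *\<^sub>R (hat B ^^ n) v"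
proof (induction n)
  case (Suc n)
  then show ?case by (simp add: linear_cmul[OF linear_hat])
qed simp

text \<open>
  The norm of the \<open>n\<close>-th iterate is at most \<open>norm B ^ n * norm v\<close>, so the series is
  dominated by an exponential series.
\<close>

lemma exp_op_hat_summable: "summable (\<lambda>n. (x ^ n / fact n) *\<^sub>R (hat B ^^ n) v)"
proof (rule summable_comparison_test')
  show "summable (\<lambda>n. norm v * (inverse (fact n) * (\<bar>x\<bar> * norm B) ^ n))"
    by (intro summable_mult summable_exp)
  show "norm ((x ^ n / fact n) *\<^sub>R (hat B ^^ n) v) \<le> norm v * (inverse (fact n) * (\<bar>x\<bar> * norm B) ^ n)" for n
  proof -
    have "norm ((x ^ n / fact n) *\<^sub>R (hat B ^^ n) v) = (\<bar>x\<bar> ^ n / fact n) * norm ((hat B ^^ n) v)"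
      by (simp add: power_abs)
    also have "\<dots> \<le> (\<bar>x\<bar> ^ n / fact n) * (norm B ^ n * norm v)"
      by (intro mult_left_mono norm_hat_funpow_le) simp
    finally show ?thesis by (simp add: power_mult_distrib divide_inverse mult_ac)
  qed
qed

lemma exp_op_hat_series:
  "exp_op (\<lambda>w. x *\<^sub>R hat B w) v = (\<Sum>n. (x ^ n / fact n) *\<^sub>R (hat B ^^ n) v)"
  by (simp add: exp_op_def scaled_hat_funpow divide_inverse mult.commute)

lemma exp_op_hat_0: "exp_op (\<lambda>w. 0 *\<^sub>R hat B w) v = v"
proof -
  have "exp_op (\<lambda>w. 0 *\<^sub>R hat B w) v = (\<Sum>n. if n = 0 then v else 0)"
    unfolding exp_op_hat_series by (rule arg_cong[where f = suminf]) auto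
  then show ?thesis using suminf_finite[of "{0::nat}" "\<lambda>n. if n = 0 then v else 0"] by simp
qed

text \<open>
  Every component is an entire power series in the angle parameter; differentiating it termwise drops
  the first term and applies \<open>hat B\<close> once more to the others.
\<close>

lemma exp_op_hat_derivative:
  "((\<lambda>x. exp_op (\<lambda>w. x *\<^sub>R hat B w) v) has_vector_derivative
    exp_op (\<lambda>w. x *\<^sub>R hat B w) v \<times> B) (at x)"
proof -
  let ?X = "\<lambda>x. exp_op (\<lambda>w. x *\<^sub>R hat B w) v"
  have bl: "bounded_linear (\<lambda>w. w \<bullet> b)" for b :: "real^3" by (rule bounded_linear_inner_left)
  have comp: "?X x \<bullet> b = (\<Sum>n. ((hat B ^^ n) v \<bullet> b / fact n) * x ^ n)"
    and sc: "summable (\<lambda>n. ((hat B ^^ n) v \<bullet> b / fact n) * x ^ n)" for x b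
    using bounded_linear.suminf[OF bl exp_op_hat_summable[of x B v], of b]
      bounded_linear.summable[OF bl exp_op_hat_summable[of x B v], of b]
    by (simp_all add: exp_op_hat_series mult.commute)
  have der: "(?X x \<times> B) \<bullet> b = (\<Sum>n. diffs (\<lambda>n. (hat B ^^ n) v \<bullet> b / fact n) n * x ^ n)" for b
  proof -
    have blh: "bounded_linear (\<lambda>w. hat B w \<bullet> b)"
      by (rule bounded_linear_compose[OF bl bounded_linear_hat])
    have "hat B (?X x) \<bullet> b = (\<Sum>n. hat B ((x ^ n / fact n) *\<^sub>R (hat B ^^ n) v) \<bullet> b)"
      unfolding exp_op_hat_series by (rule bounded_linear.suminf[OF blh exp_op_hat_summable])
    also have "\<dots> = (\<Sum>n. diffs (\<lambda>n. (hat B ^^ n) v \<bullet> b / fact n) n * x ^ n)"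
    proof (rule arg_cong[where f = suminf], rule ext)
      fix n
      show "hat B ((x ^ n / fact n) *\<^sub>R (hat B ^^ n) v) \<bullet> b
        = diffs (\<lambda>n. (hat B ^^ n) v \<bullet> b / fact n) n * x ^ n"
        by (simp add: diffs_def linear_cmul[OF linear_hat] del: of_nat_Suc)
    qed
    finally show ?thesis by (simp add: hat_def)
  qed
  have "((\<lambda>x. ?X x \<bullet> b) has_real_derivative (?X x \<times> B) \<bullet> b) (at x)" for b
    unfolding comp der by (rule termdiffs_strong_converges_everywhere[OF sc])
  then show ?thesis
    unfolding has_vector_derivative_def has_derivative_componentwise_within[of ?X]
    by (simp add: has_field_derivative_def mult.commute[of _ "(?X x \<times> B) \<bullet> _"] mult_commute_abs)
qed

text \<open>
  The derivative of \<open>d \<bullet> d\<close> is \<open>- 2 d \<bullet> (d \<times> B) = 0\<close>.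
\<close>

lemma gyration_norm_constant:
  fixes d :: "real \<Rightarrow> real^3"
  assumes T: "0 \<le> T"
    and d: "\<And>t. t \<in> {0..T} \<Longrightarrow> (d has_vector_derivative - (d t \<times> B)) (at t within {0..T})"
  shows "norm (d T) = norm (d 0)"
proof -
  have "((\<lambda>t. d t \<bullet> d t) has_vector_derivative 0) (at t within {0..T})" if "t \<in> {0..T}" for t
  proof -
    have "((\<lambda>t. d t \<bullet> d t) has_derivative (\<lambda>h. d t \<bullet> (h *\<^sub>R (- (d t \<times> B))) + (h *\<^sub>R (- (d t \<times> B))) \<bullet> d t)) (at t within {0..T})"
      using d[OF that] unfolding has_vector_derivative_def by (intro has_derivative_inner)
    then show ?thesis
      by (simp add: has_vector_derivative_def dot_cross_self)
  qed
  then obtain c where "\<And>t. t \<in> {0..T} \<Longrightarrow> d t \<bullet> d t = c"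
    using has_vector_derivative_zero_constant[of "{0..T}" "\<lambda>t. d t \<bullet> d t"] by auto
  then have "d T \<bullet> d T = d 0 \<bullet> d 0" using T by auto
  then show ?thesis by (simp add: norm_eq_sqrt_inner)
qed

lemma exp_op_gyration:
  "((\<lambda>t. exp_op (\<lambda>w. - t *\<^sub>R hat B w) v) has_vector_derivative
     - (exp_op (\<lambda>w. - t *\<^sub>R hat B w) v \<times> B)) (at t within S)"
proof -
  have "((\<lambda>t. - t) has_vector_derivative (-1::real)) (at t within S)"
    by (auto intro!: derivative_eq_intros)
  from vector_diff_chain_within[OF this has_vector_derivative_at_within[OF exp_op_hat_derivative]]
  show ?thesis by (simp add: o_def)
qed

lemma norm_exp_op_hat:
  assumes "0 \<le> T" shows "norm (exp_op (\<lambda>w. - T *\<^sub>R hat B w) v) = norm v"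
proof -
  have "norm (exp_op (\<lambda>w. - T *\<^sub>R hat B w) v) = norm (exp_op (\<lambda>w. - 0 *\<^sub>R hat B w) v)"
    by (rule gyration_norm_constant[OF assms exp_op_gyration])
  then show ?thesis using exp_op_hat_0[of B v] by simp
qed

text \<open>
  The difference of two solutions is again a solution, and its norm is constant.
\<close>

lemma gyration_unique:
  fixes \<phi> :: "real \<Rightarrow> real^3"
  assumes T: "0 \<le> T"
    and \<phi>: "\<And>t. t \<in> {0..T} \<Longrightarrow> (\<phi> has_vector_derivative - (\<phi> t \<times> B)) (at t within {0..T})"
  shows "\<phi> T = exp_op (\<lambda>w. - T *\<^sub>R hat B w) (\<phi> 0)"
proof -
  let ?\<psi> = "\<lambda>t. exp_op (\<lambda>w. - t *\<^sub>R hat B w) (\<phi> 0)"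
  have "norm (\<phi> T - ?\<psi> T) = norm (\<phi> 0 - ?\<psi> 0)"
  proof (rule gyration_norm_constant[OF T])
    fix t assume "t \<in> {0..T}"
    from has_vector_derivative_diff[OF \<phi>[OF this] exp_op_gyration]
    show "((\<lambda>t. \<phi> t - ?\<psi> t) has_vector_derivative - ((\<phi> t - ?\<psi> t) \<times> B)) (at t within {0..T})"
      by (simp add: Cross3.left_diff_distrib)
  qed
  also have "?\<psi> 0 = \<phi> 0" using exp_op_hat_0[of B "\<phi> 0"] by simp
  finally show ?thesis by simp
qed

lemma par_part_cross: "par_part B g \<times> B = 0"
  by (simp add: par_part_def cross_mult_left)

text \<open>
  The drift is built so that its gyration replaces the part of the force perpendicular to the magnetic
  field.
\<close>

lemma drift_cross: "drift B g \<times> B = g - par_part B g"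
proof (cases "B = 0")
  case False
  have "(B \<times> g) \<times> B = (B \<bullet> B) *\<^sub>R g - (g \<bullet> B) *\<^sub>R B"
    by (simp add: cross3_simps forall_3)
  then show ?thesis
    using False by (simp add: drift_def par_part_def cross_mult_left power2_norm_eq_inner scaleR_diff_right)
qed (simp add: drift_def par_part_def)

text \<open>
  In the following, \<open>u\<close> is the path of the mean velocity in one cell, \<open>ub\<close> its time
  average, \<open>J\<close> the current divided by the density and \<open>g\<close> the pressure gradient divided by
  the density.
\<close>

context
  fixes u :: "real \<Rightarrow> real^3" and B J g ub :: "real^3" and dt tn :: real
  assumes dt: "0 < dt"
    and u: "\<And>t. t \<in> {tn..tn + dt} \<Longrightarrow>
      (u has_vector_derivative (u t - ub + J) \<times> B - g) (at t within {tn..tn + dt})"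
    and ub: "ub = (1 / dt) *\<^sub>R integral {tn..tn + dt} u"
begin

lemma path_integral: "(u has_integral dt *\<^sub>R ub) {tn..tn + dt}"
proof -
  have "continuous_on {tn..tn + dt} u"
    unfolding continuous_on_eq_continuous_within using u has_vector_derivative_continuous by blast
  then have "(u has_integral integral {tn..tn + dt} u) {tn..tn + dt}"
    by (intro integrable_integral integrable_continuous_real)
  then show ?thesis using dt by (simp add: ub)
qed

lemma path_integral_linear:
  assumes "bounded_linear L" shows "((\<lambda>t. L (u t)) has_integral dt *\<^sub>R L ub) {tn..tn + dt}"
  using has_integral_linear[OF path_integral assms]
  by (simp add: o_def linear_cmul[OF bounded_linear.linear[OF assms]])

lemma path_increment: "u (tn + dt) - u tn = dt *\<^sub>R (J \<times> B - g)"
proof -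
  have "((\<lambda>t. (u t - ub + J) \<times> B - g) has_integral u (tn + dt) - u tn) {tn..tn + dt}"
    by (rule fundamental_theorem_of_calculus) (use u dt in auto)
  moreover have "((\<lambda>t. hat B (u t) + ((J - ub) \<times> B - g)) has_integral
      dt *\<^sub>R hat B ub + dt *\<^sub>R ((J - ub) \<times> B - g)) {tn..tn + dt}"
    using has_integral_add[OF path_integral_linear[OF bounded_linear_hat]
        has_integral_const_real[of "(J - ub) \<times> B - g" tn "tn + dt"]] dt by simp
  moreover have "(\<lambda>t. (u t - ub + J) \<times> B - g) = (\<lambda>t. hat B (u t) + ((J - ub) \<times> B - g))"
    by (simp add: hat_def cross_add_left Cross3.left_diff_distrib algebra_simps)
  ultimately have "u (tn + dt) - u tn = dt *\<^sub>R hat B ub + dt *\<^sub>R ((J - ub) \<times> B - g)"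
    using has_integral_unique by metis
  then show ?thesis
    by (simp add: hat_def Cross3.left_diff_distrib algebra_simps)
qed

text \<open>
  The self-interaction \<open>u \<bullet> (u \<times> B)\<close> vanishes, so the power is linear in
  \<open>u\<close> and its integral only involves the time average \<open>ub\<close>; the average in turn drops
  out of \<open>ub \<bullet> ((J - ub) \<times> B)\<close>.
\<close>

lemma path_energy: "(norm (u (tn + dt)))\<^sup>2 - (norm (u tn))\<^sup>2 = 2 * dt * (ub \<bullet> (J \<times> B) - ub \<bullet> g)"
proof -
  let ?k = "(J - ub) \<times> B - g"
  have "((\<lambda>t. u t \<bullet> u t) has_vector_derivative 2 * (u t \<bullet> ?k)) (at t within {tn..tn + dt})"
    if t: "t \<in> {tn..tn + dt}" for t
  proof -
    let ?d = "(u t - ub + J) \<times> B - g"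
    have e: "u t \<bullet> ?d = u t \<bullet> ?k"
    proof -
      have "?d = u t \<times> B + ?k" by (simp add: cross_add_left Cross3.left_diff_distrib)
      then show ?thesis by (simp only: inner_add_right dot_cross_self add_0_left)
    qed
    have "((\<lambda>t. u t \<bullet> u t) has_derivative (\<lambda>h. u t \<bullet> (h *\<^sub>R ?d) + (h *\<^sub>R ?d) \<bullet> u t)) (at t within {tn..tn + dt})"
      using u[OF t] unfolding has_vector_derivative_def by (intro has_derivative_inner)
    moreover have "(\<lambda>h. u t \<bullet> (h *\<^sub>R ?d) + (h *\<^sub>R ?d) \<bullet> u t) = (\<lambda>h. h *\<^sub>R (2 * (u t \<bullet> ?k)))"
      unfolding inner_commute[of "_ *\<^sub>R ?d" "u t"] inner_scaleR_right e by (simp add: fun_eq_iff)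
    ultimately show ?thesis by (simp only: has_vector_derivative_def)
  qed
  then have "((\<lambda>t. 2 * (u t \<bullet> ?k)) has_integral u (tn + dt) \<bullet> u (tn + dt) - u tn \<bullet> u tn) {tn..tn + dt}"
    using dt by (intro fundamental_theorem_of_calculus) auto
  moreover have "((\<lambda>t. 2 * (u t \<bullet> ?k)) has_integral dt *\<^sub>R (2 * (ub \<bullet> ?k))) {tn..tn + dt}"
    by (intro path_integral_linear bounded_linear_const_mult bounded_linear_inner_left)
  ultimately have "u (tn + dt) \<bullet> u (tn + dt) - u tn \<bullet> u tn = dt *\<^sub>R (2 * (ub \<bullet> ?k))"
    by (rule has_integral_unique)
  moreover have "ub \<bullet> ?k = ub \<bullet> (J \<times> B) - ub \<bullet> g"
    by (simp add: Cross3.left_diff_distrib inner_diff_right dot_cross_self)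
  ultimately show ?thesis by (simp add: power2_norm_eq_inner)
qed

text \<open>
  Relative to \<open>w\<close>, the path gyrates freely apart from a constant force along the magnetic
  field, which is not rotated. Traversing the path backwards from its end point and removing this force
  leaves a pure gyration, for which the exponential is the unique solution. Going backwards produces
  directly the exponential that appears in the splitting hypothesis.
\<close>

lemma path_endpoint:
  defines "w \<equiv> ub + drift B g - J"
  shows "exp_op (\<lambda>v. - dt *\<^sub>R hat B v) (u (tn + dt) - w) = u tn - w - dt *\<^sub>R par_part B g"
proof -
  \<comment> \<open>The path in reversed time, relative to \<open>w\<close> and with the impulse of the parallel force removed.\<close>
  define \<phi> where "\<phi> t = u (tn + dt - t) - w - t *\<^sub>R par_part B g" for t
  have im: "(\<lambda>t. tn + dt - t) ` {0..dt} = {tn..tn + dt}"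
    by (auto simp: image_iff intro!: bexI[of _ "tn + dt - _"])
  have \<phi>: "(\<phi> has_vector_derivative - (\<phi> t \<times> B)) (at t within {0..dt})" if t: "t \<in> {0..dt}" for t
  proof -
    let ?s = "tn + dt - t"
    have "(u has_vector_derivative (u ?s - ub + J) \<times> B - g) (at ?s within (\<lambda>t. tn + dt - t) ` {0..dt})"
      unfolding im using t by (intro u) auto
    moreover have "((\<lambda>t. tn + dt - t) has_vector_derivative (-1::real)) (at t within {0..dt})"
      by (auto intro!: derivative_eq_intros)
    ultimately have "((\<lambda>t. u (tn + dt - t)) has_vector_derivative - ((u ?s - ub + J) \<times> B - g)) (at t within {0..dt})"
      using vector_diff_chain_within[of "\<lambda>t. tn + dt - t" "-1" t "{0..dt}" u "(u ?s - ub + J) \<times> B - g"]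
      unfolding o_def scaleR_minus1_left by blast
    then have "(\<phi> has_vector_derivative (- ((u ?s - ub + J) \<times> B - g) - 0 - par_part B g)) (at t within {0..dt})"
      unfolding \<phi>_def by (intro has_vector_derivative_diff has_vector_derivative_const)
        (auto intro!: derivative_eq_intros)
    moreover have "- ((u ?s - ub + J) \<times> B - g) - 0 - par_part B g = - (\<phi> t \<times> B)"
    proof -
      have "\<phi> t \<times> B = (u ?s - ub + J) \<times> B - drift B g \<times> B - t *\<^sub>R (par_part B g \<times> B)"
        by (simp add: \<phi>_def w_def cross_add_left Cross3.left_diff_distrib cross_mult_left)
      then show ?thesis by (simp add: drift_cross par_part_cross)
    qed
    ultimately show ?thesis by simp
  qed
  from gyration_unique[OF less_imp_le[OF dt] this]
  show ?thesis by (simp add: \<phi>_def)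
qed

end

section \<open>One velocity step in a cell\<close>

definition moment :: "vel_grid \<Rightarrow> (int^3 \<Rightarrow> real) \<Rightarrow> (real^3 \<Rightarrow> real) \<Rightarrow> real" where
  "moment V f \<phi> = (\<Sum>\<^sub>\<infinity>j. \<phi> (vel V j) * f j)"

definition first_moment :: "vel_grid \<Rightarrow> (int^3 \<Rightarrow> real) \<Rightarrow> real^3" where
  "first_moment V f = (\<Sum>\<^sub>\<infinity>j. f j *\<^sub>R vel V j)"

lemma quad_summable:
  assumes "moment_summable V f" "quad \<phi>"
  shows "(\<lambda>j. \<phi> (vel V j) * f j) summable_on UNIV"
proof -
  obtain K where "\<And>v. \<bar>\<phi> v\<bar> \<le> K * weight v" using quad_bound[OF assms(2)] by blast
  from moment_summable_dominated[OF assms(1) this] show ?thesis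
    by (rule summable_on_iff_abs_summable_on_real[THEN iffD2])
qed

lemma moment_add:
  assumes "moment_summable V f" "quad \<phi>" "quad \<psi>"
  shows "moment V f (\<lambda>v. \<phi> v + \<psi> v) = moment V f \<phi> + moment V f \<psi>"
  unfolding moment_def distrib_right by (intro infsum_add quad_summable assms)

lemma moment_const: "moment V f (\<lambda>v. c) = c * moment V f (\<lambda>v. 1)"
  by (simp add: moment_def infsum_cmult_right')

lemma first_moment_summable:
  assumes "moment_summable V f"
  shows "(\<lambda>j. f j *\<^sub>R vel V j) summable_on UNIV"
proof -
  have "(\<lambda>j. norm (norm (vel V j) * f j)) summable_on UNIV"
    by (rule moment_summable_dominated[OF assms, of _ 1]) (simp add: norm_le_weight)
  then have "(\<lambda>j. norm (f j *\<^sub>R vel V j)) summable_on UNIV" by (simp add: abs_mult mult.commute)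
  then show ?thesis by (rule Infinite_Sum.abs_summable_summable)
qed

lemma moment_linear:
  assumes "moment_summable V f" "linear l"
  shows "moment V f l = l (first_moment V f)"
proof -
  have "bounded_linear l" using assms(2) by (simp add: linear_conv_bounded_linear)
  from infsumI[OF has_sum_bounded_linear[OF this has_sum_infsum[OF first_moment_summable[OF assms(1)]]]]
  show ?thesis by (simp add: moment_def first_moment_def linear_cmul[OF assms(2)] mult.commute)
qed

lemma vel_vol_pos: "valid_vel_grid V \<Longrightarrow> 0 < vel_vol V"
  unfolding vel_vol_def valid_vel_grid_def by (intro prod_pos) auto

lemma mass_density_moment: "mass_density V f = vel_vol V * moment V f (\<lambda>v. 1)"
  unfolding mass_density_def moment_def infsum_cmult_left' by simp

lemma mean_vel_first_moment:
  assumes V: "valid_vel_grid V" and f: "moment_summable V f"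
  shows "mean_vel V f = (1 / moment V f (\<lambda>v. 1)) *\<^sub>R first_moment V f"
proof -
  have "(\<Sum>\<^sub>\<infinity>j. (f j * vel_vol V) *\<^sub>R vel V j) = (\<Sum>\<^sub>\<infinity>j. vel_vol V *\<^sub>R (f j *\<^sub>R vel V j))"
    by (simp add: mult.commute)
  also have "\<dots> = vel_vol V *\<^sub>R first_moment V f"
    unfolding first_moment_def by (rule infsum_scaleR_right)
  finally show ?thesis
    using vel_vol_pos[OF V] by (simp add: mean_vel_def mass_density_moment)
qed

text \<open>
  The mean velocity moves along with the rigid motion. For the energy, write
  \<open>\<bar>w + R (v - a)\<bar>\<^sup>2\<close> as \<open>\<bar>v\<bar>\<^sup>2\<close> plus an affine function of
  \<open>v\<close>, which is where the isometry is used. The average of an affine function is its value at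
  the mean velocity, so the thermal energy, that is, the energy of the deviation from the mean, is
  unchanged.
\<close>

lemma rigid_transport_moments:
  assumes V: "valid_vel_grid V" and f: "moment_summable V f"
    and T: "transports V (\<lambda>v. w + R (v - a)) f g"
    and R: "linear R" and iso: "\<And>v. norm (R v) = norm v"
    and N: "moment V f (\<lambda>v. 1) \<noteq> 0"
  shows "moment V g (\<lambda>v. 1) = moment V f (\<lambda>v. 1)"
    and "mean_vel V g = w + R (mean_vel V f - a)"
    and "moment V g (\<lambda>v. (norm v)\<^sup>2) - moment V f (\<lambda>v. (norm v)\<^sup>2)
      = moment V f (\<lambda>v. 1) * ((norm (mean_vel V g))\<^sup>2 - (norm (mean_vel V f))\<^sup>2)"
proof -
  interpret R: linear R by fact
  let ?N = "moment V f (\<lambda>v. 1)" and ?P = "first_moment V f"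
  have g: "moment_summable V g" using T by (rule transports_moment_summable)
  have tr: "moment V g \<phi> = moment V f (\<lambda>v. \<phi> (w + R (v - a)))" if "quad \<phi>" for \<phi>
    unfolding moment_def
    by (rule T[unfolded transports_def, THEN conjunct2, rule_format, OF that])
  show N1: "moment V g (\<lambda>v. 1) = ?N" by (rule tr[OF quad_const])
  have P: "?P = ?N *\<^sub>R mean_vel V f" using N by (simp add: mean_vel_first_moment[OF V f])
  have aff: "moment V f (\<lambda>v. c + l v) = c * ?N + l ?P" if "linear l" for c l
    by (simp add: moment_add[OF f quad_const quad_linear[OF that]] moment_const[of _ _ c] moment_linear[OF f that])
  have "b \<bullet> first_moment V g = b \<bullet> (?N *\<^sub>R (w + R (mean_vel V f - a)))" for b
  proof -
    have lb: "linear (\<lambda>v. b \<bullet> v)" by (rule linearI) (simp_all add: inner_add_right)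
    have lR: "linear (\<lambda>v. b \<bullet> R v)" by (rule linearI) (simp_all add: inner_add_right R.add R.scale)
    have "b \<bullet> first_moment V g = moment V f (\<lambda>v. b \<bullet> (w + R (v - a)))"
      using moment_linear[OF g lb] tr[OF quad_linear[OF lb]] by simp
    also have "\<dots> = moment V f (\<lambda>v. b \<bullet> (w - R a) + b \<bullet> R v)"
      by (simp add: R.diff inner_add_right inner_diff_right algebra_simps)
    also have "\<dots> = b \<bullet> (w - R a) * ?N + b \<bullet> R ?P" by (rule aff[OF lR])
    also have "\<dots> = b \<bullet> (?N *\<^sub>R (w + R (mean_vel V f - a)))"
      unfolding P by (simp add: R.diff R.scale inner_add_right inner_diff_right algebra_simps)
    finally show ?thesis .
  qed
  then have P1: "first_moment V g = ?N *\<^sub>R (w + R (mean_vel V f - a))"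
    by (rule vector_eq_ldot[THEN iffD1, OF allI])
  show mg: "mean_vel V g = w + R (mean_vel V f - a)"
    using N by (simp add: mean_vel_first_moment[OF V g] N1 P1)
  \<comment> \<open>The transported energy density is \<open>c + l v\<close> plus the original one.\<close>
  define c where "c = (norm w)\<^sup>2 - 2 * (w \<bullet> R a) + (norm a)\<^sup>2"
  define l where "l v = 2 * (w \<bullet> R v) - 2 * (a \<bullet> v)" for v
  have l: "linear l"
    unfolding l_def by (rule linearI) (simp_all add: inner_add_right R.add R.scale algebra_simps)
  have sq: "(norm (w + R (v - a)))\<^sup>2 = (c + l v) + (norm v)\<^sup>2" for v
  proof -
    have plus: "(norm (w + x))\<^sup>2 = (norm w)\<^sup>2 + 2 * (w \<bullet> x) + (norm x)\<^sup>2" for x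
      by (simp add: power2_norm_eq_inner inner_add_left inner_add_right inner_commute)
    have minus: "(norm (v - a))\<^sup>2 = (norm v)\<^sup>2 - 2 * (a \<bullet> v) + (norm a)\<^sup>2"
      by (simp add: power2_norm_eq_inner inner_diff_left inner_diff_right inner_commute)
    show ?thesis
      unfolding plus iso minus unfolding c_def l_def R.diff inner_diff_right by simp
  qed
  have qcl: "quad (\<lambda>v. c + l v)"
    by (rule quadI[OF l bilinear_zero, of _ c]) simp
  have "moment V g (\<lambda>v. (norm v)\<^sup>2) = moment V f (\<lambda>v. (c + l v) + (norm v)\<^sup>2)"
    unfolding tr[OF quad_norm_square] sq ..
  also have "\<dots> = (c * ?N + l ?P) + moment V f (\<lambda>v. (norm v)\<^sup>2)"
    by (simp only: moment_add[OF f qcl quad_norm_square] aff[OF l])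
  also have "l ?P = ?N * l (mean_vel V f)"
    unfolding P using linear_cmul[OF l] by simp
  finally have "moment V g (\<lambda>v. (norm v)\<^sup>2) - moment V f (\<lambda>v. (norm v)\<^sup>2) = ?N * (c + l (mean_vel V f))"
    by (simp add: algebra_simps)
  then show "moment V g (\<lambda>v. (norm v)\<^sup>2) - moment V f (\<lambda>v. (norm v)\<^sup>2)
      = ?N * ((norm (mean_vel V g))\<^sup>2 - (norm (mean_vel V f))\<^sup>2)"
    unfolding mg sq by simp
qed

text \<open>
  Testing the operator identity on coordinate functions shows that the rotation is the composition of
  the four shears. Moments move by the inverse shears in the opposite order.
\<close>

lemma exact_splitting_inverse:
  assumes sp: "exact_splitting dt B s k1 k2 yl yk yr" and ne: "k1 \<noteq> s" "k2 \<noteq> s"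
  defines "R \<equiv> \<lambda>v. unshear dt s yl (unshear dt k1 (yk k1) (unshear dt k2 (yk k2) (unshear dt s yr v)))"
  shows "exp_op (\<lambda>w. - dt *\<^sub>R hat B w) (R v) = v"
    and "R (exp_op (\<lambda>w. - dt *\<^sub>R hat B w) v) = v"
    and "linear R"
proof -
  let ?S = "\<lambda>k y v. v + (dt * (y \<bullet> v)) *\<^sub>R axis k (1::real)"
  have y: "yl $ s = 0" "yr $ s = 0" "yk k1 $ k1 = 0" "yk k2 $ k2 = 0"
    using sp ne by (auto simp: exact_splitting_def)
  have E: "exp_op (\<lambda>w. - dt *\<^sub>R hat B w) v = ?S s yr (?S k2 (yk k2) (?S k1 (yk k1) (?S s yl v)))" for v
  proof -
    have "g (exp_op (\<lambda>w. - dt *\<^sub>R hat B w) v) = g (?S s yr (?S k2 (yk k2) (?S k1 (yk k1) (?S s yl v))))"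
      for g :: "real^3 \<Rightarrow> real"
      using sp unfolding exact_splitting_def shear_def by blast
    from this[of "\<lambda>x. x $ _"] show ?thesis by (simp add: vec_eq_iff)
  qed
  have SU: "?S k y (unshear dt k y v) = v" if "y $ k = 0" for k y v
    by (rule shear_unshear[OF that])
  have US: "unshear dt k y (?S k y v) = v" if "y $ k = 0" for k y v
    using that by (simp add: unshear_def inner_add_right inner_axis)
  show "exp_op (\<lambda>w. - dt *\<^sub>R hat B w) (R v) = v"
    unfolding E R_def SU[OF y(1)] SU[OF y(2)] SU[OF y(3)] SU[OF y(4)] ..
  show "R (exp_op (\<lambda>w. - dt *\<^sub>R hat B w) v) = v"
    unfolding E R_def US[OF y(1)] US[OF y(2)] US[OF y(3)] US[OF y(4)] ..
  show "linear R"
    unfolding R_def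
    by (intro linear_compose[OF _ linear_unshear, unfolded o_def] linear_unshear)
qed

lemma transports_vlasov_step:
  fixes G :: space_grid and \<rho> p :: "nat^3 \<Rightarrow> real" and ub B :: "nat^3 \<Rightarrow> real^3" and i :: "nat^3"
  assumes V: "valid_vel_grid V" and f: "moment_summable V f"
    and sp: "exact_splitting dt (B i) s k1 k2 (yl i) (yk i) (yr i)" and ne: "k1 \<noteq> s" "k2 \<noteq> s"
  defines "w \<equiv> shift_vel G \<rho> ub B p i"
    and "R \<equiv> \<lambda>v. unshear dt s (yl i) (unshear dt k1 (yk i k1) (unshear dt k2 (yk i k2) (unshear dt s (yr i) v)))"
  shows "transports V (\<lambda>v. w + R (v - (dt *\<^sub>R par_part (B i) (pforce G \<rho> p i) + w))) f
    (vlasov_step G V dt s k1 k2 yl yk yr \<rho> ub B p i f)"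
proof -
  have y: "yl i $ s = 0" "yr i $ s = 0" "yk i k1 $ k1 = 0" "yk i k2 $ k2 = 0"
    using sp ne by (auto simp: exact_splitting_def)
  have tl: "transports V (\<lambda>v. - a + v) g (translate V a g)" if "moment_summable V g" for a g
    using transports_translate[OF V that, of a] by simp
  have R: "linear R" unfolding R_def by (rule exact_splitting_inverse(3)[OF sp ne])
  note 1 = transports_translate[OF V f, of "dt *\<^sub>R par_part (B i) (pforce G \<rho> p i)"]
  note 2 = tl[OF transports_moment_summable[OF 1], of w]
  note 3 = transports_rotate_split[OF V transports_moment_summable[OF 2] y, of dt]
  note 4 = tl[OF transports_moment_summable[OF 3], of "- w"]
  have rot: "transports V (\<lambda>v. 0 + R v) (translate V w (translate V (dt *\<^sub>R par_part (B i) (pforce G \<rho> p i)) f))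
     (rotate_split V dt s k1 k2 (yl i) (yk i) (yr i) (translate V w (translate V (dt *\<^sub>R par_part (B i) (pforce G \<rho> p i)) f)))"
    using 3 by (simp add: R_def)
  have "transports V (\<lambda>v. - (- w) + (0 + R (- w + (v - dt *\<^sub>R par_part (B i) (pforce G \<rho> p i))))) f
      (vlasov_step G V dt s k1 k2 yl yk yr \<rho> ub B p i f)"
    unfolding vlasov_step_def Let_def w_def[symmetric]
    by (rule transports_trans[OF transports_trans[OF transports_trans[OF 1 2 linear_ident] rot R] 4 linear_ident])
  then show ?thesis by (simp add: algebra_simps)
qed

text \<open>
  The rotation maps the end point of the path, relative to \<open>w\<close>, to the argument of \<open>R\<close>
  in the transport of the mean velocity, and \<open>R\<close> inverts the rotation. Hence the new mean
  velocity is exactly the end point of the path, and the balances for the path hold for the scheme.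
\<close>

lemma cell_step:
  assumes V: "valid_vel_grid V" and f: "moment_summable V f" and dt: "0 < dt"
    and sp: "exact_splitting dt (B i) s k1 k2 (yl i) (yk i) (yr i)" and ne: "k1 \<noteq> s" "k2 \<noteq> s"
    and \<rho>: "\<rho> i = mass_density V f" "\<rho> i \<noteq> 0"
    and path: "mean_vel_path G dt tn \<rho> B p (mean_vel V f) i u (ub i)"
    and g: "g = vlasov_step G V dt s k1 k2 yl yk yr \<rho> ub B p i f"
  defines "J \<equiv> current G B (node G i)" and "P \<equiv> grad (interp G p) (node G i)"
  shows "moment V g (\<lambda>v. 1) = moment V f (\<lambda>v. 1)"
    and "moment_summable V g"
    and "mean_vel V g - mean_vel V f = dt *\<^sub>R ((J /\<^sub>R \<rho> i) \<times> B i) - dt *\<^sub>R (P /\<^sub>R \<rho> i)"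
    and "vel_vol V * (moment V g (\<lambda>v. (norm v)\<^sup>2) - moment V f (\<lambda>v. (norm v)\<^sup>2))
      = 2 * dt * (ub i \<bullet> (J \<times> B i) - ub i \<bullet> P)"
    and "(u has_integral dt *\<^sub>R ub i) {tn..tn + dt}"
proof -
  let ?w = "shift_vel G \<rho> ub B p i" and ?g = "pforce G \<rho> p i"
  let ?a = "dt *\<^sub>R par_part (B i) ?g + ?w"
  let ?E = "exp_op (\<lambda>w. - dt *\<^sub>R hat (B i) w)"
  define R where "R = (\<lambda>v. unshear dt s (yl i) (unshear dt k1 (yk i k1) (unshear dt k2 (yk i k2) (unshear dt s (yr i) v))))"
  have T: "transports V (\<lambda>v. ?w + R (v - ?a)) f g"
    unfolding g R_def by (rule transports_vlasov_step[where B = B and yl = yl and yk = yk and yr = yr, OF V f sp ne])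
  have inv: "?E (R v) = v" "R (?E v) = v" "linear R" for v
    unfolding R_def by (rule exact_splitting_inverse[OF sp ne])+
  have iso: "norm (R v) = norm v" for v
    using norm_exp_op_hat[OF less_imp_le[OF dt], of "B i" "R v"] unfolding inv(1) by simp
  have N: "moment V f (\<lambda>v. 1) \<noteq> 0" using \<rho> by (auto simp: mass_density_moment)
  note rt = rigid_transport_moments[OF V f T inv(3) iso N]
  show "moment V g (\<lambda>v. 1) = moment V f (\<lambda>v. 1)" by (rule rt(1))
  show "moment_summable V g" using T by (rule transports_moment_summable)
  have u0: "u tn = mean_vel V f"
    and du: "\<And>t. t \<in> {tn..tn + dt} \<Longrightarrow> (u has_vector_derivative
           (u t - ub i + J /\<^sub>R \<rho> i) \<times> B i - ?g) (at t within {tn..tn + dt})"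
    and ub: "ub i = (1 / dt) *\<^sub>R integral {tn..tn + dt} u"
    using path by (auto simp: mean_vel_path_def J_def pforce_def)
  have w: "?w = ub i + drift (B i) ?g - J /\<^sub>R \<rho> i" by (simp add: shift_vel_def J_def)
  \<comment> \<open>Applying \<open>R\<close> to both sides turns the end point formula into the transport formula for the mean.\<close>
  have "?E (u (tn + dt) - ?w) = mean_vel V f - ?w - dt *\<^sub>R par_part (B i) ?g"
    unfolding w u0[symmetric] by (rule path_endpoint[OF dt du ub])
  also have "\<dots> = mean_vel V f - ?a" by simp
  finally have "mean_vel V g = ?w + R (?E (u (tn + dt) - ?w))" unfolding rt(2) by (simp only:)
  then have u1: "mean_vel V g = u (tn + dt)" unfolding inv(2) by simp
  show "mean_vel V g - mean_vel V f = dt *\<^sub>R ((J /\<^sub>R \<rho> i) \<times> B i) - dt *\<^sub>R (P /\<^sub>R \<rho> i)"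
  proof -
    have "u (tn + dt) - u tn = dt *\<^sub>R ((J /\<^sub>R \<rho> i) \<times> B i - ?g)"
      by (rule path_increment[OF dt du ub])
    then show ?thesis unfolding u1 u0 by (simp add: pforce_def P_def scaleR_diff_right)
  qed
  have en: "(norm (u (tn + dt)))\<^sup>2 - (norm (u tn))\<^sup>2
      = 2 * dt * (ub i \<bullet> ((J /\<^sub>R \<rho> i) \<times> B i) - ub i \<bullet> ?g)"
    by (rule path_energy[OF dt du ub])
  have "vel_vol V * (moment V g (\<lambda>v. (norm v)\<^sup>2) - moment V f (\<lambda>v. (norm v)\<^sup>2))
      = \<rho> i * (2 * dt * (ub i \<bullet> ((J /\<^sub>R \<rho> i) \<times> B i) - ub i \<bullet> ?g))"
    unfolding rt(3) en[symmetric] u1 u0 by (simp add: \<rho>(1) mass_density_moment)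
  also have "\<dots> = 2 * dt * (ub i \<bullet> (J \<times> B i) - ub i \<bullet> P)"
  proof -
    have "ub i \<bullet> ((J /\<^sub>R \<rho> i) \<times> B i) - ub i \<bullet> ?g = (ub i \<bullet> (J \<times> B i) - ub i \<bullet> P) / \<rho> i"
      by (simp add: pforce_def P_def[symmetric] cross_mult_left divide_inverse algebra_simps)
    then show ?thesis using \<rho>(2) by simp
  qed
  finally show "vel_vol V * (moment V g (\<lambda>v. (norm v)\<^sup>2) - moment V f (\<lambda>v. (norm v)\<^sup>2))
      = 2 * dt * (ub i \<bullet> (J \<times> B i) - ub i \<bullet> P)" .
  show "(u has_integral dt *\<^sub>R ub i) {tn..tn + dt}" by (rule path_integral[OF dt du ub])
qed

section \<open>Field balances on the spatial grid\<close>

definition real_trig_field :: "space_grid \<Rightarrow> (real^3 \<Rightarrow> real^3) \<Rightarrow> bool" where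
  "real_trig_field G A \<longleftrightarrow> (\<forall>a. real_trig_poly G (\<lambda>x. A x $ a))"

lemma real_trig_fieldD: "real_trig_field G A \<Longrightarrow> real_trig_poly G (\<lambda>x. A x $ a)"
  by (simp add: real_trig_field_def)

lemma real_trig_field_vinterp:
  assumes "valid_space_grid G" "real_vinterp G h"
  shows "real_trig_field G (vinterp G h)"
  using assms real_trig_poly_interp unfolding real_trig_field_def real_vinterp_def vinterp_def by simp

lemma vinterp_node:
  assumes "valid_space_grid G" "i \<in> cells G" shows "vinterp G h (node G i) = h i"
  by (simp add: vec_eq_iff vinterp_def interp_node[OF assms])

lemma vinterp_eq_real_trig_field:
  assumes "valid_space_grid G" "real_trig_field G A" "\<And>i. i \<in> cells G \<Longrightarrow> h i = A (node G i)"
  shows "vinterp G h = A"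
proof -
  have "interp G (\<lambda>i. h i $ a) = (\<lambda>x. A x $ a)" for a
    by (rule interp_eq_real_trig_poly[OF assms(1) real_trig_fieldD[OF assms(2)]]) (simp add: assms(3))
  then show ?thesis by (simp add: fun_eq_iff vec_eq_iff vinterp_def)
qed

lemma real_trig_field_lincomb:
  assumes "real_trig_field G A" "real_trig_field G C"
  shows "real_trig_field G (\<lambda>x. a *\<^sub>R A x + b *\<^sub>R C x)"
  using assms by (simp add: real_trig_field_def real_trig_poly_lincomb)

lemma divergence_lincomb:
  assumes "real_trig_field G A" "real_trig_field G C"
  shows "divergence (\<lambda>x. a *\<^sub>R A x + b *\<^sub>R C x) x = a * divergence A x + b * divergence C x"
  by (simp add: divergence_def sum.distrib sum_distrib_left
      pderiv_at_lincomb[OF real_trig_poly_differentiable[OF real_trig_fieldD[OF assms(1)]]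
        real_trig_poly_differentiable[OF real_trig_fieldD[OF assms(2)]]])

lemma curl_nth:
  "curl A x $ 1 = pderiv_at 2 (\<lambda>y. A y $ 3) x - pderiv_at 3 (\<lambda>y. A y $ 2) x"
  "curl A x $ 2 = pderiv_at 3 (\<lambda>y. A y $ 1) x - pderiv_at 1 (\<lambda>y. A y $ 3) x"
  "curl A x $ 3 = pderiv_at 1 (\<lambda>y. A y $ 2) x - pderiv_at 2 (\<lambda>y. A y $ 1) x"
  by (simp_all add: curl_def)

lemma real_trig_poly_diff:
  "real_trig_poly G F \<Longrightarrow> real_trig_poly G H \<Longrightarrow> real_trig_poly G (\<lambda>x. F x - H x)"
  using real_trig_poly_lincomb[of G F H 1 "- 1"] by simp

lemma pderiv_at_diff:
  assumes "real_trig_poly G F" "real_trig_poly G H"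
  shows "pderiv_at a (\<lambda>x. F x - H x) x = pderiv_at a F x - pderiv_at a H x"
  using pderiv_at_lincomb[OF real_trig_poly_differentiable[OF assms(1)]
    real_trig_poly_differentiable[OF assms(2)], of a 1 "- 1"] by simp

lemma real_trig_field_curl:
  assumes "real_trig_field G A" shows "real_trig_field G (curl A)"
  unfolding real_trig_field_def forall_3 curl_nth
  by (intro conjI real_trig_poly_diff real_trig_poly_pderiv real_trig_fieldD[OF assms])

text \<open>
  Partial derivatives of trigonometric polynomials commute.
\<close>

lemma divergence_curl:
  assumes "real_trig_field G A" shows "divergence (curl A) x = 0"
proof -
  note A = real_trig_fieldD[OF assms]
  note d = pderiv_at_diff[OF real_trig_poly_pderiv[OF A] real_trig_poly_pderiv[OF A]]
  show ?thesis
    unfolding divergence_def sum_3 curl_nth d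
    using pderiv_at_commute[OF A, of 1 2 3] pderiv_at_commute[OF A, of 1 3 2] pderiv_at_commute[OF A, of 2 3 1]
    by simp
qed

lemma real_trig_poly_const:
  assumes "valid_space_grid G" shows "real_trig_poly G (\<lambda>x. c)"
proof -
  have "0 \<in> wave_vectors G"
    using assms by (force simp: wave_vectors_def valid_space_grid_def intro!: exI[of _ "0::int"])
  then have "trig_sum G (\<lambda>\<xi>. if \<xi> = 0 then of_real c else 0) x = of_real c" for x
    by (simp add: trig_sum_def if_distrib[where f = "\<lambda>z. z * _"] sum.delta cong: if_cong) (simp add: wave_def)
  then show ?thesis unfolding real_trig_poly_def real_trig_def by (metis (no_types, lifting))
qed

lemma pderiv_at_const: "pderiv_at a (\<lambda>x. c) x = 0"
  by (simp add: pderiv_at_def)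

lemma sum_pderiv_at_zero:
  assumes "valid_space_grid G" "real_trig_poly G F"
  shows "(\<Sum>i\<in>cells G. pderiv_at a F (node G i)) = 0"
  using summation_by_parts[OF assms(1) real_trig_poly_const[OF assms(1), of 1] assms(2), of a]
  by (simp add: pderiv_at_const)

lemma sum_divergence_zero:
  assumes "valid_space_grid G" "real_trig_field G A"
  shows "(\<Sum>i\<in>cells G. divergence A (node G i)) = 0"
  unfolding divergence_def
  by (subst sum.swap) (simp add: sum_pderiv_at_zero[OF assms(1) real_trig_fieldD[OF assms(2)]])

lemma sum_divergence_by_parts:
  assumes "valid_space_grid G" "real_trig_poly G F" "real_trig_field G A"
  shows "(\<Sum>i\<in>cells G. F (node G i) * divergence A (node G i))
    = - (\<Sum>i\<in>cells G. grad F (node G i) \<bullet> A (node G i))"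
proof -
  have "(\<Sum>i\<in>cells G. F (node G i) * divergence A (node G i))
      = (\<Sum>a\<in>UNIV. \<Sum>i\<in>cells G. F (node G i) * pderiv_at a (\<lambda>y. A y $ a) (node G i))"
    unfolding divergence_def sum_distrib_left by (rule sum.swap)
  also have "\<dots> = (\<Sum>a\<in>UNIV. - (\<Sum>i\<in>cells G. pderiv_at a F (node G i) * A (node G i) $ a))"
    by (intro sum.cong refl summation_by_parts assms real_trig_fieldD)
  also have "\<dots> = - (\<Sum>i\<in>cells G. grad F (node G i) \<bullet> A (node G i))"
    unfolding inner_vec_def grad_def sum_negf by (subst sum.swap) simp
  finally show ?thesis .
qed

lemma sum_curl_by_parts:
  assumes G: "valid_space_grid G" and A: "real_trig_field G A" and C: "real_trig_field G C"
  shows "(\<Sum>i\<in>cells G. A (node G i) \<bullet> curl C (node G i)) = (\<Sum>i\<in>cells G. curl A (node G i) \<bullet> C (node G i))"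
proof -
  have s: "(\<Sum>i\<in>cells G. A (node G i) $ a * pderiv_at b (\<lambda>y. C y $ c) (node G i))
    = - (\<Sum>i\<in>cells G. pderiv_at b (\<lambda>y. A y $ a) (node G i) * C (node G i) $ c)" for a b c
    by (rule summation_by_parts[OF G real_trig_fieldD[OF A] real_trig_fieldD[OF C]])
  show ?thesis
    by (simp add: inner_vec_def sum_3 curl_nth Rings.left_diff_distrib Rings.right_diff_distrib
        sum.distrib sum_subtractf s)
qed

text \<open>
  Componentwise, \<open>curl A \<times> A\<close> is the advection term with components
  \<open>\<Sum>b. A\<^sub>b \<partial>\<^sub>b A\<^sub>a\<close> minus the terms \<open>A\<^sub>b \<partial>\<^sub>a A\<^sub>b\<close>. Summation by parts turns
  the sum of the first into minus the sum of \<open>A\<^sub>a\<close> times the divergence of \<open>A\<close>,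
  and shows that each of the others has a sum equal to its own negative.
\<close>

lemma sum_lorentz_force_zero:
  assumes G: "valid_space_grid G" and A: "real_trig_field G A"
    and div: "\<And>i. i \<in> cells G \<Longrightarrow> divergence A (node G i) = 0"
  shows "(\<Sum>i\<in>cells G. curl A (node G i) \<times> A (node G i)) = 0"
proof -
  let ?d = "\<lambda>b c i. pderiv_at b (\<lambda>y. A y $ c) (node G i)" and ?A = "\<lambda>a i. A (node G i) $ a"
  have s: "(\<Sum>i\<in>cells G. ?A a i * ?d b c i) = - (\<Sum>i\<in>cells G. ?d b a i * ?A c i)" for a b c
    by (rule summation_by_parts[OF G real_trig_fieldD[OF A] real_trig_fieldD[OF A]])
  have self: "(\<Sum>i\<in>cells G. ?A b i * ?d a b i) = 0" for a b
    using s[of b a b] by (simp add: mult.commute)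
  have adv: "(\<Sum>b\<in>UNIV. \<Sum>i\<in>cells G. ?A b i * ?d b a i) = 0" for a
  proof -
    have "(\<Sum>b\<in>UNIV. \<Sum>i\<in>cells G. ?A b i * ?d b a i) = - (\<Sum>i\<in>cells G. divergence A (node G i) * ?A a i)"
      unfolding s sum_negf divergence_def sum_distrib_right by (subst sum.swap) simp
    also have "\<dots> = 0" using div by simp
    finally show ?thesis .
  qed
  have "(\<Sum>i\<in>cells G. (curl A (node G i) \<times> A (node G i)) $ a)
    = (\<Sum>b\<in>UNIV. \<Sum>i\<in>cells G. ?A b i * ?d b a i) - (\<Sum>b\<in>UNIV. \<Sum>i\<in>cells G. ?A b i * ?d a b i)" for a
  proof -
    have "(curl A (node G i) \<times> A (node G i)) $ a = (\<Sum>b\<in>UNIV. ?A b i * ?d b a i - ?A b i * ?d a b i)" for i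
    proof -
      have "\<forall>a. (curl A (node G i) \<times> A (node G i)) $ a = (\<Sum>b\<in>UNIV. ?A b i * ?d b a i - ?A b i * ?d a b i)"
        unfolding forall_3 cross_components curl_nth sum_3 by (simp add: algebra_simps)
      then show ?thesis by blast
    qed
    then have "(\<Sum>i\<in>cells G. (curl A (node G i) \<times> A (node G i)) $ a)
      = (\<Sum>i\<in>cells G. \<Sum>b\<in>UNIV. ?A b i * ?d b a i - ?A b i * ?d a b i)" by simp
    also have "\<dots> = (\<Sum>b\<in>UNIV. \<Sum>i\<in>cells G. ?A b i * ?d b a i - ?A b i * ?d a b i)"
      by (rule sum.swap)
    finally show ?thesis by (simp only: sum_subtractf)
  qed
  then show ?thesis by (simp add: vec_eq_iff adv self)
qed

lemma sum_grad_zero: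
  assumes "valid_space_grid G" "real_trig_poly G F"
  shows "(\<Sum>i\<in>cells G. grad F (node G i)) = 0"
  by (simp add: vec_eq_iff grad_def sum_pderiv_at_zero[OF assms])

lemma real_vinterp_midpoint:
  assumes G: "valid_space_grid G" and "real_vinterp G a" "real_vinterp G b"
  shows "vinterp G (midpoint_field a b) = (\<lambda>x. (1 / 2) *\<^sub>R vinterp G a x + (1 / 2) *\<^sub>R vinterp G b x)"
    and "real_trig_field G (vinterp G (midpoint_field a b))"
proof -
  have f: "real_trig_field G (\<lambda>x. (1 / 2) *\<^sub>R vinterp G a x + (1 / 2) *\<^sub>R vinterp G b x)"
    by (intro real_trig_field_lincomb real_trig_field_vinterp assms)
  show 1: "vinterp G (midpoint_field a b) = (\<lambda>x. (1 / 2) *\<^sub>R vinterp G a x + (1 / 2) *\<^sub>R vinterp G b x)"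
    by (rule vinterp_eq_real_trig_field[OF G f])
      (simp add: vinterp_node[OF G] midpoint_field_def scaleR_add_right)
  show "real_trig_field G (vinterp G (midpoint_field a b))" unfolding 1 by (rule f)
qed

lemma real_interp_midpoint:
  assumes G: "valid_space_grid G" and "real_interp G a" "real_interp G b"
  shows "real_trig_poly G (interp G (midpoint_field a b))"
proof -
  have f: "real_trig_poly G (\<lambda>x. 1 / 2 * interp G a x + 1 / 2 * interp G b x)"
    by (intro real_trig_poly_lincomb real_trig_poly_interp assms)
  have "interp G (midpoint_field a b) = (\<lambda>x. 1 / 2 * interp G a x + 1 / 2 * interp G b x)"
    by (rule interp_eq_real_trig_poly[OF G f])
      (simp add: interp_node[OF G] midpoint_field_def)
  then show ?thesis using f by simp
qed

lemma cross_triple_swap: "x \<bullet> (y \<times> z) = - (y \<bullet> (x \<times> z))" for x y z :: "real^3"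
  by (simp add: cross3_simps)

text \<open>
  The difference of the squares is twice the midpoint field times the increment, and the curl is
  self-adjoint for the sum over the nodes.
\<close>

lemma magnetic_energy_balance:
  assumes G: "valid_space_grid G" and B: "real_vinterp G B0" "real_vinterp G B1"
    and E: "real_vinterp G E"
    and step: "\<And>i. i \<in> cells G \<Longrightarrow> B1 i = B0 i + dt *\<^sub>R curl (vinterp G E) (node G i)"
  shows "(\<Sum>i\<in>cells G. (norm (B1 i))\<^sup>2) - (\<Sum>i\<in>cells G. (norm (B0 i))\<^sup>2)
    = 2 * dt * (\<Sum>i\<in>cells G. current G (midpoint_field B0 B1) (node G i) \<bullet> E i)"
proof -
  let ?Bm = "midpoint_field B0 B1"
  have "(norm (B1 i))\<^sup>2 - (norm (B0 i))\<^sup>2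
      = 2 * dt * (vinterp G ?Bm (node G i) \<bullet> curl (vinterp G E) (node G i))" if i: "i \<in> cells G" for i
  proof -
    have "(norm (B1 i))\<^sup>2 - (norm (B0 i))\<^sup>2 = 2 * (?Bm i \<bullet> (B1 i - B0 i))"
      by (simp add: midpoint_field_def power2_norm_eq_inner inner_diff_left inner_diff_right inner_add_left inner_add_right inner_commute)
    then show ?thesis using step[OF i] by (simp add: vinterp_node[OF G i])
  qed
  then have "(\<Sum>i\<in>cells G. (norm (B1 i))\<^sup>2) - (\<Sum>i\<in>cells G. (norm (B0 i))\<^sup>2)
    = 2 * dt * (\<Sum>i\<in>cells G. vinterp G ?Bm (node G i) \<bullet> curl (vinterp G E) (node G i))"
    by (simp add: sum_subtractf[symmetric] sum_distrib_left)
  also have "\<dots> = 2 * dt * (\<Sum>i\<in>cells G. current G ?Bm (node G i) \<bullet> E i)"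
    unfolding sum_curl_by_parts[OF G real_vinterp_midpoint(2)[OF G B] real_trig_field_vinterp[OF G E]]
    by (simp add: current_def vinterp_node[OF G])
  finally show ?thesis .
qed

text \<open>
  The flux term sums to zero, and the divergence is adjoint to minus the gradient; the factor
  \<open>\<gamma> - 1\<close> then cancels.
\<close>

lemma pressure_balance:
  assumes G: "valid_space_grid G" and p: "real_interp G p0" "real_interp G p1"
    and F: "real_vinterp G F" and U: "real_vinterp G U" and params: "dt \<noteq> 0" "\<gamma> \<noteq> 1"
    and step: "\<And>i. i \<in> cells G \<Longrightarrow> (p1 i - p0 i) / dt +
      (divergence (vinterp G F) (node G i)
        + (\<gamma> - 1) * midpoint_field p0 p1 i * divergence (vinterp G U) (node G i)) = 0"
  shows "1 / (\<gamma> - 1) * ((\<Sum>i\<in>cells G. p1 i) - (\<Sum>i\<in>cells G. p0 i))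
    = dt * (\<Sum>i\<in>cells G. grad (interp G (midpoint_field p0 p1)) (node G i) \<bullet> U i)"
proof -
  let ?pm = "midpoint_field p0 p1"
  have "p1 i - p0 i = - dt * divergence (vinterp G F) (node G i)
      - (\<gamma> - 1) * dt * (interp G ?pm (node G i) * divergence (vinterp G U) (node G i))" if i: "i \<in> cells G" for i
  proof -
    have "(p1 i - p0 i) / dt = - (divergence (vinterp G F) (node G i)
        + (\<gamma> - 1) * ?pm i * divergence (vinterp G U) (node G i))" using step[OF i] by linarith
    then show ?thesis using params(1) unfolding interp_node[OF G i] by (simp add: field_simps)
  qed
  then have "(\<Sum>i\<in>cells G. p1 i) - (\<Sum>i\<in>cells G. p0 i)
     = - dt * (\<Sum>i\<in>cells G. divergence (vinterp G F) (node G i))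
       - (\<gamma> - 1) * dt * (\<Sum>i\<in>cells G. interp G ?pm (node G i) * divergence (vinterp G U) (node G i))"
    by (simp add: sum_subtractf[symmetric] sum_distrib_left)
  also have "\<dots> = (\<gamma> - 1) * (dt * (\<Sum>i\<in>cells G. grad (interp G ?pm) (node G i) \<bullet> U i))"
    unfolding sum_divergence_zero[OF G real_trig_field_vinterp[OF G F]]
      sum_divergence_by_parts[OF G real_interp_midpoint[OF G p] real_trig_field_vinterp[OF G U]]
    by (simp add: vinterp_node[OF G])
  finally show ?thesis using params(2) by simp
qed

lemma magnetic_divergence_free:
  assumes G: "valid_space_grid G" and B0: "real_vinterp G B0" and E: "real_vinterp G E"
    and step: "\<And>i. i \<in> cells G \<Longrightarrow> B1 i = B0 i + dt *\<^sub>R curl (vinterp G E) (node G i)"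
  shows "divergence (vinterp G B1) x = divergence (vinterp G B0) x"
proof -
  have f: "real_trig_field G (vinterp G B0)" "real_trig_field G (vinterp G E)"
    by (intro real_trig_field_vinterp assms)+
  have "vinterp G B1 = (\<lambda>x. 1 *\<^sub>R vinterp G B0 x + dt *\<^sub>R curl (vinterp G E) x)"
    by (rule vinterp_eq_real_trig_field[OF G real_trig_field_lincomb[OF f(1) real_trig_field_curl[OF f(2)]]])
      (simp add: step vinterp_node[OF G])
  then show ?thesis
    by (simp only: divergence_lincomb[OF f(1) real_trig_field_curl[OF f(2)]] divergence_curl[OF f(2)] mult_zero_right mult_1 add_0_right)
qed

text \<open>
  The node values of the powers: work of the Lorentz and pressure forces on the ions, the electric
  field against the current, and the pressure work along the electron velocity. The contribution
  \<open>J \<bullet> (J \<times> B)\<close> vanishes and the others cancel in pairs.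
\<close>

lemma energy_exchange:
  fixes J B ub P :: "real^3" and \<rho> :: real
  shows "ub \<bullet> (J \<times> B) - ub \<bullet> P + J \<bullet> (ub \<times> B - (J /\<^sub>R \<rho>) \<times> B + P /\<^sub>R \<rho>) + P \<bullet> (ub - J /\<^sub>R \<rho>) = 0"
  unfolding cross_triple_swap[of ub J B]
  by (simp add: inner_add_right inner_diff_right cross_mult_left dot_cross_self inner_commute[of P])

section \<open>Conservation laws of the scheme\<close>

theorem theorem4p3:
  fixes G :: space_grid and V :: vel_grid
    and dt tn \<gamma> :: real
    and f0 f1 :: "nat^3 \<Rightarrow> int^3 \<Rightarrow> real"
    and B0 B1 Bm :: "nat^3 \<Rightarrow> real^3"
    and p0 p1 pm \<rho> :: "nat^3 \<Rightarrow> real"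
    and u :: "nat^3 \<Rightarrow> real \<Rightarrow> real^3"
    and ub :: "nat^3 \<Rightarrow> real^3"
    and s k1 k2 :: 3
    and yl yr :: "nat^3 \<Rightarrow> real^3" and yk :: "nat^3 \<Rightarrow> 3 \<Rightarrow> real^3"
  assumes Bm: "Bm = midpoint_field B0 B1" and pm: "pm = midpoint_field p0 p1"
    and rho: "\<rho> = (\<lambda>i. mass_density V (f0 i))"
    and grids: "valid_space_grid G" "valid_vel_grid V"
    and params: "0 < dt" "\<gamma> \<noteq> 1"
    and decay: "\<And>i. i \<in> cells G \<Longrightarrow> vel_decay V (f0 i)"
    and density_nz: "\<And>i. i \<in> cells G \<Longrightarrow> \<rho> i \<noteq> 0"
    and real_fields: "real_vinterp G B0" "real_vinterp G B1" "real_interp G p0" "real_interp G p1"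
      "real_interp G \<rho>" "real_vinterp G ub"
    and real_products: "real_vinterp G (sample G (induction_rhs G \<rho> ub Bm pm))"
      "real_vinterp G (sample G (electron_vel G \<rho> ub Bm))"
      "real_vinterp G (sample G (pressure_flux G \<rho> ub Bm pm))"
    and mean_velocity: "\<And>i. i \<in> cells G \<Longrightarrow>
      mean_vel_path G dt tn \<rho> Bm pm (mean_vel V (f0 i)) i (u i) (ub i)"
    and directions: "k1 \<noteq> s" "k2 \<noteq> s" "k1 \<noteq> k2"
    and splitting: "\<And>i. i \<in> cells G \<Longrightarrow>
      exact_splitting dt (Bm i) s k1 k2 (yl i) (yk i) (yr i)"
    and step_f: "\<And>i. i \<in> cells G \<Longrightarrow>
      f1 i = vlasov_step G V dt s k1 k2 yl yk yr \<rho> ub Bm pm i (f0 i)"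
    and step_B: "\<And>i. i \<in> cells G \<Longrightarrow>
      B1 i = B0 i + dt *\<^sub>R curl (vinterp G (sample G (induction_rhs G \<rho> ub Bm pm))) (node G i)"
    and step_p: "\<And>i. i \<in> cells G \<Longrightarrow>
      (p1 i - p0 i) / dt + pressure_residual G \<gamma> \<rho> ub Bm pm i = 0"
    and div_B0: "\<And>x. divergence (vinterp G B0) x = 0"
  shows
    "(total_mass G V f1 = total_mass G V f0 \<and>
      (\<forall>a. total_momentum G V f1 a = total_momentum G V f0 a) \<and>
      total_energy G V \<gamma> f1 B1 p1 = total_energy G V \<gamma> f0 B0 p0) \<and>
     (\<forall>i\<in>cells G.
        integral {tn..tn + dt} (\<lambda>t. u i t \<times> Bm i)
          + integral {tn..tn + dt} (\<lambda>t. (- ub i) \<times> Bm i) = 0 \<and>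
        mean_vel V (f1 i) - mean_vel V (f0 i) =
          dt *\<^sub>R ((current G Bm (node G i) /\<^sub>R \<rho> i) \<times> Bm i)
          - dt *\<^sub>R (grad (interp G pm) (node G i) /\<^sub>R \<rho> i)) \<and>
     (\<forall>x. divergence (vinterp G B1) x = 0)"
proof -
  let ?J = "\<lambda>i. current G Bm (node G i)" and ?P = "\<lambda>i. grad (interp G pm) (node G i)"
  let ?E = "induction_rhs G \<rho> ub Bm pm" and ?U = "electron_vel G \<rho> ub Bm"
  let ?F = "pressure_flux G \<rho> ub Bm pm"
  note G = grids(1) and V = grids(2) and dt = params(1)
  have f0: "moment_summable V (f0 i)" if "i \<in> cells G" for i
    using decay[OF that] by (rule vel_decay_imp_moment_summable)
  note cell = cell_step[OF V f0 dt splitting directions(1,2) fun_cong[OF rho] density_nz mean_velocity step_f]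
  have f1: "moment_summable V (f1 i)" and N: "moment V (f1 i) (\<lambda>v. 1) = moment V (f0 i) (\<lambda>v. 1)"
    and du: "mean_vel V (f1 i) - mean_vel V (f0 i) =
      dt *\<^sub>R ((?J i /\<^sub>R \<rho> i) \<times> Bm i) - dt *\<^sub>R (?P i /\<^sub>R \<rho> i)"
    and dK: "vel_vol V * (moment V (f1 i) (\<lambda>v. (norm v)\<^sup>2) - moment V (f0 i) (\<lambda>v. (norm v)\<^sup>2))
      = 2 * dt * (ub i \<bullet> (?J i \<times> Bm i) - ub i \<bullet> ?P i)"
    and ui: "(u i has_integral dt *\<^sub>R ub i) {tn..tn + dt}" if "i \<in> cells G" for i
    using cell(2,1,3,4,5)[OF that that that that that] by blast+
  have Bm_field: "real_trig_field G (vinterp G Bm)"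
    unfolding Bm by (rule real_vinterp_midpoint(2)[OF G real_fields(1,2)])
  have pm_poly: "real_trig_poly G (interp G pm)"
    unfolding pm by (rule real_interp_midpoint[OF G real_fields(3,4)])

  have stepE: "B1 i = B0 i + dt *\<^sub>R curl (vinterp G (sample G ?E)) (node G i)" if "i \<in> cells G" for i
    by (rule step_B[OF that])
  have div_B1: "divergence (vinterp G B1) x = 0" for x
    using magnetic_divergence_free[OF G real_fields(1) real_products(1) stepE] div_B0 by simp
  have div_Bm: "divergence (vinterp G Bm) x = 0" for x
    unfolding Bm real_vinterp_midpoint(1)[OF G real_fields(1,2)]
      divergence_lincomb[OF real_trig_field_vinterp[OF G real_fields(1)] real_trig_field_vinterp[OF G real_fields(2)]]
      div_B0 div_B1 by simp

  have mass: "total_mass G V f1 = total_mass G V f0"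
  proof -
    have "total_mass G V f = (\<Sum>i\<in>cells G. moment V (f i) (\<lambda>v. 1) * space_vol G * vel_vol V)" for f
      unfolding total_mass_def moment_def infsum_cmult_left' by simp
    then show ?thesis by (simp add: N)
  qed

  have momentum: "total_momentum G V f1 a = total_momentum G V f0 a" for a
  proof -
    \<comment> \<open>Mass is conserved cell by cell, so \<open>\<rho>\<close> is the density at both time levels.\<close>
    have mom: "total_momentum G V f a = (\<Sum>i\<in>cells G. \<rho> i * mean_vel V (f i) $ a) * space_vol G"
      if ms: "\<And>i. i \<in> cells G \<Longrightarrow> moment_summable V (f i)"
        and ns: "\<And>i. i \<in> cells G \<Longrightarrow> moment V (f i) (\<lambda>v. 1) = moment V (f0 i) (\<lambda>v. 1)" for f
    proof -
      have "(\<Sum>\<^sub>\<infinity>j. vel V j $ a * f i j * space_vol G * vel_vol V) = \<rho> i * mean_vel V (f i) $ a * space_vol G"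
        if i: "i \<in> cells G" for i
      proof -
        have "(\<Sum>\<^sub>\<infinity>j. vel V j $ a * f i j * space_vol G * vel_vol V)
            = moment V (f i) (\<lambda>v. v $ a) * space_vol G * vel_vol V"
          unfolding moment_def infsum_cmult_left' ..
        moreover have "moment V (f i) (\<lambda>v. v $ a) = first_moment V (f i) $ a"
          by (rule moment_linear[OF ms[OF i]]) (rule linearI; simp)
        moreover have "\<rho> i * mean_vel V (f i) $ a = vel_vol V * first_moment V (f i) $ a"
          using density_nz[OF i] unfolding mean_vel_first_moment[OF V ms[OF i]] ns[OF i] rho
          by (simp add: mass_density_moment)
        ultimately show ?thesis by simp
      qed
      then show ?thesis by (simp add: total_momentum_def sum_distrib_right)
    qed
    have rc: "\<rho> i * (dt * inverse (\<rho> i)) = dt" if "i \<in> cells G" for i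
      using density_nz[OF that] by simp
    have "(\<Sum>i\<in>cells G. \<rho> i *\<^sub>R (mean_vel V (f1 i) - mean_vel V (f0 i)))
        = (\<Sum>i\<in>cells G. dt *\<^sub>R (?J i \<times> vinterp G Bm (node G i)) - dt *\<^sub>R ?P i)"
      by (rule sum.cong[OF refl])
        (simp add: du rc scaleR_diff_right cross_mult_left vinterp_node[OF G])
    also have "\<dots> = 0"
      unfolding sum_subtractf scaleR_sum_right[symmetric] current_def
        sum_lorentz_force_zero[OF G Bm_field div_Bm] sum_grad_zero[OF G pm_poly] by simp
    finally have "(\<Sum>i\<in>cells G. \<rho> i *\<^sub>R (mean_vel V (f1 i) - mean_vel V (f0 i))) $ a = 0" by simp
    then have "(\<Sum>i\<in>cells G. \<rho> i * mean_vel V (f1 i) $ a) = (\<Sum>i\<in>cells G. \<rho> i * mean_vel V (f0 i) $ a)"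
      by (simp add: Rings.right_diff_distrib sum_subtractf)
    then show ?thesis using mom[OF f1 N] mom[OF f0 refl] by simp
  qed

  have energy: "total_energy G V \<gamma> f1 B1 p1 = total_energy G V \<gamma> f0 B0 p0"
  proof -
    let ?K = "\<lambda>f. \<Sum>i\<in>cells G. moment V (f i) (\<lambda>v. (norm v)\<^sup>2)"
    have tot: "total_energy G V \<gamma> f B p = space_vol G * (1 / 2 * (vel_vol V * ?K f)
        + 1 / 2 * (\<Sum>i\<in>cells G. (norm (B i))\<^sup>2) + 1 / (\<gamma> - 1) * (\<Sum>i\<in>cells G. p i))" for f B p
      unfolding total_energy_def moment_def infsum_cmult_left' sum_distrib_right[symmetric]
      by (simp add: algebra_simps)
    have kin: "1 / 2 * (vel_vol V * ?K f1) - 1 / 2 * (vel_vol V * ?K f0)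
        = dt * (\<Sum>i\<in>cells G. ub i \<bullet> (?J i \<times> Bm i) - ub i \<bullet> ?P i)"
    proof -
      have "vel_vol V * ?K f1 - vel_vol V * ?K f0 = (\<Sum>i\<in>cells G.
          vel_vol V * (moment V (f1 i) (\<lambda>v. (norm v)\<^sup>2) - moment V (f0 i) (\<lambda>v. (norm v)\<^sup>2)))"
        by (simp only: sum_distrib_left sum_subtractf Rings.right_diff_distrib)
      also have "\<dots> = 2 * dt * (\<Sum>i\<in>cells G. ub i \<bullet> (?J i \<times> Bm i) - ub i \<bullet> ?P i)"
        unfolding sum_distrib_left by (rule sum.cong[OF refl dK])
      finally show ?thesis by simp
    qed
    have mag: "1 / 2 * (\<Sum>i\<in>cells G. (norm (B1 i))\<^sup>2) - 1 / 2 * (\<Sum>i\<in>cells G. (norm (B0 i))\<^sup>2)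
        = dt * (\<Sum>i\<in>cells G. ?J i \<bullet> sample G ?E i)"
      using magnetic_energy_balance[OF G real_fields(1,2) real_products(1) stepE] unfolding Bm[symmetric] by simp
    have pre: "1 / (\<gamma> - 1) * ((\<Sum>i\<in>cells G. p1 i) - (\<Sum>i\<in>cells G. p0 i))
        = dt * (\<Sum>i\<in>cells G. ?P i \<bullet> sample G ?U i)"
      unfolding pm
    proof (rule pressure_balance[OF G real_fields(3,4) real_products(3,2) _ params(2)])
      show "(p1 i - p0 i) / dt + (divergence (vinterp G (sample G ?F)) (node G i)
          + (\<gamma> - 1) * midpoint_field p0 p1 i * divergence (vinterp G (sample G ?U)) (node G i)) = 0"
        if "i \<in> cells G" for i
        using step_p[OF that] unfolding pressure_residual_def pm .
    qed (use dt in simp)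
    have "(\<Sum>i\<in>cells G. ub i \<bullet> (?J i \<times> Bm i) - ub i \<bullet> ?P i) + (\<Sum>i\<in>cells G. ?J i \<bullet> sample G ?E i)
        + (\<Sum>i\<in>cells G. ?P i \<bullet> sample G ?U i) = 0"
      unfolding sum.distrib[symmetric]
    proof (rule sum.neutral, rule ballI)
      fix i assume i: "i \<in> cells G"
      show "ub i \<bullet> (?J i \<times> Bm i) - ub i \<bullet> ?P i + ?J i \<bullet> sample G ?E i + ?P i \<bullet> sample G ?U i = 0"
        unfolding sample_def induction_rhs_def electron_vel_def vinterp_node[OF G i] interp_node[OF G i]
        by (rule energy_exchange)
    qed
    then have "dt * (\<Sum>i\<in>cells G. ub i \<bullet> (?J i \<times> Bm i) - ub i \<bullet> ?P i) + dt * (\<Sum>i\<in>cells G. ?J i \<bullet> sample G ?E i)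
        + dt * (\<Sum>i\<in>cells G. ?P i \<bullet> sample G ?U i) = 0"
      unfolding distrib_left[symmetric] by simp
    then have "(1 / 2 * (vel_vol V * ?K f1) + 1 / 2 * (\<Sum>i\<in>cells G. (norm (B1 i))\<^sup>2) + 1 / (\<gamma> - 1) * (\<Sum>i\<in>cells G. p1 i))
      = (1 / 2 * (vel_vol V * ?K f0) + 1 / 2 * (\<Sum>i\<in>cells G. (norm (B0 i))\<^sup>2) + 1 / (\<gamma> - 1) * (\<Sum>i\<in>cells G. p0 i))"
      unfolding kin[symmetric] mag[symmetric] pre[symmetric] Rings.right_diff_distrib by linarith
    then show ?thesis unfolding tot by (rule arg_cong)
  qed

  have cancellation: "integral {tn..tn + dt} (\<lambda>t. u i t \<times> Bm i)
      + integral {tn..tn + dt} (\<lambda>t. (- ub i) \<times> Bm i) = 0" if i: "i \<in> cells G" for i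
  proof -
    have "((\<lambda>t. hat (Bm i) (u i t)) has_integral hat (Bm i) (dt *\<^sub>R ub i)) {tn..tn + dt}"
      using has_integral_linear[OF ui[OF i] bounded_linear_hat] by (simp only: o_def)
    then have "integral {tn..tn + dt} (\<lambda>t. u i t \<times> Bm i) = dt *\<^sub>R (ub i \<times> Bm i)"
      by (simp add: hat_def cross_mult_left integral_unique)
    then show ?thesis using dt by simp
  qed
  show ?thesis using mass momentum energy cancellation du div_B1 by blast
qed

end
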